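(* There is an algorithm which, given any feasible instance $I$ of 2-TSP with Vertex Requisitions (2-TSPVR) with $n\ge 2$ vertices, computes an optimal solution $f^*\in F$, i.e. $\rho(f^* )=\min_{f\in F}\rho(f)$, in time $O\left(q(\bar G)\,2^{q(\bar G)}+n\right)$, where $\bar G$ is the bipartite graph of the instance and $q(\bar G)$ is its number of cycles, both as defined in the context.
   Context: 2-TSPVR. An instance $I$ consists of a set $X=\{x_1,\dots,x_n\}$ of vertices of a complete digraph with non-negative arc weights $\rho(x,y)$, $x\ne y$, and subsets (requisitions) $X^1,\dots,X^n\subseteq X$ with $1\le |X^i|\le 2$ for all $i$. $F$ is the set of bijections $f:\{1,\dots,n\}\to X$ with $f(i)\in X^i$ for all $i$; the instance is feasible if $F\neq\emptyset$. The cost of $f\in F$ is $\rho(f)=\sum_{i=1}^{n-1}\rho(f(i),f(i+1))+\rho(f(n),f(1))$, to be minimized over $F$. Indices are cyclic ($n+1:=1$). Only the arcs that start in $X^i$ and end in $X^{i+1}$ for some $i\in\{1,\dots,n\}$ are given in the input (so the input has size $O(n)$; the weights $\rho(x,y)$ with $x\in X^i$, $y\in X^{i+1}$ are accessible in constant time from $i$). Time is counted with arithmetic operations and comparisons on weights taking unit time (standard unit-cost random access machine). Bipartite graph. Let $X_n=\{1,\dots,n\}$ and let $\bar G=(X_n,X,\bar U)$ be the bipartite graph with edge set $\bar U=\{\{i,x\}: i\in X_n,\ x\in X^i\}$. Feasible solutions $f\in F$ correspond one-to-one to perfect matchings of $\bar G$. An edge is special if it belongs to all perfect matchings of $\bar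 G$; a vertex is special if it is incident with a special edge. For a feasible instance, let $\bar G'$ be the graph obtained from $\bar G$ by deleting all special vertices; $\bar G'$ is 2-regular, so its components are even cycles. $q(\bar G)$ denotes the number of these cycles. *)

theory Defs
  imports Complex_Main "HOL-Library.FuncSet"
begin

section \<open>2-TSP with Vertex Requisitions\<close>

text \<open>
  The vertex \<open>x_j\<close> is identified with its index \<open>j\<close>, so that \<open>X = {1..n}\<close>; this is also how
  an algorithm refers to vertices.
\<close>

record tspvr =
  num :: nat
  req :: "nat \<Rightarrow> nat set"
  weight :: "nat \<Rightarrow> nat \<Rightarrow> real"

definition tspvr_instance :: "tspvr \<Rightarrow> bool" where
  "tspvr_instance I \<longleftrightarrow>
     (\<forall>i\<in>{1..num I}. req I i \<subseteq> {1..num I} \<and> 1 \<le> card (req I i) \<and> card (req I i) \<le> 2) \<and>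
     (\<forall>x\<in>{1..num I}. \<forall>y\<in>{1..num I}. x \<noteq> y \<longrightarrow> 0 \<le> weight I x y)"

definition solutions :: "tspvr \<Rightarrow> (nat \<Rightarrow> nat) set" where
  "solutions I = {f \<in> {1..num I} \<rightarrow>\<^sub>E {1..num I}.
     bij_betw f {1..num I} {1..num I} \<and> (\<forall>i\<in>{1..num I}. f i \<in> req I i)}"

definition feasible :: "tspvr \<Rightarrow> bool" where
  "feasible I \<longleftrightarrow> solutions I \<noteq> {}"

definition cost :: "tspvr \<Rightarrow> (nat \<Rightarrow> nat) \<Rightarrow> real" where
  "cost I f = (\<Sum>i = 1..<num I. weight I (f i) (f (i + 1))) + weight I (f (num I)) (f 1)"

definition optimal :: "tspvr \<Rightarrow> (nat \<Rightarrow> nat) \<Rightarrow> bool" where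
  "optimal I f \<longleftrightarrow> f \<in> solutions I \<and> cost I f = Min (cost I ` solutions I)"


section \<open>The bipartite graph and its number of cycles\<close>

text \<open>\<open>Inl i\<close> is the position \<open>i\<close>, and \<open>Inr x\<close> is the vertex \<open>x\<close> of the digraph.\<close>

definition bip_verts :: "tspvr \<Rightarrow> (nat + nat) set" where
  "bip_verts I = Inl ` {1..num I} \<union> Inr ` {1..num I}"

definition bip_edges :: "tspvr \<Rightarrow> (nat + nat) set set" where
  "bip_edges I = {{Inl i, Inr x} | i x. i \<in> {1..num I} \<and> x \<in> req I i}"

definition perfect_matching :: "'v set \<Rightarrow> 'v set set \<Rightarrow> 'v set set \<Rightarrow> bool" where
  "perfect_matching V E M \<longleftrightarrow> M \<subseteq> E \<and> (\<forall>v\<in>V. \<exists>!e. e \<in> M \<and> v \<in> e)"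

definition special_edge :: "'v set \<Rightarrow> 'v set set \<Rightarrow> 'v set \<Rightarrow> bool" where
  "special_edge V E e \<longleftrightarrow> e \<in> E \<and> (\<forall>M. perfect_matching V E M \<longrightarrow> e \<in> M)"

definition special_vertex :: "'v set \<Rightarrow> 'v set set \<Rightarrow> 'v \<Rightarrow> bool" where
  "special_vertex V E v \<longleftrightarrow> (\<exists>e. special_edge V E e \<and> v \<in> e)"

definition components :: "'v set \<Rightarrow> 'v set set \<Rightarrow> 'v set set" where
  "components V E = (\<lambda>v. {u. (v, u) \<in> {(a, b). {a, b} \<in> E}\<^sup>*}) ` V"

definition reduced_verts :: "tspvr \<Rightarrow> (nat + nat) set" where
  "reduced_verts I = {v \<in> bip_verts I. \<not> special_vertex (bip_verts I) (bip_edges I) v}"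

definition reduced_edges :: "tspvr \<Rightarrow> (nat + nat) set set" where
  "reduced_edges I = {e \<in> bip_edges I. e \<subseteq> reduced_verts I}"

text \<open>
  For a feasible instance the graph left after deleting the special vertices is 2-regular, so its
  cycles are its connected components.
\<close>

definition num_cycles :: "tspvr \<Rightarrow> nat" where
  "num_cycles I = card (components (reduced_verts I) (reduced_edges I))"


section \<open>Unit-cost random access machine\<close>

text \<open>
  The machine has index (natural number) and weight (real) data, each with directly addressed
  registers and an unbounded memory reached only through addresses held in index registers.
  Subtraction of indices is truncated. Weights can be inspected only by comparing them.
  There is no multiplication, so that unit cost cannot be abused by operating on huge numbers.
\<close>

datatype instr =
    Const nat nat
  | Add nat nat nat
  | Sub nat nat nat
  | Load nat nat
  | Store nat nat
  | WAdd nat nat nat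
  | WSub nat nat nat
  | WLoad nat nat
  | WStore nat nat
  | Jump nat
  | JumpLe nat nat nat
  | WJumpLe nat nat nat

record ram =
  pc :: nat
  reg :: "nat \<Rightarrow> nat"
  mem :: "nat \<Rightarrow> nat"
  wreg :: "nat \<Rightarrow> real"
  wmem :: "nat \<Rightarrow> real"

definition goto :: "nat \<Rightarrow> ram \<Rightarrow> ram" where
  "goto l s = s\<lparr>pc := l\<rparr>"

definition next_pc :: "ram \<Rightarrow> ram" where
  "next_pc s = s\<lparr>pc := pc s + 1\<rparr>"

fun exec :: "instr \<Rightarrow> ram \<Rightarrow> ram" where
  "exec (Const r c) s = next_pc (s\<lparr>reg := (reg s)(r := c)\<rparr>)"
| "exec (Add r a b) s = next_pc (s\<lparr>reg := (reg s)(r := reg s a + reg s b)\<rparr>)"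
| "exec (Sub r a b) s = next_pc (s\<lparr>reg := (reg s)(r := reg s a - reg s b)\<rparr>)"
| "exec (Load r a) s = next_pc (s\<lparr>reg := (reg s)(r := mem s (reg s a))\<rparr>)"
| "exec (Store a r) s = next_pc (s\<lparr>mem := (mem s)(reg s a := reg s r)\<rparr>)"
| "exec (WAdd r a b) s = next_pc (s\<lparr>wreg := (wreg s)(r := wreg s a + wreg s b)\<rparr>)"
| "exec (WSub r a b) s = next_pc (s\<lparr>wreg := (wreg s)(r := wreg s a - wreg s b)\<rparr>)"
| "exec (WLoad r a) s = next_pc (s\<lparr>wreg := (wreg s)(r := wmem s (reg s a))\<rparr>)"
| "exec (WStore a r) s = next_pc (s\<lparr>wmem := (wmem s)(reg s a := wreg s r)\<rparr>)"
| "exec (Jump l) s = goto l s"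
| "exec (JumpLe a b l) s = (if reg s a \<le> reg s b then goto l s else next_pc s)"
| "exec (WJumpLe a b l) s = (if wreg s a \<le> wreg s b then goto l s else next_pc s)"

definition halted :: "instr list \<Rightarrow> ram \<Rightarrow> bool" where
  "halted p s \<longleftrightarrow> length p \<le> pc s"

definition step :: "instr list \<Rightarrow> ram \<Rightarrow> ram" where
  "step p s = (if halted p s then s else exec (p ! pc s) s)"


section \<open>Input and output\<close>

text \<open>
  Index memory: \<open>n\<close> at address \<open>0\<close>, and the two elements of \<open>X^i\<close> (twice the same one if
  \<open>X^i\<close> is a singleton) at addresses \<open>2 i - 1\<close> and \<open>2 i\<close>.
  Weight memory: the at most four arcs from \<open>X^i\<close> to \<open>X^(i+1)\<close> at addresses
  \<open>4 (i - 1), ..., 4 (i - 1) + 3\<close>, where a slot with equal end points, which is no arc, holds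
  \<open>0\<close>. Nothing else is given; all other cells are \<open>0\<close>.
\<close>

definition cyc_next :: "nat \<Rightarrow> nat \<Rightarrow> nat" where
  "cyc_next n i = (if i = n then 1 else i + 1)"

definition req_elem :: "tspvr \<Rightarrow> nat \<Rightarrow> nat \<Rightarrow> nat" where
  "req_elem I i k = (if k = 0 then Min (req I i) else Max (req I i))"

definition arc_weight :: "tspvr \<Rightarrow> nat \<Rightarrow> nat \<Rightarrow> real" where
  "arc_weight I x y = (if x = y then 0 else weight I x y)"

definition input_mem :: "tspvr \<Rightarrow> nat \<Rightarrow> nat" where
  "input_mem I a =
     (if a = 0 then num I
      else if a \<le> 2 * num I then req_elem I ((a + 1) div 2) ((a + 1) mod 2)
      else 0)"

definition input_wmem :: "tspvr \<Rightarrow> nat \<Rightarrow> real" where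
  "input_wmem I a =
     (if a < 4 * num I then
        (let i = a div 4 + 1 in
         arc_weight I (req_elem I i (a mod 4 div 2)) (req_elem I (cyc_next (num I) i) (a mod 2)))
      else 0)"

definition init :: "tspvr \<Rightarrow> ram" where
  "init I = \<lparr>pc = 0, reg = (\<lambda>_. 0), mem = input_mem I, wreg = (\<lambda>_. 0), wmem = input_wmem I\<rparr>"

text \<open>The value \<open>f(i)\<close> of the computed solution is read off at address \<open>i\<close>.\<close>

definition ram_output :: "tspvr \<Rightarrow> ram \<Rightarrow> nat \<Rightarrow> nat" where
  "ram_output I s = restrict (mem s) {1..num I}"

end

theory Submission
  imports Defs "HOL-Library.Nat_Bijection"
begin

text \<open>
  Regard the positions as edges joining the (one or two) vertices of their requisitions. A vertex of
  degree 1 forces its only position, which can then be removed together with the vertex. When no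
  such vertex is left, feasibility and counting show that all remaining degrees are 2, so that what
  remains is a union of cycles and of double edges that stem from requisitions with one vertex. It
  suffices to store for every vertex its degree and the sum of its positions: the sum reveals the
  position of a vertex of degree 1, and it leads from one position of a vertex of degree 2 to the
  other. Hence all this takes linear time.

  Every cycle can be matched in two ways independently of the others, and each arc of the tour
  depends on at most two cycles. So the cost is a constant plus a quadratic form
  \<open>\<Sum>c\<in>S. \<Sum>d\<in>S. B c d\<close> in the set \<open>S\<close> of cycles that are matched in the second way, and the
  coefficients are collected in linear time. The costs of all \<open>2 ^ q\<close> sets are tabulated by
  adding one cycle at a time: \<open>T (S \<union> {c}) = T S + D S\<close> for \<open>S \<subseteq> {..<c}\<close>, where
  \<open>D S = B c c + (\<Sum>d\<in>S. B c d + B d c)\<close> is tabulated in the same manner.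
\<close>

section \<open>A structured language on top of the machine\<close>

text \<open>Two obstacles come from the machine. It can neither multiply nor halve, so the row
  starts \<open>c * n\<close> and the powers of two are tabulated by repeated addition. The tables
  double in length, so their price is a geometric series O(2^q), even below the allowed q 2^q; the
  summand n covers the case q = 0.

  That a traversed component is a cycle is never stated as graph theory. The walk carries a
  statement about all solutions instead: on the positions with a common label a solution takes the
  first option everywhere or the second option everywhere. With the independence of the labels this
  yields optimality. The bipartite graph enters at one place only, where the counter
  \<open>q\<close> of the program is bounded by the number of components.

  A double edge is walked like a cycle but not counted. It may share its label with other positions,
  since its two options coincide.\<close>

datatype aexp = N nat | V nat | Plus aexp aexp | Minus aexp aexp | Ld aexp

datatype wexp = WV nat | WPlus wexp wexp | WMinus wexp wexp | WLd aexp

datatype bexp = Le aexp aexp | WLe wexp wexp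

datatype atom = Assign nat aexp | Put aexp aexp | WAssign nat wexp | WPut aexp wexp

datatype com = Block "atom list" | Seq com com (infixr ";;" 60) | If bexp com com | While bexp com

record store =
  var :: "nat \<Rightarrow> nat"
  imem :: "nat \<Rightarrow> nat"
  wvar :: "nat \<Rightarrow> real"
  rmem :: "nat \<Rightarrow> real"

fun aval :: "aexp \<Rightarrow> store \<Rightarrow> nat" where
  "aval (N c) s = c"
| "aval (V r) s = var s r"
| "aval (Plus a b) s = aval a s + aval b s"
| "aval (Minus a b) s = aval a s - aval b s"
| "aval (Ld a) s = imem s (aval a s)"

fun wval :: "wexp \<Rightarrow> store \<Rightarrow> real" where
  "wval (WV r) s = wvar s r"
| "wval (WPlus a b) s = wval a s + wval b s"
| "wval (WMinus a b) s = wval a s - wval b s"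
| "wval (WLd a) s = rmem s (aval a s)"

fun bval :: "bexp \<Rightarrow> store \<Rightarrow> bool" where
  "bval (Le a b) s \<longleftrightarrow> aval a s \<le> aval b s"
| "bval (WLe a b) s \<longleftrightarrow> wval a s \<le> wval b s"

fun atom_sem :: "atom \<Rightarrow> store \<Rightarrow> store" where
  "atom_sem (Assign r a) s = s\<lparr>var := (var s)(r := aval a s)\<rparr>"
| "atom_sem (Put a b) s = s\<lparr>imem := (imem s)(aval a s := aval b s)\<rparr>"
| "atom_sem (WAssign r a) s = s\<lparr>wvar := (wvar s)(r := wval a s)\<rparr>"
| "atom_sem (WPut a b) s = s\<lparr>rmem := (rmem s)(aval a s := wval b s)\<rparr>"

text \<open>
  Registers below \<open>100\<close> hold the variables; the code of an expression leaves its value in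
  register \<open>t \<ge> 100\<close> and overwrites only registers from \<open>t\<close> on.
\<close>

fun acode :: "aexp \<Rightarrow> nat \<Rightarrow> instr list" where
  "acode (N c) t = [Const t c]"
| "acode (V r) t = [Const t 0, Add t t r]"
| "acode (Plus a b) t = acode a t @ acode b (t + 1) @ [Add t t (t + 1)]"
| "acode (Minus a b) t = acode a t @ acode b (t + 1) @ [Sub t t (t + 1)]"
| "acode (Ld a) t = acode a t @ [Load t t]"

text \<open>No instruction creates a weight constant; \<open>r - r\<close> supplies the zero that a
  move needs. The address code of \<open>WLd\<close> may use index register \<open>100\<close>
  freely, because pending weight operands sit in weight registers.\<close>

fun wcode :: "wexp \<Rightarrow> nat \<Rightarrow> instr list" where
  "wcode (WV r) t = [WSub t r r, WAdd t t r]"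
| "wcode (WPlus a b) t = wcode a t @ wcode b (t + 1) @ [WAdd t t (t + 1)]"
| "wcode (WMinus a b) t = wcode a t @ wcode b (t + 1) @ [WSub t t (t + 1)]"
| "wcode (WLd a) t = acode a 100 @ [WLoad t 100]"

fun bcode :: "bexp \<Rightarrow> instr list" where
  "bcode (Le a b) = acode a 100 @ acode b 101"
| "bcode (WLe a b) = wcode a 100 @ wcode b 101"

fun bjump :: "bexp \<Rightarrow> nat \<Rightarrow> instr" where
  "bjump (Le a b) = JumpLe 100 101"
| "bjump (WLe a b) = WJumpLe 100 101"

text \<open>\<open>Const 101 0, Add r 100 101\<close> moves register \<open>100\<close> to \<open>r\<close>.\<close>

fun atom_code :: "atom \<Rightarrow> instr list" where
  "atom_code (Assign r a) = acode a 100 @ [Const 101 0, Add r 100 101]"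
| "atom_code (Put a b) = acode a 100 @ acode b 101 @ [Store 100 101]"
| "atom_code (WAssign r a) = wcode a 100 @ [WSub 101 100 100, WAdd r 100 101]"
| "atom_code (WPut a b) = wcode b 100 @ acode a 100 @ [WStore 100 100]"

definition block_code :: "atom list \<Rightarrow> instr list" where
  "block_code as = concat (map atom_code as)"

fun com_code :: "com \<Rightarrow> nat \<Rightarrow> instr list" where
  "com_code (Block as) k = block_code as"
| "com_code (c ;; d) k = (let cc = com_code c k in cc @ com_code d (k + length cc))"
| "com_code (If b c d) k =
     (let k1 = k + length (bcode b) + 1; dd = com_code d k1;
          k2 = k1 + length dd + 1; cc = com_code c k2
      in bcode b @ [bjump b k2] @ dd @ [Jump (k2 + length cc)] @ cc)"
| "com_code (While b c) k =
     (let k1 = k + length (bcode b) + 2; cc = com_code c k1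
      in bcode b @ [bjump b k1, Jump (k1 + length cc + 1)] @ cc @ [Jump k])"

text \<open>Straight-line code performs one step per instruction, so its length is its exact time.
  All constants of the final bound are built from such lengths and are thus independent of the
  instance.\<close>

definition bcost :: "atom list \<Rightarrow> nat" where
  "bcost as = length (block_code as)"

definition tcost :: "bexp \<Rightarrow> nat" where
  "tcost b = length (bcode b)"

text \<open>Time is the exact number of machine steps. The extra units are the jumps of
  \<open>com_code\<close>: the conditional jump after every test; in \<open>If\<close>, whose false
  branch is laid out first, the jump over the true branch; in \<open>While\<close>, the jump to the
  exit or back to the test.\<close>

inductive runs :: "com \<Rightarrow> store \<Rightarrow> nat \<Rightarrow> store \<Rightarrow> bool" where
  runs_block: "runs (Block as) s (bcost as) (fold atom_sem as s)"
| runs_seq: "\<lbrakk>runs c s t s'; runs d s' t' s''\<rbrakk> \<Longrightarrow> runs (c ;; d) s (t + t') s''"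
| runs_if_true: "\<lbrakk>bval b s; runs c s t s'\<rbrakk> \<Longrightarrow> runs (If b c d) s (tcost b + 1 + t) s'"
| runs_if_false: "\<lbrakk>\<not> bval b s; runs d s t s'\<rbrakk> \<Longrightarrow> runs (If b c d) s (tcost b + 1 + (t + 1)) s'"
| runs_while_false: "\<not> bval b s \<Longrightarrow> runs (While b c) s (tcost b + 1 + 1) s"
| runs_while_true: "\<lbrakk>bval b s; runs c s t s'; runs (While b c) s' t' s''\<rbrakk>
    \<Longrightarrow> runs (While b c) s (tcost b + 1 + (t + (1 + t'))) s''"

fun aexp_ok :: "aexp \<Rightarrow> bool" where
  "aexp_ok (N c) \<longleftrightarrow> True"
| "aexp_ok (V r) \<longleftrightarrow> r < 100"
| "aexp_ok (Plus a b) \<longleftrightarrow> aexp_ok a \<and> aexp_ok b"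
| "aexp_ok (Minus a b) \<longleftrightarrow> aexp_ok a \<and> aexp_ok b"
| "aexp_ok (Ld a) \<longleftrightarrow> aexp_ok a"

fun wexp_ok :: "wexp \<Rightarrow> bool" where
  "wexp_ok (WV r) \<longleftrightarrow> r < 100"
| "wexp_ok (WPlus a b) \<longleftrightarrow> wexp_ok a \<and> wexp_ok b"
| "wexp_ok (WMinus a b) \<longleftrightarrow> wexp_ok a \<and> wexp_ok b"
| "wexp_ok (WLd a) \<longleftrightarrow> aexp_ok a"

fun bexp_ok :: "bexp \<Rightarrow> bool" where
  "bexp_ok (Le a b) \<longleftrightarrow> aexp_ok a \<and> aexp_ok b"
| "bexp_ok (WLe a b) \<longleftrightarrow> wexp_ok a \<and> wexp_ok b"

fun atom_wf :: "atom \<Rightarrow> bool" where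
  "atom_wf (Assign r a) \<longleftrightarrow> r < 100 \<and> aexp_ok a"
| "atom_wf (Put a b) \<longleftrightarrow> aexp_ok a \<and> aexp_ok b"
| "atom_wf (WAssign r a) \<longleftrightarrow> r < 100 \<and> wexp_ok a"
| "atom_wf (WPut a b) \<longleftrightarrow> aexp_ok a \<and> wexp_ok b"

fun com_ok :: "com \<Rightarrow> bool" where
  "com_ok (Block as) \<longleftrightarrow> list_all atom_wf as"
| "com_ok (c ;; d) \<longleftrightarrow> com_ok c \<and> com_ok d"
| "com_ok (If b c d) \<longleftrightarrow> bexp_ok b \<and> com_ok c \<and> com_ok d"
| "com_ok (While b c) \<longleftrightarrow> bexp_ok b \<and> com_ok c"

section \<open>Simulation of the language by the machine\<close>

definition implements :: "ram \<Rightarrow> store \<Rightarrow> bool" where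
  "implements r s \<longleftrightarrow> (\<forall>x<100. reg r x = var s x \<and> wreg r x = wvar s x) \<and>
     mem r = imem s \<and> wmem r = rmem s"

definition code_at :: "instr list \<Rightarrow> nat \<Rightarrow> instr list \<Rightarrow> bool" where
  "code_at p k is \<longleftrightarrow> (\<forall>j<length is. k + j < length p \<and> p ! (k + j) = is ! j)"

lemma code_at_Nil: "code_at p k []"
  by (simp add: code_at_def)

lemma code_at_Cons:
  "code_at p k (x # xs) \<longleftrightarrow> k < length p \<and> p ! k = x \<and> code_at p (k + 1) xs"
  by (simp add: code_at_def All_less_Suc2)

lemma code_at_append:
  "code_at p k (xs @ ys) \<longleftrightarrow> code_at p k xs \<and> code_at p (k + length xs) ys"
  by (induction xs arbitrary: k) (simp_all add: code_at_Nil code_at_Cons)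

fun is_jump :: "instr \<Rightarrow> bool" where
  "is_jump (Jump l) \<longleftrightarrow> True"
| "is_jump (JumpLe a b l) \<longleftrightarrow> True"
| "is_jump (WJumpLe a b l) \<longleftrightarrow> True"
| "is_jump _ \<longleftrightarrow> False"

lemma pc_exec: "\<not> is_jump x \<Longrightarrow> pc (exec x r) = pc r + 1"
  by (cases x) (auto simp: next_pc_def)

lemma step_straight:
  assumes "list_all (Not \<circ> is_jump) is" "code_at p (pc r) is"
  shows "(step p ^^ length is) r = fold exec is r \<and> pc (fold exec is r) = pc r + length is"
  using assms
proof (induction "is" arbitrary: r)
  case (Cons x xs)
  have "step p r = exec x r" using Cons.prems by (auto simp: code_at_Cons step_def halted_def)
  moreover have "pc (exec x r) = pc r + 1" using Cons.prems pc_exec by auto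
  moreover have "code_at p (pc r + 1) xs" using Cons.prems by (auto simp: code_at_Cons)
  ultimately show ?case
    using Cons.IH[of "exec x r"] Cons.prems by (simp add: funpow_swap1 del: funpow.simps(2) add: funpow_Suc_right)
qed auto

lemma acode_straight: "list_all (Not \<circ> is_jump) (acode a t)"
  by (induction a arbitrary: t) auto

lemma wcode_straight: "list_all (Not \<circ> is_jump) (wcode a t)"
  by (induction a arbitrary: t) (auto simp: acode_straight)

lemma bcode_straight: "list_all (Not \<circ> is_jump) (bcode b)"
  by (cases b) (auto simp: acode_straight wcode_straight)

lemma block_code_straight: "list_all (Not \<circ> is_jump) (block_code as)"
proof -
  have "list_all (Not \<circ> is_jump) (atom_code a)" for a
    by (cases a) (auto simp: acode_straight wcode_straight)
  then show ?thesis by (induction as) (auto simp: block_code_def)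
qed

text \<open>Registers below \<open>t\<close> must survive, since a left operand waits in
  \<open>t\<close> while the right one is evaluated from \<open>t + 1\<close> on. That no weight
  register changes lets \<open>WPut\<close> compute its value before its address.\<close>

lemma acode_sound:
  assumes "aexp_ok a" "100 \<le> t" "implements r s"
  shows "implements (fold exec (acode a t) r) s \<and> reg (fold exec (acode a t) r) t = aval a s \<and>
    (\<forall>x<t. reg (fold exec (acode a t) r) x = reg r x) \<and> wreg (fold exec (acode a t) r) = wreg r"
  using assms
proof (induction a arbitrary: t r)
  case (Plus a b)
  from Plus.IH(1)[of t r] Plus.IH(2)[of "t + 1" "fold exec (acode a t) r"] Plus.prems
  show ?case by (auto simp: implements_def next_pc_def)
next
  case (Minus a b)
  from Minus.IH(1)[of t r] Minus.IH(2)[of "t + 1" "fold exec (acode a t) r"] Minus.prems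
  show ?case by (auto simp: implements_def next_pc_def)
next
  case (Ld a)
  from Ld.IH[of t r] Ld.prems show ?case by (auto simp: implements_def next_pc_def)
qed (auto simp: implements_def next_pc_def)

lemma wcode_sound:
  assumes "wexp_ok a" "100 \<le> t" "implements r s"
  shows "implements (fold exec (wcode a t) r) s \<and> wreg (fold exec (wcode a t) r) t = wval a s \<and>
    (\<forall>x<t. wreg (fold exec (wcode a t) r) x = wreg r x)"
  using assms
proof (induction a arbitrary: t r)
  case (WPlus a b)
  from WPlus.IH(1)[of t r] WPlus.IH(2)[of "t + 1" "fold exec (wcode a t) r"] WPlus.prems
  show ?case by (auto simp: implements_def next_pc_def)
next
  case (WMinus a b)
  from WMinus.IH(1)[of t r] WMinus.IH(2)[of "t + 1" "fold exec (wcode a t) r"] WMinus.prems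
  show ?case by (auto simp: implements_def next_pc_def)
next
  case (WLd a)
  from acode_sound[of a 100 r s] WLd.prems show ?case by (auto simp: implements_def next_pc_def)
qed (auto simp: implements_def next_pc_def)

lemma atom_sound:
  assumes "atom_wf a" "implements r s"
  shows "implements (fold exec (atom_code a) r) (atom_sem a s)"
proof (cases a)
  case (Assign x e)
  then show ?thesis using assms acode_sound[of e 100 r s] by (auto simp: implements_def next_pc_def)
next
  case (Put e f)
  then show ?thesis
    using assms acode_sound[of e 100 r s] acode_sound[of f 101 "fold exec (acode e 100) r" s]
    by (auto simp: implements_def next_pc_def)
next
  case (WAssign x e)
  then show ?thesis using assms wcode_sound[of e 100 r s] by (auto simp: implements_def next_pc_def)
next
  case (WPut e f)
  then show ?thesis
    using assms wcode_sound[of f 100 r s] acode_sound[of e 100 "fold exec (wcode f 100) r" s]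
    by (auto simp: implements_def next_pc_def)
qed

lemma block_sound:
  assumes "list_all atom_wf as" "implements r s"
  shows "implements (fold exec (block_code as) r) (fold atom_sem as s)"
  using assms
proof (induction as arbitrary: r s)
  case (Cons a as)
  then show ?case using atom_sound[of a r s] by (auto simp: block_code_def)
qed (auto simp: block_code_def)

lemma implements_pc: "implements (r\<lparr>pc := k\<rparr>) s \<longleftrightarrow> implements r s"
  by (simp add: implements_def)

lemma test_sound:
  assumes "bexp_ok b" "implements r s" "code_at p (pc r) (bcode b @ [bjump b l])"
  shows "\<exists>r'. (step p ^^ (tcost b + 1)) r = r' \<and> implements r' s \<and>
    pc r' = (if bval b s then l else pc r + tcost b + 1)"
proof -
  let ?r = "fold exec (bcode b) r"
  have 1: "(step p ^^ tcost b) r = ?r" "pc ?r = pc r + tcost b"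
    using step_straight[OF bcode_straight[of b], of p r] assms(3)
    by (auto simp: code_at_append tcost_def)
  have 2: "step p ?r = exec (bjump b l) ?r"
    using assms(3) 1(2) by (simp add: code_at_append code_at_Cons code_at_Nil step_def halted_def tcost_def)
  have 3: "implements ?r s \<and> exec (bjump b l) ?r = (if bval b s then goto l ?r else next_pc ?r)"
  proof (cases b)
    case (Le e f)
    then show ?thesis
      using assms acode_sound[of e 100 r s] acode_sound[of f 101 "fold exec (acode e 100) r" s] by auto
  next
    case (WLe e f)
    then show ?thesis
      using assms wcode_sound[of e 100 r s] wcode_sound[of f 101 "fold exec (wcode e 100) r" s] by auto
  qed
  show ?thesis using 1 2 3 by (auto simp: goto_def next_pc_def implements_pc)
qed

lemma step_Jump:
  assumes "code_at p (pc r) [Jump l]" "implements r s"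
  shows "\<exists>r'. step p r = r' \<and> implements r' s \<and> pc r' = l"
  using assms by (auto simp: code_at_Cons code_at_Nil step_def halted_def goto_def implements_pc)

lemma funpow_plus: "(f ^^ (m + k)) x = (f ^^ k) ((f ^^ m) x)"
  by (metis add.commute comp_apply funpow_add)

text \<open>Jump targets are absolute, so code is compiled for the very place where it lies, and
  \<open>code_at\<close> passes to each subprogram at the program counter reached before it. The run
  already fixes the number of steps, so termination of the machine comes for free.\<close>

theorem com_code_sound:
  assumes "runs c s t s'" "com_ok c" "implements r s" "code_at p (pc r) (com_code c (pc r))"
  shows "\<exists>r'. (step p ^^ t) r = r' \<and> implements r' s' \<and> pc r' = pc r + length (com_code c (pc r))"
  using assms
proof (induction arbitrary: r rule: runs.induct)
  case (runs_block as s)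
  then show ?case
    using step_straight[OF block_code_straight[of as], of p r] block_sound[of as r s]
    by (auto simp: bcost_def)
next
  case (runs_seq c s t s' d t' s'')
  let ?cc = "com_code c (pc r)"
  have "code_at p (pc r) ?cc" using runs_seq.prems by (simp add: Let_def code_at_append)
  then obtain r1 where r1: "(step p ^^ t) r = r1" "implements r1 s'" "pc r1 = pc r + length ?cc"
    using runs_seq.IH(1) runs_seq.prems by auto
  have "code_at p (pc r1) (com_code d (pc r1))"
    using runs_seq.prems r1 by (simp add: Let_def code_at_append)
  then obtain r2 where "(step p ^^ t') r1 = r2" "implements r2 s''" "pc r2 = pc r1 + length (com_code d (pc r1))"
    using runs_seq.IH(2) runs_seq.prems r1 by auto
  then show ?case using r1 by (auto simp: funpow_plus Let_def)
next
  case (runs_if_true b s c t s' d)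
  define k1 where "k1 = pc r + length (bcode b) + 1"
  define k2 where "k2 = k1 + length (com_code d k1) + 1"
  have code: "com_code (If b c d) (pc r) = bcode b @ [bjump b k2] @ com_code d k1 @
      [Jump (k2 + length (com_code c k2))] @ com_code c k2"
    by (simp add: k1_def k2_def Let_def)
  have at: "code_at p (pc r) (bcode b @ [bjump b k2])" "code_at p k2 (com_code c k2)"
    using runs_if_true.prems(3) unfolding code
    by (auto simp: code_at_append code_at_Cons code_at_Nil k1_def k2_def add_ac)
  from test_sound[OF _ _ at(1)] runs_if_true obtain r1 where
    r1: "(step p ^^ (tcost b + 1)) r = r1" "implements r1 s" "pc r1 = k2" by auto
  then obtain r2 where "(step p ^^ t) r1 = r2" "implements r2 s'" "pc r2 = k2 + length (com_code c k2)"
    using runs_if_true.IH[of r1] runs_if_true.prems at(2) by auto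
  then show ?case
    unfolding funpow_plus[of "tcost b + 1"] r1(1) code by (auto simp: k1_def k2_def)
next
  case (runs_if_false b s d t s' c)
  define k1 where "k1 = pc r + length (bcode b) + 1"
  define k2 where "k2 = k1 + length (com_code d k1) + 1"
  have code: "com_code (If b c d) (pc r) = bcode b @ [bjump b k2] @ com_code d k1 @
      [Jump (k2 + length (com_code c k2))] @ com_code c k2"
    by (simp add: k1_def k2_def Let_def)
  have at: "code_at p (pc r) (bcode b @ [bjump b k2])" "code_at p k1 (com_code d k1)"
    "code_at p (k1 + length (com_code d k1)) [Jump (k2 + length (com_code c k2))]"
    using runs_if_false.prems(3) unfolding code
    by (auto simp: code_at_append code_at_Cons code_at_Nil k1_def k2_def add_ac)
  from test_sound[OF _ _ at(1)] runs_if_false obtain r1 where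
    r1: "(step p ^^ (tcost b + 1)) r = r1" "implements r1 s" "pc r1 = k1"
    by (auto simp: k1_def tcost_def)
  then obtain r2 where r2: "(step p ^^ t) r1 = r2" "implements r2 s'" "pc r2 = k1 + length (com_code d k1)"
    using runs_if_false.IH[of r1] runs_if_false.prems at(2) by auto
  then obtain r3 where "step p r2 = r3" "implements r3 s'" "pc r3 = k2 + length (com_code c k2)"
    using step_Jump[of p r2] at(3) by auto
  then show ?case
    unfolding funpow_plus[of "tcost b + 1"] funpow_plus[of t 1] r1(1) r2(1) code
    by (auto simp: k1_def k2_def)
next
  case (runs_while_false b s c)
  define k1 where "k1 = pc r + length (bcode b) + 2"
  have code: "com_code (While b c) (pc r) =
      bcode b @ [bjump b k1, Jump (k1 + length (com_code c k1) + 1)] @ com_code c k1 @ [Jump (pc r)]"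
    by (simp add: k1_def Let_def)
  have at: "code_at p (pc r) (bcode b @ [bjump b k1])"
    "code_at p (pc r + tcost b + 1) [Jump (k1 + length (com_code c k1) + 1)]"
    using runs_while_false.prems(3) unfolding code
    by (auto simp: code_at_append code_at_Cons code_at_Nil tcost_def k1_def)
  from test_sound[OF _ _ at(1)] runs_while_false obtain r1 where
    r1: "(step p ^^ (tcost b + 1)) r = r1" "implements r1 s" "pc r1 = pc r + tcost b + 1" by auto
  then obtain r2 where "step p r1 = r2" "implements r2 s" "pc r2 = k1 + length (com_code c k1) + 1"
    using step_Jump[of p r1] at(2) by auto
  then show ?case
    unfolding funpow_plus[of "tcost b + 1"] r1(1) code by (auto simp: k1_def)
next
  case (runs_while_true b s c t s' t' s'')
  define k1 where "k1 = pc r + length (bcode b) + 2"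
  have code: "com_code (While b c) (pc r) =
      bcode b @ [bjump b k1, Jump (k1 + length (com_code c k1) + 1)] @ com_code c k1 @ [Jump (pc r)]"
    by (simp add: k1_def Let_def)
  have at: "code_at p (pc r) (bcode b @ [bjump b k1])" "code_at p k1 (com_code c k1)"
    "code_at p (k1 + length (com_code c k1)) [Jump (pc r)]"
    using runs_while_true.prems(3) unfolding code
    by (auto simp: code_at_append code_at_Cons code_at_Nil k1_def add_ac)
  from test_sound[OF _ _ at(1)] runs_while_true obtain r1 where
    r1: "(step p ^^ (tcost b + 1)) r = r1" "implements r1 s" "pc r1 = k1" by auto
  then obtain r2 where r2: "(step p ^^ t) r1 = r2" "implements r2 s'" "pc r2 = k1 + length (com_code c k1)"
    using runs_while_true.IH(1)[of r1] runs_while_true.prems at(2) by auto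
  then obtain r3 where r3: "step p r2 = r3" "implements r3 s'" "pc r3 = pc r"
    using step_Jump[of p r2] at(3) by auto
  then obtain r4 where "(step p ^^ t') r3 = r4" "implements r4 s''"
    "pc r4 = pc r + length (com_code (While b c) (pc r))"
    using runs_while_true.IH(2)[of r3] runs_while_true.prems by auto
  then show ?case
    unfolding funpow_plus[of "tcost b + 1"] funpow_plus[of t] funpow_plus[of 1] r1(1) r2(1)
    using r3 by auto
qed

text \<open>One run with the wanted property is enough: the machine is deterministic, and
  \<open>com_code_sound\<close> identifies its state after \<open>t\<close> steps. With the time
  inside the postcondition, the rules below add it up along the program.\<close>

definition ht :: "store \<Rightarrow> com \<Rightarrow> (nat \<Rightarrow> store \<Rightarrow> bool) \<Rightarrow> bool" where
  "ht s c Q \<longleftrightarrow> (\<exists>t s'. runs c s t s' \<and> Q t s')"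

lemma ht_block: "Q (bcost as) (fold atom_sem as s) \<Longrightarrow> ht s (Block as) Q"
  using runs_block by (auto simp: ht_def)

lemma ht_seq: "ht s c (\<lambda>t s'. ht s' d (\<lambda>t'. Q (t + t'))) \<Longrightarrow> ht s (c ;; d) Q"
  using runs_seq by (fastforce simp: ht_def)

lemma ht_if:
  assumes "bval b s \<Longrightarrow> ht s c (\<lambda>t. Q (tcost b + 1 + t))"
    and "\<not> bval b s \<Longrightarrow> ht s d (\<lambda>t. Q (tcost b + 1 + (t + 1)))"
  shows "ht s (If b c d) Q"
  using assms runs_if_true[of b s c] runs_if_false[of b s d] unfolding ht_def by (cases "bval b s") blast+

lemma ht_conseq: "ht s c Q \<Longrightarrow> (\<And>t s'. Q t s' \<Longrightarrow> Q' t s') \<Longrightarrow> ht s c Q'"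
  by (auto simp: ht_def)

text \<open>The potential \<open>\<Phi>\<close> makes amortised time bounds possible.\<close>

lemma ht_while:
  assumes "P s"
    and "\<And>s. P s \<Longrightarrow> bval b s \<Longrightarrow>
      ht s c (\<lambda>t s'. P s' \<and> tcost b + 2 + t + \<Phi> s' \<le> (\<Phi> s :: nat))"
  shows "ht s (While b c) (\<lambda>t s'. P s' \<and> \<not> bval b s' \<and> t + \<Phi> s' \<le> \<Phi> s + (tcost b + 2))"
  using assms(1)
proof (induction "\<Phi> s" arbitrary: s rule: less_induct)
  case less
  show ?case
  proof (cases "bval b s")
    case True
    then obtain t s' where 1: "runs c s t s'" "P s'" "tcost b + 2 + t + \<Phi> s' \<le> \<Phi> s"
      using assms(2) less.prems unfolding ht_def by blast
    then obtain t' s'' where "runs (While b c) s' t' s''" "P s''" "\<not> bval b s''"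
      "t' + \<Phi> s'' \<le> \<Phi> s' + (tcost b + 2)"
      using less.hyps[of s'] unfolding ht_def by fastforce
    then show ?thesis using runs_while_true[OF True 1(1)] 1(3) unfolding ht_def by fastforce
  next
    case False
    then show ?thesis using runs_while_false less.prems unfolding ht_def by fastforce
  qed
qed

lemma ht_while_conseq:
  assumes "P s"
    and "\<And>s. P s \<Longrightarrow> bval b s \<Longrightarrow>
      ht s c (\<lambda>t s'. P s' \<and> tcost b + 2 + t + \<Phi> s' \<le> (\<Phi> s :: nat))"
    and "\<And>t s'. P s' \<Longrightarrow> \<not> bval b s' \<Longrightarrow> t + \<Phi> s' \<le> \<Phi> s + (tcost b + 2) \<Longrightarrow> Q t s'"
  shows "ht s (While b c) Q"
  using ht_conseq[OF ht_while[of P s b c \<Phi>]] assms by blast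


section \<open>The structure of the set of solutions\<close>

text \<open>
  Every position \<open>i\<close> has two options \<open>o0 i\<close> and \<open>o1 i\<close>, which agree unless \<open>i\<close> lies on a cycle;
  \<open>cy i\<close> is then the number of the cycle. The solutions are obtained by choosing
  for every cycle which of its two perfect matchings to take.
\<close>

locale cycle_structure =
  fixes I :: tspvr and q :: nat and o0 o1 cy :: "nat \<Rightarrow> nat"
  assumes inst: "tspvr_instance I"
    and feas: "feasible I"
    and options: "i \<in> {1..num I} \<Longrightarrow> o0 i \<in> req I i \<and> o1 i \<in> req I i"
    and covered: "x \<in> {1..num I} \<Longrightarrow>
      \<exists>i\<in>{1..num I}. \<exists>j\<in>{1..num I}. cy i = cy j \<and> o1 i = x \<and> o0 j = x"
    and uniform: "f \<in> solutions I \<Longrightarrow>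
      (\<forall>i\<in>{1..num I}. cy i = c \<longrightarrow> f i = o0 i) \<or> (\<forall>i\<in>{1..num I}. cy i = c \<longrightarrow> f i = o1 i)"
    and junk_label: "i \<in> {1..num I} \<Longrightarrow> q \<le> cy i \<Longrightarrow> o0 i = o1 i"
    and proper: "c < q \<Longrightarrow> \<exists>i\<in>{1..num I}. cy i = c \<and> o0 i \<noteq> o1 i"
begin

definition choice :: "nat set \<Rightarrow> nat \<Rightarrow> nat" where
  "choice S i = (if cy i \<in> S then o1 i else o0 i)"

definition sol :: "nat set \<Rightarrow> nat \<Rightarrow> nat" where
  "sol S = restrict (choice S) {1..num I}"

lemma req_range: "i \<in> {1..num I} \<Longrightarrow> req I i \<subseteq> {1..num I}"
  using inst by (auto simp: tspvr_instance_def)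

lemma choice_req: "i \<in> {1..num I} \<Longrightarrow> choice S i \<in> req I i"
  using options by (auto simp: choice_def)

lemma choice_range: "i \<in> {1..num I} \<Longrightarrow> choice S i \<in> {1..num I}"
  using choice_req req_range by blast

text \<open>Whichever way a cycle is matched, \<open>covered\<close> offers a position for
  \<open>x\<close>: one whose second option is \<open>x\<close>, and one with the same label whose
  first option is \<open>x\<close>. So every choice is onto, hence bijective on a finite
  set.\<close>

lemma choice_bij: "bij_betw (choice S) {1..num I} {1..num I}"
proof -
  have "\<exists>i\<in>{1..num I}. choice S i = x" if x: "x \<in> {1..num I}" for x
    proof -
    obtain i j where "i \<in> {1..num I}" "j \<in> {1..num I}" "cy i = cy j" "o1 i = x" "o0 j = x"
      using covered[OF x] by blast
    then show ?thesis by (cases "cy i \<in> S") (auto simp: choice_def intro: bexI[of _ i] bexI[of _ j])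
  qed
  then have "choice S ` {1..num I} = {1..num I}"
    using choice_range by (auto simp: image_iff) metis
  then show ?thesis
    by (simp add: bij_betw_def eq_card_imp_inj_on)
qed

lemma sol_solution: "sol S \<in> solutions I"
proof -
  have "bij_betw (sol S) {1..num I} {1..num I}"
    by (rule iffD1[OF bij_betw_cong choice_bij[of S]]) (simp add: sol_def)
  then show ?thesis
    unfolding solutions_def using choice_req choice_range by (simp add: sol_def)
qed

lemma solution_sol:
  assumes f: "f \<in> solutions I"
  shows "\<exists>S \<subseteq> {..<q}. f = sol S"
proof (intro exI conjI)
  let ?S = "{c \<in> {..<q}. \<forall>i\<in>{1..num I}. cy i = c \<longrightarrow> f i = o1 i}"
  show "?S \<subseteq> {..<q}" by auto
  have "f i = choice ?S i" if i: "i \<in> {1..num I}" for i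
  proof (cases "cy i \<in> ?S")
    case False
    then show ?thesis
      using uniform[OF f, of "cy i"] junk_label[OF i] i by (auto simp: choice_def not_less)
  qed (use i in \<open>auto simp: choice_def\<close>)
  moreover have "f \<in> extensional {1..num I}" using f by (auto simp: solutions_def PiE_def)
  ultimately show "f = sol ?S" by (auto simp: sol_def restrict_def extensional_def fun_eq_iff)
qed

lemma req_pair:
  assumes "i \<in> {1..num I}" "o0 i \<noteq> o1 i"
  shows "req I i = {o0 i, o1 i}"
proof (rule sym, rule card_seteq)
  show "finite (req I i)" using req_range[OF assms(1)] finite_subset by blast
  have "card (req I i) \<le> 2" using inst assms(1) by (auto simp: tspvr_instance_def)
  then show "card (req I i) \<le> card {o0 i, o1 i}" using assms(2) by simp
qed (use options[OF assms(1)] in auto)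

text \<open>Different labels can be chosen independently. Then some choice would give
  \<open>x\<close> to both \<open>i\<close> and \<open>j\<close>, although every choice is
  injective.\<close>

lemma shared_vertex_same_cycle:
  assumes "i \<in> {1..num I}" "o0 i \<noteq> o1 i" "j \<in> {1..num I}" "o0 j \<noteq> o1 j"
    and "x \<in> req I i" "x \<in> req I j"
  shows "cy i = cy j"
proof (rule ccontr)
  assume ne: "cy i \<noteq> cy j"
  let ?S = "(if x = o1 i then {cy i} else {}) \<union> (if x = o1 j then {cy j} else {})"
  have "choice ?S i = x" "choice ?S j = x"
    using assms req_pair ne by (auto simp: choice_def)
  then show False
    using choice_bij[of ?S] assms(1,3) ne unfolding bij_betw_def inj_on_def by metis
qed

section \<open>Perfect matchings, special vertices and components\<close>

definition matching_of :: "(nat \<Rightarrow> nat) \<Rightarrow> (nat + nat) set set" where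
  "matching_of f = {{Inl i, Inr (f i)} | i. i \<in> {1..num I}}"

lemma matching_of_iff: "{Inl i, Inr x} \<in> matching_of f \<longleftrightarrow> i \<in> {1..num I} \<and> f i = x"
  by (auto simp: matching_of_def doubleton_eq_iff)

lemma matching_of_perfect:
  assumes "f \<in> solutions I"
  shows "perfect_matching (bip_verts I) (bip_edges I) (matching_of f)"
proof -
  have f: "bij_betw f {1..num I} {1..num I}" "\<And>i. i \<in> {1..num I} \<Longrightarrow> f i \<in> req I i"
    using assms by (auto simp: solutions_def)
  have "\<exists>!e. e \<in> matching_of f \<and> Inl i \<in> e" if "i \<in> {1..num I}" for i
    using that by (intro ex1I[of _ "{Inl i, Inr (f i)}"]) (auto simp: matching_of_def)
  moreover have "\<exists>!e. e \<in> matching_of f \<and> Inr x \<in> e" if x: "x \<in> {1..num I}" for x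
  proof -
    have "x \<in> f ` {1..num I}" using f(1) x by (simp add: bij_betw_def)
    then obtain i where i: "i \<in> {1..num I}" "f i = x" by blast
    show ?thesis
    proof (rule ex1I[of _ "{Inl i, Inr x}"])
      show "{Inl i, Inr x} \<in> matching_of f \<and> Inr x \<in> {Inl i, Inr x}"
        using i by (simp add: matching_of_iff)
      fix e assume "e \<in> matching_of f \<and> Inr x \<in> e"
      then obtain j where j: "e = {Inl j, Inr (f j)}" "j \<in> {1..num I}" "f j = x"
        by (auto simp: matching_of_def)
      then show "e = {Inl i, Inr x}" using i bij_betw_imp_inj_on[OF f(1)] by (metis inj_onD)
    qed
  qed
  moreover have "matching_of f \<subseteq> bip_edges I"
    using f(2) unfolding matching_of_def bip_edges_def by blast
  ultimately show ?thesis
    unfolding perfect_matching_def bip_verts_def by blast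
qed

text \<open>Each position is matched to some vertex, and uniqueness of the matching edge at a vertex
  makes this map injective, hence bijective on \<open>{1..num I}\<close>.\<close>

lemma perfect_matching_solution:
  assumes M: "perfect_matching (bip_verts I) (bip_edges I) M"
  shows "\<exists>f \<in> solutions I. \<forall>i\<in>{1..num I}. {Inl i, Inr (f i)} \<in> M"
proof -
  have ME: "M \<subseteq> bip_edges I" and ex1: "\<And>v. v \<in> bip_verts I \<Longrightarrow> \<exists>!e. e \<in> M \<and> v \<in> e"
    using M by (auto simp: perfect_matching_def)
  have "\<exists>x. {Inl i, Inr x} \<in> M" if "i \<in> {1..num I}" for i
    using ex1[of "Inl i"] ME that unfolding bip_verts_def bip_edges_def by fastforce
  then obtain g where g: "\<And>i. i \<in> {1..num I} \<Longrightarrow> {Inl i, Inr (g i)} \<in> M" by metis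
  have req: "g i \<in> req I i" if "i \<in> {1..num I}" for i
    using g[OF that] ME by (auto simp: bip_edges_def doubleton_eq_iff)
  have range: "g ` {1..num I} \<subseteq> {1..num I}" using req req_range by blast
  have "inj_on g {1..num I}"
  proof (rule inj_onI)
    fix i j assume ij: "i \<in> {1..num I}" "j \<in> {1..num I}" "g i = g j"
    have "Inr (g i) \<in> bip_verts I" using ij(1) range unfolding bip_verts_def by blast
    then have "{Inl i, Inr (g i)} = {Inl j, Inr (g j)}"
      using ex1[of "Inr (g i)"] g[OF ij(1)] g[OF ij(2)] ij(3) by (metis insertCI)
    then show "i = j" by (auto simp: doubleton_eq_iff)
  qed
  then have "bij_betw g {1..num I} {1..num I}"
    using range by (simp add: bij_betw_def endo_inj_surj)
  then have "bij_betw (restrict g {1..num I}) {1..num I} {1..num I}"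
    by (rule iffD1[OF bij_betw_cong, rotated]) simp
  then have "restrict g {1..num I} \<in> solutions I"
    using req range by (auto simp: solutions_def)
  then show ?thesis using g by (intro bexI[of _ "restrict g {1..num I}"]) auto
qed

text \<open>If the options agree, every solution takes the same edge at \<open>i\<close>, which is
  then special. If they differ, the choices \<open>{}\<close> and \<open>{cy i}\<close> use
  different edges at \<open>i\<close>, and no edge at \<open>i\<close> lies in both
  matchings.\<close>

lemma reduced_vert_iff:
  assumes i: "i \<in> {1..num I}"
  shows "Inl i \<in> reduced_verts I \<longleftrightarrow> o0 i \<noteq> o1 i"
proof
  assume red: "Inl i \<in> reduced_verts I"
  show "o0 i \<noteq> o1 i"
  proof
    assume eq: "o0 i = o1 i"
    have "special_edge (bip_verts I) (bip_edges I) {Inl i, Inr (o0 i)}"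
      unfolding special_edge_def
    proof (intro conjI allI impI)
      show "{Inl i, Inr (o0 i)} \<in> bip_edges I" using i options[OF i] by (auto simp: bip_edges_def)
      fix M assume "perfect_matching (bip_verts I) (bip_edges I) M"
      then obtain f where f: "f \<in> solutions I" "{Inl i, Inr (f i)} \<in> M"
        using perfect_matching_solution i by blast
      then show "{Inl i, Inr (o0 i)} \<in> M" using uniform[OF f(1), of "cy i"] i eq by auto
    qed
    then show False using red by (auto simp: reduced_verts_def special_vertex_def)
  qed
next
  assume ne: "o0 i \<noteq> o1 i"
  have "\<not> special_vertex (bip_verts I) (bip_edges I) (Inl i)"
  proof
    assume "special_vertex (bip_verts I) (bip_edges I) (Inl i)"
    then obtain e where e: "special_edge (bip_verts I) (bip_edges I) e" "Inl i \<in> e"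
      by (auto simp: special_vertex_def)
    then obtain x where x: "e = {Inl i, Inr x}" by (auto simp: special_edge_def bip_edges_def)
    have "sol S i = x" for S
      using e(1) matching_of_perfect[OF sol_solution[of S]] unfolding special_edge_def x
      by (auto simp: matching_of_iff)
    from this[of "{}"] this[of "{cy i}"] show False using ne i by (auto simp: sol_def choice_def)
  qed
  then show "Inl i \<in> reduced_verts I" using i by (auto simp: reduced_verts_def bip_verts_def)
qed

text \<open>Each \<open>c < q\<close> is sent to the component of a position with label
  \<open>c\<close> and two different options. Labels are constant along the edges of the reduced
  graph, so this map is injective.\<close>

lemma cycles_le_num_cycles: "q \<le> num_cycles I"
proof -
  let ?R = "{(a, b). {a, b} \<in> reduced_edges I}"
  let ?comp = "\<lambda>v. {u. (v, u) \<in> ?R\<^sup>*}"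
  obtain r where r: "\<And>c. c < q \<Longrightarrow> r c \<in> {1..num I} \<and> cy (r c) = c \<and> o0 (r c) \<noteq> o1 (r c)"
    using proper by metis
  \<comment> \<open>A vertex of the digraph inherits the labels of its incident positions with two
    options; by \<open>shared_vertex_same_cycle\<close> there is only one such label.\<close>
  define on_cycle where "on_cycle c v = (case v of
      Inl i \<Rightarrow> i \<in> {1..num I} \<and> cy i = c \<and> o0 i \<noteq> o1 i
    | Inr x \<Rightarrow> (\<exists>i\<in>{1..num I}. cy i = c \<and> o0 i \<noteq> o1 i \<and> x \<in> req I i))" for c and v :: "nat + nat"
  have closed: "on_cycle c b" if edge: "{a, b} \<in> reduced_edges I" and a: "on_cycle c a" for a b c
  proof -
    have "{a, b} \<in> bip_edges I" "{a, b} \<subseteq> reduced_verts I"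
      using edge unfolding reduced_edges_def by blast+
    moreover from this(1) obtain i x where
      "{a, b} = {Inl i, Inr x}" "i \<in> {1..num I}" "x \<in> req I i"
      unfolding bip_edges_def by blast
    ultimately have ix: "{a, b} = {Inl i, Inr x}" "i \<in> {1..num I}" "x \<in> req I i"
      "Inl i \<in> reduced_verts I" by auto
    then have ne: "o0 i \<noteq> o1 i" using reduced_vert_iff by blast
    consider "a = Inl i" "b = Inr x" | "a = Inr x" "b = Inl i"
      using ix(1) by (auto simp: doubleton_eq_iff)
    then show ?thesis
    proof cases
      case 1
      then show ?thesis using a ix by (auto simp: on_cycle_def)
    next
      case 2
      then obtain j where "j \<in> {1..num I}" "cy j = c" "o0 j \<noteq> o1 j" "x \<in> req I j"
        using a by (auto simp: on_cycle_def)
      then have "cy i = c" using shared_vertex_same_cycle[of i j x] ix ne by auto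
      then show ?thesis using 2 ix ne by (auto simp: on_cycle_def)
    qed
  qed
  have reach: "on_cycle c v" if path: "(Inl (r c), v) \<in> ?R\<^sup>*" and c: "c < q" for c v
    using path
  proof (induction rule: rtrancl_induct)
    case base
    then show ?case using r[OF c] by (auto simp: on_cycle_def)
  next
    case (step y z)
    then show ?case using closed by auto
  qed
  have "inj_on (\<lambda>c. ?comp (Inl (r c))) {..<q}"
  proof (rule inj_onI)
    fix c d assume cd: "c \<in> {..<q}" "d \<in> {..<q}" "?comp (Inl (r c)) = ?comp (Inl (r d))"
    then have "(Inl (r c), Inl (r d)) \<in> ?R\<^sup>*" by auto
    then show "c = d" using reach[of c "Inl (r d)"] r[of d] cd by (auto simp: on_cycle_def)
  qed
  then have "q = card ((\<lambda>c. ?comp (Inl (r c))) ` {..<q})" by (simp add: card_image)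
  also have "\<dots> \<le> num_cycles I"
    unfolding num_cycles_def components_def
  proof (rule card_mono)
    show "finite ((\<lambda>v. ?comp v) ` reduced_verts I)"
      by (auto simp: reduced_verts_def bip_verts_def)
    show "(\<lambda>c. ?comp (Inl (r c))) ` {..<q} \<subseteq> (\<lambda>v. ?comp v) ` reduced_verts I"
      using r reduced_vert_iff by (intro image_subsetI imageI) blast
  qed
  finally show ?thesis .
qed

text \<open>A choice is injective and, as \<open>n\<close> is at least 2, neighbouring positions
  differ, the pair \<open>(n, 1)\<close> included. So the zeros that stand in slots with equal end
  points are never summed.\<close>

lemma cost_sol:
  assumes "2 \<le> num I"
  shows "cost I (sol S) = arc_weight I (choice S (num I)) (choice S 1) +
    (\<Sum>i = 1..<num I. arc_weight I (choice S i) (choice S (i + 1)))"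
proof -
  have "arc_weight I (choice S i) (choice S j) = weight I (sol S i) (sol S j)"
    if "i \<in> {1..num I}" "j \<in> {1..num I}" "i \<noteq> j" for i j
  proof -
    have "choice S i \<noteq> choice S j" using bij_betw_imp_inj_on[OF choice_bij] that by (metis inj_onD)
    then show ?thesis using that by (simp add: arc_weight_def sol_def)
  qed
  then show ?thesis using assms by (simp add: cost_def)
qed

lemma optimal_sol:
  assumes "\<And>S'. S' \<subseteq> {..<q} \<Longrightarrow> cost I (sol S) \<le> cost I (sol S')"
  shows "optimal I (sol S)"
proof -
  have "finite (solutions I)"
    by (rule finite_subset[of _ "{1..num I} \<rightarrow>\<^sub>E {1..num I}"]) (auto simp: solutions_def intro: finite_PiE)
  then have "Min (cost I ` solutions I) = cost I (sol S)"
    using assms solution_sol sol_solution by (intro Min_eqI) blast+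
  then show ?thesis using sol_solution by (simp add: optimal_def)
qed

end


section \<open>Peeling off the forced positions\<close>

definition lo :: "tspvr \<Rightarrow> nat \<Rightarrow> nat" where
  "lo I i = Min (req I i)"

definition hi :: "tspvr \<Rightarrow> nat \<Rightarrow> nat" where
  "hi I i = Max (req I i)"

text \<open>A requisition with a single vertex counts as a double edge.\<close>

definition mult :: "tspvr \<Rightarrow> nat \<Rightarrow> nat \<Rightarrow> nat" where
  "mult I i x = (if lo I i = x then 1 else 0) + (if hi I i = x then 1 else 0)"

definition degree :: "tspvr \<Rightarrow> nat set \<Rightarrow> nat \<Rightarrow> nat" where
  "degree I U x = (\<Sum>i\<in>U. mult I i x)"

definition pos_sum :: "tspvr \<Rightarrow> nat set \<Rightarrow> nat \<Rightarrow> nat" where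
  "pos_sum I U x = (\<Sum>i\<in>U. i * mult I i x)"

text \<open>Vertices are numbered from 1, so the initial content 0 of a cell can mean that the
  position has not been decided yet.\<close>

definition open_positions :: "tspvr \<Rightarrow> (nat \<Rightarrow> nat) \<Rightarrow> nat set" where
  "open_positions I o0 = {i \<in> {1..num I}. o0 i = 0}"

locale feasible_instance =
  fixes I :: tspvr
  assumes inst: "tspvr_instance I"
    and feas: "feasible I"
begin

lemma req_eq:
  assumes i: "i \<in> {1..num I}"
  shows "req I i = {lo I i, hi I i}" "lo I i \<le> hi I i"
proof -
  have r: "req I i \<subseteq> {1..num I}" "1 \<le> card (req I i)" "card (req I i) \<le> 2"
    using inst i by (auto simp: tspvr_instance_def)
  then have fin: "finite (req I i)" using finite_subset by blast
  have "card (req I i) = 1 \<or> card (req I i) = 2" using r by linarith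
  then obtain a b where "req I i = {a, b}" by (auto simp: card_1_singleton_iff card_2_iff)
  then show "req I i = {lo I i, hi I i}" "lo I i \<le> hi I i"
    by (auto simp: lo_def hi_def min_def max_def)
qed

lemma ends_range:
  assumes "i \<in> {1..num I}"
  shows "lo I i \<in> {1..num I}" "hi I i \<in> {1..num I}"
  using inst assms req_eq(1)[OF assms] unfolding tspvr_instance_def by blast+

lemma solution_req: "f \<in> solutions I \<Longrightarrow> i \<in> {1..num I} \<Longrightarrow> f i \<in> {lo I i, hi I i}"
  using req_eq(1) by (auto simp: solutions_def)

lemma solution_range: "f \<in> solutions I \<Longrightarrow> i \<in> {1..num I} \<Longrightarrow> f i \<in> {1..num I}"
  unfolding solutions_def by blast

lemma solution_inj:
  "f \<in> solutions I \<Longrightarrow> i \<in> {1..num I} \<Longrightarrow> j \<in> {1..num I} \<Longrightarrow> f i = f j \<Longrightarrow> i = j"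
  unfolding solutions_def by (blast dest: bij_betw_imp_inj_on inj_onD)

lemma solution_surj:
  assumes "f \<in> solutions I" "x \<in> {1..num I}"
  shows "\<exists>i\<in>{1..num I}. f i = x"
proof -
  have "x \<in> f ` {1..num I}" using assms by (auto simp: solutions_def bij_betw_def)
  then show ?thesis by blast
qed

lemma mult_pos_iff: "0 < mult I i x \<longleftrightarrow> x \<in> {lo I i, hi I i}"
  by (auto simp: mult_def)

lemma degree_pos:
  assumes "finite U" "i \<in> U" "x \<in> {lo I i, hi I i}"
  shows "0 < degree I U x"
proof -
  have "mult I i x \<le> degree I U x"
    unfolding degree_def using assms by (intro member_le_sum) auto
  moreover have "0 < mult I i x" using assms mult_pos_iff by simp
  ultimately show ?thesis by linarith
qed

lemma degree_remove:
  assumes "finite U" "i \<in> U"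
  shows "degree I (U - {i}) x = degree I U x - mult I i x"
    and "pos_sum I (U - {i}) x = pos_sum I U x - i * mult I i x"
  using assms by (simp_all add: degree_def pos_sum_def sum_diff1_nat)

text \<open>An assigned vertex has degree zero among the open positions. Hence a vertex of positive
  degree is still free, and every solution must give it to an open position; this makes the next
  forced step valid.\<close>

definition peel_inv :: "(nat \<Rightarrow> nat) \<Rightarrow> (nat \<Rightarrow> nat) \<Rightarrow> (nat \<Rightarrow> nat) \<Rightarrow> (nat \<Rightarrow> nat) \<Rightarrow> bool" where
  "peel_inv o0 o1 deg su \<longleftrightarrow>
     (\<forall>x\<in>{1..num I}. deg x = degree I (open_positions I o0) x \<and>
        su x = pos_sum I (open_positions I o0) x) \<and>
     (\<forall>i\<in>{1..num I}. o0 i \<noteq> 0 \<longrightarrow> o1 i = o0 i \<and> o0 i \<in> {lo I i, hi I i} \<and>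
        degree I (open_positions I o0) (o0 i) = 0 \<and> (\<forall>f\<in>solutions I. f i = o0 i))"

text \<open>Degree 1 leaves a single term in the position sum, which is therefore the position
  itself. It also rules out a double edge, which counts 2, so \<open>y\<close> differs from
  \<open>u\<close>. A solution has to give \<open>u\<close> to some position; a position decided
  before would leave \<open>u\<close> with degree zero, so it is the only open one at
  \<open>u\<close>.\<close>

lemma peel_step:
  assumes inv: "peel_inv o0 o1 deg su" and u: "u \<in> {1..num I}" and deg: "deg u = 1"
    and i: "i = su u" and y: "y = lo I i + hi I i - u"
  shows "i \<in> {1..num I}" "o0 i = 0" "y \<in> {1..num I}" "y \<noteq> u"
    "peel_inv (o0(i := u)) (o1(i := u)) (deg(u := deg u - 1, y := deg y - 1)) (su(u := su u - i, y := su y - i))"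
    "open_positions I (o0(i := u)) = open_positions I o0 - {i}"
proof -
  let ?U = "open_positions I o0"
  have fin: "finite ?U" by (simp add: open_positions_def)
  have "degree I ?U u = Suc 0" using inv u deg by (auto simp: peel_inv_def)
  then obtain k where k: "k \<in> ?U" "mult I k u = Suc 0" "\<And>j. j \<in> ?U \<Longrightarrow> j \<noteq> k \<Longrightarrow> mult I j u = 0"
    unfolding degree_def using sum_eq_Suc0_iff[OF fin] by metis
  have "su u = (\<Sum>j\<in>?U. j * mult I j u)" using inv u by (auto simp: peel_inv_def pos_sum_def)
  also have "\<dots> = (\<Sum>j\<in>?U. if j = k then k else 0)" using k by (intro sum.cong) auto
  also have "\<dots> = k" using k fin by simp
  finally have ik: "i = k" using i by simp
  have iU: "i \<in> ?U" using k ik by simp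
  then show i1: "i \<in> {1..num I}" and "o0 i = 0" by (auto simp: open_positions_def)
  have ends: "u \<noteq> y \<and> (lo I i = u \<and> hi I i = y \<or> lo I i = y \<and> hi I i = u)"
    using k(2) y unfolding ik mult_def by (auto split: if_splits)
  then show y1: "y \<in> {1..num I}" and "y \<noteq> u" using ends_range[OF i1] by auto
  have U': "open_positions I (o0(i := u)) = ?U - {i}" using u by (auto simp: open_positions_def)
  then show "open_positions I (o0(i := u)) = ?U - {i}" .
  have m: "mult I i x = (if x = u \<or> x = y then 1 else 0)" for x using ends by (auto simp: mult_def)
  have forced: "f i = u" if f: "f \<in> solutions I" for f
  proof -
    obtain j where j: "j \<in> {1..num I}" "f j = u" using solution_surj[OF f u] by blast
    have "j \<in> ?U"
    proof (rule ccontr)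
      assume "j \<notin> ?U"
      then have "o0 j \<noteq> 0" using j by (auto simp: open_positions_def)
      then have "degree I ?U u = 0" using inv j f unfolding peel_inv_def by metis
      then show False using \<open>degree I ?U u = Suc 0\<close> by simp
    qed
    moreover have "0 < mult I j u" using solution_req[OF f j(1)] j(2) mult_pos_iff by simp
    ultimately show ?thesis using k(3) ik j by fastforce
  qed
  show "peel_inv (o0(i := u)) (o1(i := u)) (deg(u := deg u - 1, y := deg y - 1))
      (su(u := su u - i, y := su y - i))"
    unfolding peel_inv_def U'
  proof (intro conjI ballI impI)
    fix x assume "x \<in> {1..num I}"
    then show "(deg(u := deg u - 1, y := deg y - 1)) x = degree I (?U - {i}) x"
      "(su(u := su u - i, y := su y - i)) x = pos_sum I (?U - {i}) x"
      using inv unfolding degree_remove[OF fin iU] m by (auto simp: peel_inv_def)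
  next
    fix j assume j: "j \<in> {1..num I}" "(o0(i := u)) j \<noteq> 0"
    show "(o1(i := u)) j = (o0(i := u)) j" "(o0(i := u)) j \<in> {lo I j, hi I j}"
      using inv j ends unfolding peel_inv_def by (cases "j = i"; auto)+
    show "degree I (?U - {i}) ((o0(i := u)) j) = 0"
      using inv j \<open>degree I ?U u = Suc 0\<close> unfolding degree_remove[OF fin iU] m peel_inv_def
      by (cases "j = i") auto
    fix f assume "f \<in> solutions I"
    then show "f j = (o0(i := u)) j"
      using inv j forced unfolding peel_inv_def by (cases "j = i") auto
  qed
qed

text \<open>Fix a solution \<open>f\<close>. The degrees add up to twice the number of open
  positions. There are as many vertices that \<open>f\<close> gives to open positions, and each of
  them has a positive degree other than 1, hence at least 2. So all of them have degree exactly 2,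
  and nothing remains for the other vertices.\<close>

lemma peeled_two_regular:
  assumes inv: "peel_inv o0 o1 deg su" and deg: "\<And>x. x \<in> {1..num I} \<Longrightarrow> deg x \<noteq> 1"
    and x: "x \<in> {1..num I}"
  shows "degree I (open_positions I o0) x \<in> {0, 2}"
proof -
  let ?U = "open_positions I o0"
  obtain f where f: "f \<in> solutions I" using feas by (auto simp: feasible_def)
  have U: "finite ?U" "?U \<subseteq> {1..num I}" by (auto simp: open_positions_def)
  have inj: "inj_on f ?U" using solution_inj[OF f] U(2) by (meson inj_onI subsetD)
  have fU: "f ` ?U \<subseteq> {1..num I}"
    using solution_range[OF f] U(2) by blast
  have "(\<Sum>x\<in>{1..num I}. mult I i x) = 2" if "i \<in> ?U" for i
    using ends_range[of i] U(2) that unfolding mult_def sum.distrib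
    by (simp add: subset_iff)
  then have "(\<Sum>x\<in>{1..num I}. degree I ?U x) = 2 * card ?U"
    unfolding degree_def by (subst sum.swap) simp
  also have "\<dots> = (\<Sum>x\<in>{1..num I}. if x \<in> f ` ?U then 2 else 0)"
    using fU inj by (simp add: sum.If_cases card_image Int_absorb1)
  finally have "(\<Sum>x\<in>{1..num I}. if x \<in> f ` ?U then 2 else 0) = (\<Sum>x\<in>{1..num I}. degree I ?U x)" ..
  moreover have "(if x \<in> f ` ?U then 2 else 0) \<le> degree I ?U x" if x: "x \<in> {1..num I}" for x
  proof (cases "x \<in> f ` ?U")
    case True
    then obtain i where i: "i \<in> ?U" "f i = x" by blast
    then have "i \<in> {1..num I}" using U(2) by blast
    then have "0 < degree I ?U x" using degree_pos[OF U(1) i(1)] solution_req[OF f] i(2) by metis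
    moreover have "degree I ?U x \<noteq> 1" using inv deg x by (auto simp: peel_inv_def)
    ultimately show ?thesis by simp
  qed simp
  ultimately have "(if x \<in> f ` ?U then 2 else 0) = degree I ?U x"
    using x by (intro sum_mono_inv[of _ "{1..num I}" "degree I ?U"]) auto
  then show ?thesis by (auto split: if_splits)
qed

end


section \<open>Traversing the cycles\<close>

locale two_regular = feasible_instance +
  fixes U :: "nat set"
  assumes U: "U \<subseteq> {1..num I}"
    and two_regular: "x \<in> {1..num I} \<Longrightarrow> degree I U x \<in> {0, 2}"
begin

lemma finite_U: "finite U"
  using U finite_subset by blast

text \<open>On a double edge the position is counted twice in the sum, so that it becomes its own
  partner.\<close>

definition partner :: "nat \<Rightarrow> nat \<Rightarrow> nat" where
  "partner x i = pos_sum I U x - i"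

lemma partner:
  assumes i: "i \<in> U" "x \<in> {lo I i, hi I i}"
  shows "partner x i \<in> U" "x \<in> {lo I (partner x i), hi I (partner x i)}"
    "lo I i \<noteq> hi I i \<Longrightarrow> partner x i \<noteq> i" "lo I i = hi I i \<Longrightarrow> partner x i = i"
    "\<And>k. k \<in> U \<Longrightarrow> x \<in> {lo I k, hi I k} \<Longrightarrow> k = i \<or> k = partner x i"
proof -
  have x: "x \<in> {1..num I}" using i ends_range[of i] U by blast
  then have two: "degree I U x = 2" using two_regular degree_pos[OF finite_U i] by fastforce
  have split: "degree I U x = mult I i x + (\<Sum>j\<in>U - {i}. mult I j x)"
    "pos_sum I U x = i * mult I i x + (\<Sum>j\<in>U - {i}. j * mult I j x)"
    unfolding degree_def pos_sum_def using i finite_U by (auto intro: sum.remove)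
  have "partner x i \<in> U \<and> x \<in> {lo I (partner x i), hi I (partner x i)} \<and>
      (lo I i \<noteq> hi I i \<longrightarrow> partner x i \<noteq> i) \<and> (lo I i = hi I i \<longrightarrow> partner x i = i) \<and>
      (\<forall>k. k \<in> U \<longrightarrow> x \<in> {lo I k, hi I k} \<longrightarrow> k = i \<or> k = partner x i)"
  proof (cases "lo I i = hi I i")
    case True
    then have m: "mult I i x = 2" using i by (auto simp: mult_def)
    then have zero: "\<forall>j\<in>U - {i}. mult I j x = 0" using split(1) two finite_U by simp
    then have p: "partner x i = i" using split(2) m by (simp add: partner_def)
    have uniq: "k = i" if "k \<in> U" "x \<in> {lo I k, hi I k}" for k
    proof (rule ccontr)
      assume "k \<noteq> i"
      then have "mult I k x = 0" using zero that(1) by blast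
      then show False using mult_pos_iff[of k x] that(2) by simp
    qed
    show ?thesis unfolding p using i True uniq by blast
  next
    case False
    then have m: "mult I i x = 1" using i by (auto simp: mult_def)
    then have "(\<Sum>j\<in>U - {i}. mult I j x) = Suc 0" using split(1) two by simp
    then obtain k where k: "k \<in> U - {i}" "mult I k x = Suc 0"
      "\<And>j. j \<in> U - {i} \<Longrightarrow> j \<noteq> k \<Longrightarrow> mult I j x = 0"
      using sum_eq_Suc0_iff[of "U - {i}"] finite_U by (metis finite_Diff)
    have "(\<Sum>j\<in>U - {i}. j * mult I j x) = (\<Sum>j\<in>U - {i}. if j = k then k else 0)"
      using k by (intro sum.cong) auto
    also have "\<dots> = k" using k(1) finite_U by simp
    finally have p: "partner x i = k" using split(2) m by (simp add: partner_def)
    have k': "x \<in> {lo I k, hi I k}" using k(2) mult_pos_iff[of k x] by simp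
    have uniq: "j = i \<or> j = k" if "j \<in> U" "x \<in> {lo I j, hi I j}" for j
    proof (rule ccontr)
      assume "\<not> (j = i \<or> j = k)"
      then have "mult I j x = 0" using k(3) that(1) by blast
      then show False using mult_pos_iff[of j x] that(2) by simp
    qed
    show ?thesis unfolding p using False k(1) k' uniq by blast
  qed
  then show "partner x i \<in> U" "x \<in> {lo I (partner x i), hi I (partner x i)}"
    "lo I i \<noteq> hi I i \<Longrightarrow> partner x i \<noteq> i" "lo I i = hi I i \<Longrightarrow> partner x i = i"
    "\<And>k. k \<in> U \<Longrightarrow> x \<in> {lo I k, hi I k} \<Longrightarrow> k = i \<or> k = partner x i"
    by blast+
qed

definition visited :: "(nat \<Rightarrow> nat) \<Rightarrow> nat set" where
  "visited o0 = {i \<in> U. o0 i \<noteq> 0}"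

text \<open>Cycles are recorded only through a successor and a predecessor with the same label.
  Labels from \<open>q\<close> on may only sit on positions whose options agree: a double edge
  receives the current \<open>q\<close> without advancing it, and the next cycle may reuse this
  number. Forced positions are harmless under any label for the same reason. The bound by
  \<open>card (visited o0)\<close> serves to keep labels below \<open>n\<close>, where they index
  rows of the coefficient matrix.\<close>

definition cycles_inv :: "nat \<Rightarrow> (nat \<Rightarrow> nat) \<Rightarrow> (nat \<Rightarrow> nat) \<Rightarrow> (nat \<Rightarrow> nat) \<Rightarrow> bool" where
  "cycles_inv q o0 o1 cy \<longleftrightarrow>
     (\<forall>i\<in>{1..num I} - U. o0 i \<noteq> 0 \<and> o1 i = o0 i \<and> o0 i \<in> {lo I i, hi I i} \<and> (\<forall>f\<in>solutions I. f i = o0 i)) \<and>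
     (\<forall>i\<in>visited o0. o0 i \<in> {lo I i, hi I i} \<and> o1 i = lo I i + hi I i - o0 i) \<and>
     (\<forall>i\<in>visited o0. \<exists>j\<in>visited o0. cy j = cy i \<and> o0 j = o1 i) \<and>
     (\<forall>i\<in>visited o0. \<exists>j\<in>visited o0. cy j = cy i \<and> o1 j = o0 i) \<and>
     (\<forall>c. \<forall>f\<in>solutions I. (\<forall>i\<in>visited o0. cy i = c \<longrightarrow> f i = o0 i) \<or>
        (\<forall>i\<in>visited o0. cy i = c \<longrightarrow> f i = o1 i)) \<and>
     (\<forall>i\<in>visited o0. q \<le> cy i \<longrightarrow> o0 i = o1 i) \<and>
     (\<forall>c<q. \<exists>i\<in>visited o0. cy i = c \<and> o0 i \<noteq> o1 i) \<and>
     q \<le> card (visited o0) \<and> (\<forall>i\<in>{1..num I}. cy i < num I)"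

text \<open>
  The walk started from position \<open>i0\<close> in the state \<open>o0', o1', cy'\<close> and has visited \<open>W\<close> since.
  It is about to enter position \<open>p\<close> through vertex \<open>x\<close>.
\<close>

definition walk_inv where
  "walk_inv q o0' o1' cy' i0 o0 o1 cy p x \<longleftrightarrow>
     (let W = visited o0 - visited o0' in
     i0 \<in> U \<and> o0' i0 = 0 \<and>
     visited o0' \<subseteq> visited o0 \<and> (\<forall>i. i \<notin> W \<longrightarrow> o0 i = o0' i \<and> o1 i = o1' i \<and> cy i = cy' i) \<and>
     (\<forall>i\<in>W. o0 i \<in> {lo I i, hi I i} \<and> o1 i = lo I i + hi I i - o0 i \<and> cy i = q) \<and>
     p \<in> U \<and> x \<in> {lo I p, hi I p} \<and> p \<notin> visited o0' \<and>
     (W = {} \<and> p = i0 \<and> x = lo I i0 \<or>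
      i0 \<in> W \<and> o0 i0 = lo I i0 \<and>
      (\<exists>l\<in>W. o1 l = x \<and> p = partner x l \<and> (\<forall>i\<in>W. i \<noteq> l \<longrightarrow> o1 i \<noteq> x \<and> (\<exists>j\<in>W. o0 j = o1 i)) \<and>
        (\<forall>f\<in>solutions I. f l = o0 l \<longrightarrow> (\<forall>i\<in>W. f i = o0 i)))) \<and>
     (\<forall>i\<in>W. o0 i = x \<longrightarrow> x = lo I i0) \<and>
     (\<forall>i\<in>W. i \<noteq> i0 \<longrightarrow> (\<exists>j\<in>W. j \<noteq> i \<and> o1 j = o0 i)) \<and>
     (\<forall>f\<in>solutions I. f i0 = o1 i0 \<longrightarrow> (\<forall>i\<in>W. f i = o1 i)) \<and>
     (lo I i0 = hi I i0 \<longrightarrow> W \<subseteq> {i0}))"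

text \<open>Within the visited positions each vertex of \<open>i\<close> already has degree two,
  through another visited position or through \<open>i\<close> itself if it is a double edge. So the
  visited positions are cut off from the rest, and a new walk cannot run into them.\<close>

lemma cycles_inv_closed:
  assumes inv: "cycles_inv q o0 o1 cy" and i: "i \<in> visited o0" "x \<in> {lo I i, hi I i}"
    and j: "j \<in> U" "x \<in> {lo I j, hi I j}"
  shows "j \<in> visited o0"
proof -
  have iU: "i \<in> U" using i by (auto simp: visited_def)
  have opt: "{lo I k, hi I k} = {o0 k, o1 k}" if "k \<in> visited o0" for k
  proof -
    have "o0 k \<in> {lo I k, hi I k} \<and> o1 k = lo I k + hi I k - o0 k"
      using inv that by (simp add: cycles_inv_def)
    then show ?thesis by auto
  qed
  obtain k where k: "k \<in> visited o0" "x \<in> {lo I k, hi I k}" "k \<noteq> i \<or> lo I i = hi I i"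
  proof (cases "x = o1 i")
    case True
    obtain k where "k \<in> visited o0" "o0 k = o1 i" using inv i(1) unfolding cycles_inv_def by blast
    then show ?thesis using that[of k] True opt[of k] opt[OF i(1)] by (cases "k = i") auto
  next
    case False
    then have "x = o0 i" using i opt[OF i(1)] by auto
    moreover obtain k where "k \<in> visited o0" "o1 k = o0 i" using inv i(1) unfolding cycles_inv_def by blast
    ultimately show ?thesis using that[of k] opt[of k] opt[OF i(1)] by (cases "k = i") auto
  qed
  have "j = i \<or> j = partner x i" using partner(5)[OF iU i(2) j] .
  moreover have "k = i \<or> k = partner x i"
    using partner(5)[OF iU i(2), of k] k by (auto simp: visited_def)
  moreover have "lo I i = hi I i \<Longrightarrow> partner x i = i" using partner(4)[OF iU i(2)] .
  ultimately show ?thesis using i(1) k by auto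
qed

lemma walk_start:
  assumes "cycles_inv q o0 o1 cy" "i \<in> U" "o0 i = 0"
  shows "walk_inv q o0 o1 cy i o0 o1 cy i (lo I i)"
  using assms by (auto simp: walk_inv_def visited_def)

text \<open>Let \<open>l\<close> be the position visited last, which was left through
  \<open>x\<close>. The two statements about solutions grow from opposite ends. If
  \<open>f i0\<close> is the exit option, so is \<open>f l = x\<close>, and injectivity pushes
  \<open>f p\<close> to \<open>y\<close>. If \<open>f p = x\<close>, then \<open>f l\<close> is not
  \<open>x\<close>, so \<open>l\<close> takes its entry option and therefore all of \<open>W\<close>
  does.\<close>

lemma walk_step:
  assumes inv0: "cycles_inv q o0' o1' cy'"
    and inv: "walk_inv q o0' o1' cy' i0 o0 o1 cy p x"
    and p: "o0 p = 0" and y: "y = lo I p + hi I p - x"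
  shows "p \<in> U" "x \<in> {1..num I}" "y \<in> {1..num I}" "visited (o0(p := x)) = insert p (visited o0)"
    "walk_inv q o0' o1' cy' i0 (o0(p := x)) (o1(p := y)) (cy(p := q)) (partner y p) y"
proof -
  define W where "W = visited o0 - visited o0'"
  have start: "i0 \<in> U" "o0' i0 = 0" "visited o0' \<subseteq> visited o0"
    and old: "\<And>i. i \<notin> W \<Longrightarrow> o0 i = o0' i \<and> o1 i = o1' i \<and> cy i = cy' i"
    and cur: "\<And>i. i \<in> W \<Longrightarrow> o0 i \<in> {lo I i, hi I i} \<and> o1 i = lo I i + hi I i - o0 i \<and> cy i = q"
    and pU: "p \<in> U" and xp: "x \<in> {lo I p, hi I p}" and pold: "p \<notin> visited o0'"
    and last: "W = {} \<and> p = i0 \<and> x = lo I i0 \<or> i0 \<in> W \<and> o0 i0 = lo I i0 \<and>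
      (\<exists>l\<in>W. o1 l = x \<and> p = partner x l \<and> (\<forall>i\<in>W. i \<noteq> l \<longrightarrow> o1 i \<noteq> x \<and> (\<exists>j\<in>W. o0 j = o1 i)) \<and>
        (\<forall>f\<in>solutions I. f l = o0 l \<longrightarrow> (\<forall>i\<in>W. f i = o0 i)))"
    and noin: "\<And>i. i \<in> W \<Longrightarrow> o0 i = x \<Longrightarrow> x = lo I i0"
    and pred: "\<And>i. i \<in> W \<Longrightarrow> i \<noteq> i0 \<Longrightarrow> \<exists>j\<in>W. j \<noteq> i \<and> o1 j = o0 i"
    and fwd: "\<And>f. f \<in> solutions I \<Longrightarrow> f i0 = o1 i0 \<Longrightarrow> \<forall>i\<in>W. f i = o1 i"
    and loop: "lo I i0 = hi I i0 \<Longrightarrow> W \<subseteq> {i0}"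
    using inv unfolding walk_inv_def Let_def W_def[symmetric] by blast+
  show "p \<in> U" by (fact pU)
  have pI: "p \<in> {1..num I}" using pU U by blast
  have ends: "{lo I p, hi I p} = {x, y}" using xp y by auto
  then show x1: "x \<in> {1..num I}" and "y \<in> {1..num I}"
    using ends_range[OF pI] by (auto simp: doubleton_eq_iff)
  have yp: "y \<in> {lo I p, hi I p}" using ends by auto
  show vis: "visited (o0(p := x)) = insert p (visited o0)" using pU x1 by (auto simp: visited_def)
  have pW: "p \<notin> W" "p \<notin> visited o0" using p by (auto simp: W_def visited_def)
  have WU: "W \<subseteq> U" by (auto simp: W_def visited_def)
  have curends: "{lo I i, hi I i} = {o0 i, o1 i}" if "i \<in> W" for i
    using cur[OF that] by auto
  have W': "visited (o0(p := x)) - visited o0' = insert p W" using vis pold by (auto simp: W_def)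
  \<comment> \<open>A double edge uses up the degree of its vertex, so it cannot be entered from
    another position; it occurs only as the first step of a walk.\<close>
  have xy: "W = {} \<and> x = lo I i0" if "y = x"
  proof (rule ccontr)
    assume "\<not> (W = {} \<and> x = lo I i0)"
    then obtain l where l: "l \<in> W" "o1 l = x" using last by blast
    then have "l = p \<or> l = partner x p"
      using partner(5)[OF pU xp, of l] WU curends[OF l(1)] by blast
    moreover have "partner x p = p" using partner(4)[OF pU xp] ends that by auto
    ultimately show False using l pW by auto
  qed
  \<comment> \<open>An earlier exit through \<open>y\<close> would be followed by an entry through
    \<open>y\<close>. Degree two leaves just one position besides \<open>p\<close> for both roles;
    it would be a double edge at \<open>y\<close> and exclude \<open>p\<close>.\<close>
  have new: "o1 i \<noteq> y" if i: "i \<in> W" for i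
  proof
    assume eq: "o1 i = y"
    obtain l where l: "l \<in> W" "o1 l = x" "\<And>i. i \<in> W \<Longrightarrow> i \<noteq> l \<Longrightarrow> \<exists>j\<in>W. o0 j = o1 i"
      using last i by blast
    have "i \<noteq> l" using l eq xy i by auto
    then obtain j where j: "j \<in> W" "o0 j = y" using l i eq by blast
    have "i = partner y p" "j = partner y p"
      using partner(5)[OF pU yp, of i] partner(5)[OF pU yp, of j] i j eq WU curends pW by blast+
    then have "o0 i = y" using j by simp
    then have "lo I i = hi I i" "y \<in> {lo I i, hi I i}" using curends[OF i] eq by auto
    then have "partner y i = i" using partner(4)[of i y] i WU by blast
    moreover have "p = i \<or> p = partner y i"
      using partner(5)[OF _ \<open>y \<in> {lo I i, hi I i}\<close> pU yp] i WU by blast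
    ultimately show False using i pW by auto
  qed
  have nxt: "partner y p \<in> U" "y \<in> {lo I (partner y p), hi I (partner y p)}"
    using partner[OF pU yp] by auto
  have nold: "partner y p \<notin> visited o0'"
    using cycles_inv_closed[OF inv0 _ nxt(2) pU yp] pold by blast
  have sol: "f i = o0 i \<or> f i = o1 i" if "f \<in> solutions I" "i \<in> W" for f i
    using solution_req[OF that(1), of i] curends[OF that(2)] that(2) WU U by blast
  have solp: "f p = x \<or> f p = y" if "f \<in> solutions I" for f
    using solution_req[OF that pI] ends by blast
  have clash: "\<not> (f l = x \<and> f p = x)" if "f \<in> solutions I" "l \<in> W" for f l
  proof
    assume "f l = x \<and> f p = x"
    moreover have "l \<in> {1..num I}" using that(2) WU U by auto
    ultimately have "l = p" using solution_inj[OF that(1) _ pI] by metis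
    then show False using that(2) pW by simp
  qed
  show "walk_inv q o0' o1' cy' i0 (o0(p := x)) (o1(p := y)) (cy(p := q)) (partner y p) y"
    unfolding walk_inv_def Let_def W'
  proof (intro conjI)
    show "i0 \<in> U" "o0' i0 = 0" by fact+
    show "visited o0' \<subseteq> visited (o0(p := x))" using start(3) vis by auto
    show "\<forall>i. i \<notin> insert p W \<longrightarrow> (o0(p := x)) i = o0' i \<and> (o1(p := y)) i = o1' i \<and> (cy(p := q)) i = cy' i"
      using old by auto
    show "\<forall>i\<in>insert p W. (o0(p := x)) i \<in> {lo I i, hi I i} \<and>
        (o1(p := y)) i = lo I i + hi I i - (o0(p := x)) i \<and> (cy(p := q)) i = q"
      using cur xp y pW by auto
    show "partner y p \<in> U" "y \<in> {lo I (partner y p), hi I (partner y p)}" by fact+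
    show "partner y p \<notin> visited o0'" by fact
    have i0: "i0 \<in> insert p W \<and> (o0(p := x)) i0 = lo I i0" using last pW by auto
    have "\<exists>j\<in>insert p W. (o0(p := x)) j = o1 i" if "i \<in> W" for i
    proof -
      obtain l where "l \<in> W" "o1 l = x" "i \<noteq> l \<longrightarrow> (\<exists>j\<in>W. o0 j = o1 i)" using last \<open>i \<in> W\<close> by blast
      then show ?thesis using pW by (cases "i = l") auto
    qed
    \<comment> \<open>This is the backward implication: the entry option at the new end
      \<open>p\<close> forces the entry option on the whole path.\<close>
    moreover have "\<forall>i\<in>W. f i = o0 i" if f: "f \<in> solutions I" "f p = x" for f
    proof (cases "W = {}")
      case False
      then obtain l where l: "l \<in> W" "o1 l = x" "f l = o0 l \<longrightarrow> (\<forall>i\<in>W. f i = o0 i)"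
        using last f(1) by blast
      then show ?thesis using clash[OF f(1) l(1)] sol[OF f(1) l(1)] f(2) by auto
    qed simp
    ultimately show "insert p W = {} \<and> partner y p = i0 \<and> y = lo I i0 \<or>
      i0 \<in> insert p W \<and> (o0(p := x)) i0 = lo I i0 \<and>
      (\<exists>l\<in>insert p W. (o1(p := y)) l = y \<and> partner y p = partner y l \<and>
        (\<forall>i\<in>insert p W. i \<noteq> l \<longrightarrow> (o1(p := y)) i \<noteq> y \<and>
          (\<exists>j\<in>insert p W. (o0(p := x)) j = (o1(p := y)) i)) \<and>
        (\<forall>f\<in>solutions I. f l = (o0(p := x)) l \<longrightarrow> (\<forall>i\<in>insert p W. f i = (o0(p := x)) i)))"
      using i0 new pW by (intro disjI2 conjI bexI[of _ p]) auto
    show "\<forall>i\<in>insert p W. (o0(p := x)) i = y \<longrightarrow> y = lo I i0"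
    proof (intro ballI impI)
      fix i assume i: "i \<in> insert p W" "(o0(p := x)) i = y"
      show "y = lo I i0"
      proof (cases "i = p")
        case True
        then show ?thesis using i xy by auto
      next
        case False
        then have iW: "i \<in> W" "o0 i = y" using i by auto
        show ?thesis
        proof (cases "i = i0")
          case True
          then show ?thesis using iW last by auto
        next
          case False
          then show ?thesis using pred[OF iW(1)] new iW(2) by metis
        qed
      qed
    qed
    show "\<forall>i\<in>insert p W. i \<noteq> i0 \<longrightarrow> (\<exists>j\<in>insert p W. j \<noteq> i \<and> (o1(p := y)) j = (o0(p := x)) i)"
    proof (intro ballI impI)
      fix i assume i: "i \<in> insert p W" "i \<noteq> i0"
      show "\<exists>j\<in>insert p W. j \<noteq> i \<and> (o1(p := y)) j = (o0(p := x)) i"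
      proof (cases "i = p")
        case True
        then obtain l where "l \<in> W" "o1 l = x" using last i(2) by blast
        then show ?thesis using True pW by (intro bexI[of _ l]) auto
      next
        case False
        then obtain j where "j \<in> W" "j \<noteq> i" "o1 j = o0 i" using pred i by blast
        then show ?thesis using False pW by (intro bexI[of _ j]) auto
      qed
    qed
    show "\<forall>f\<in>solutions I. f i0 = (o1(p := y)) i0 \<longrightarrow> (\<forall>i\<in>insert p W. f i = (o1(p := y)) i)"
    proof (intro ballI impI)
      fix f i assume f: "f \<in> solutions I" "f i0 = (o1(p := y)) i0" and i: "i \<in> insert p W"
      show "f i = (o1(p := y)) i"
      proof (cases "W = {}")
        case True
        then show ?thesis using f(2) i last by auto
      next
        case False
        then obtain l where l: "l \<in> W" "o1 l = x" "i0 \<in> W" using last by blast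
        then have all: "\<forall>i\<in>W. f i = o1 i" using fwd[OF f(1)] f(2) pW by (auto split: if_splits)
        then have "f p = y" using clash[OF f(1) l(1)] solp[OF f(1)] l by auto
        then show ?thesis using all i by auto
      qed
    qed
    show "lo I i0 = hi I i0 \<longrightarrow> insert p W \<subseteq> {i0}"
    proof
      assume lh: "lo I i0 = hi I i0"
      have "p = i0"
      proof (cases "W = {}")
        case False
        then obtain l where l: "l \<in> W" "o1 l = x" "p = partner x l" using last by blast
        then have "l = i0" using loop[OF lh] by auto
        then show ?thesis using partner(4)[of l x] l lh WU curends[OF l(1)] by auto
      qed (use last in auto)
      then show "insert p W \<subseteq> {i0}" using loop[OF lh] by auto
    qed
  qed
qed

text \<open>A walk can stop only at its own start, which closes the chain of entries and exits. A
  solution is uniform on the new label: either \<open>f i0\<close> is the exit option and all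
  positions follow forwards, or \<open>f i0 = x\<close> keeps the last position \<open>l\<close>
  away from \<open>x\<close>, so \<open>l\<close> takes its entry option and all follow
  backwards.\<close>

lemma walk_end:
  assumes inv0: "cycles_inv q o0' o1' cy'"
    and inv: "walk_inv q o0' o1' cy' i0 o0 o1 cy p x"
    and p: "o0 p \<noteq> 0"
  shows "cycles_inv (q + (if lo I i0 = hi I i0 then 0 else 1)) o0 o1 cy"
    "visited o0' \<subseteq> visited o0" "i0 \<in> visited o0"
proof -
  define W where "W = visited o0 - visited o0'"
  have start: "i0 \<in> U" "o0' i0 = 0" "visited o0' \<subseteq> visited o0"
    and old: "\<And>i. i \<notin> W \<Longrightarrow> o0 i = o0' i \<and> o1 i = o1' i \<and> cy i = cy' i"
    and cur: "\<And>i. i \<in> W \<Longrightarrow> o0 i \<in> {lo I i, hi I i} \<and> o1 i = lo I i + hi I i - o0 i \<and> cy i = q"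
    and pU: "p \<in> U" and xp: "x \<in> {lo I p, hi I p}" and pold: "p \<notin> visited o0'"
    and last: "W = {} \<and> p = i0 \<and> x = lo I i0 \<or> i0 \<in> W \<and> o0 i0 = lo I i0 \<and>
      (\<exists>l\<in>W. o1 l = x \<and> p = partner x l \<and> (\<forall>i\<in>W. i \<noteq> l \<longrightarrow> o1 i \<noteq> x \<and> (\<exists>j\<in>W. o0 j = o1 i)) \<and>
        (\<forall>f\<in>solutions I. f l = o0 l \<longrightarrow> (\<forall>i\<in>W. f i = o0 i)))"
    and noin: "\<And>i. i \<in> W \<Longrightarrow> o0 i = x \<Longrightarrow> x = lo I i0"
    and pred: "\<And>i. i \<in> W \<Longrightarrow> i \<noteq> i0 \<Longrightarrow> \<exists>j\<in>W. j \<noteq> i \<and> o1 j = o0 i"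
    and fwd: "\<And>f. f \<in> solutions I \<Longrightarrow> f i0 = o1 i0 \<Longrightarrow> \<forall>i\<in>W. f i = o1 i"
    and loop: "lo I i0 = hi I i0 \<Longrightarrow> W \<subseteq> {i0}"
    using inv unfolding walk_inv_def Let_def W_def[symmetric] by blast+
  have pW: "p \<in> W" using p pU pold by (auto simp: W_def visited_def)
  have WU: "W \<subseteq> U" by (auto simp: W_def visited_def)
  have curends: "{lo I i, hi I i} = {o0 i, o1 i}" if "i \<in> W" for i
    using cur[OF that] by auto
  obtain l where l: "l \<in> W" "o1 l = x" "p = partner x l"
      "\<And>i. i \<in> W \<Longrightarrow> i \<noteq> l \<Longrightarrow> o1 i \<noteq> x \<and> (\<exists>j\<in>W. o0 j = o1 i)"
      "\<And>f. f \<in> solutions I \<Longrightarrow> f l = o0 l \<Longrightarrow> \<forall>i\<in>W. f i = o0 i"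
    and i0: "i0 \<in> W" "o0 i0 = lo I i0" using last pW by blast
  \<comment> \<open>Position \<open>p\<close> already has \<open>x\<close> as its entry or its exit.
    In the latter case \<open>p\<close> is the last position \<open>l\<close> and its own partner,
    hence a double edge, where entry and exit agree.\<close>
  have x0: "x = lo I i0"
  proof (cases "o0 p = x")
    case True
    then show ?thesis using noin pW by blast
  next
    case False
    then have "o1 p = x" using curends[OF pW] xp by auto
    then have "p = l" using l(4)[OF pW] by blast
    then have "lo I l = hi I l"
      using partner(3)[of l x] l WU curends[OF l(1)] by auto
    then have "o0 l = x" using curends[OF l(1)] l(2) by auto
    then show ?thesis using noin l(1) by blast
  qed
  show "visited o0' \<subseteq> visited o0" by fact
  show i0v: "i0 \<in> visited o0" using i0 by (auto simp: W_def)
  have vis: "visited o0 = visited o0' \<union> W" using start(3) by (auto simp: W_def)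
  have disj: "i \<in> visited o0' \<Longrightarrow> o0 i = o0' i \<and> o1 i = o1' i \<and> cy i = cy' i" for i
    using old[of i] by (auto simp: W_def)
  have out: "i \<notin> U \<Longrightarrow> o0 i = o0' i \<and> o1 i = o1' i \<and> cy i = cy' i" for i
    using old[of i] WU by blast
  have inv0': "(\<forall>i\<in>{1..num I} - U. o0' i \<noteq> 0 \<and> o1' i = o0' i \<and> o0' i \<in> {lo I i, hi I i} \<and> (\<forall>f\<in>solutions I. f i = o0' i))"
     "(\<forall>i\<in>visited o0'. o0' i \<in> {lo I i, hi I i} \<and> o1' i = lo I i + hi I i - o0' i)"
     "(\<forall>i\<in>visited o0'. \<exists>j\<in>visited o0'. cy' j = cy' i \<and> o0' j = o1' i)"
     "(\<forall>i\<in>visited o0'. \<exists>j\<in>visited o0'. cy' j = cy' i \<and> o1' j = o0' i)"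
     "\<And>c f. f \<in> solutions I \<Longrightarrow> (\<forall>i\<in>visited o0'. cy' i = c \<longrightarrow> f i = o0' i) \<or>
        (\<forall>i\<in>visited o0'. cy' i = c \<longrightarrow> f i = o1' i)"
     "(\<forall>i\<in>visited o0'. q \<le> cy' i \<longrightarrow> o0' i = o1' i)"
     "(\<forall>c<q. \<exists>i\<in>visited o0'. cy' i = c \<and> o0' i \<noteq> o1' i)"
     "q \<le> card (visited o0')" "(\<forall>i\<in>{1..num I}. cy' i < num I)"
    using inv0 unfolding cycles_inv_def by blast+
  have sol: "f i = o0 i \<or> f i = o1 i" if "f \<in> solutions I" "i \<in> W" for f i
    using solution_req[OF that(1), of i] curends[OF that(2)] that(2) WU U by blast
  have card: "card (visited o0') < card (visited o0)"
  proof (rule psubset_card_mono)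
    show "finite (visited o0)" using finite_U by (simp add: visited_def)
    show "visited o0' \<subset> visited o0" using start(3) i0(1) by (auto simp only: W_def)
  qed
  have "card (visited o0) \<le> card {1..num I}"
    using U by (intro card_mono) (auto simp: visited_def)
  \<comment> \<open>At least one position more has been visited than \<open>q\<close> accounts for,
    so the label \<open>q\<close> is still a valid row index.\<close>
  then have qn: "q < num I" using card inv0'(8) by simp
  show "cycles_inv (q + (if lo I i0 = hi I i0 then 0 else 1)) o0 o1 cy"
    unfolding cycles_inv_def
  proof (intro conjI)
    show "\<forall>i\<in>{1..num I} - U. o0 i \<noteq> 0 \<and> o1 i = o0 i \<and> o0 i \<in> {lo I i, hi I i} \<and> (\<forall>f\<in>solutions I. f i = o0 i)"
      using inv0'(1) out by simp
    show "\<forall>i\<in>visited o0. o0 i \<in> {lo I i, hi I i} \<and> o1 i = lo I i + hi I i - o0 i"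
      using inv0'(2) cur disj unfolding vis by (simp add: ball_Un)
    show "\<forall>i\<in>visited o0. \<exists>j\<in>visited o0. cy j = cy i \<and> o0 j = o1 i"
    proof
      fix i assume "i \<in> visited o0"
      then consider "i \<in> visited o0'" | "i \<in> W" using vis by blast
      then show "\<exists>j\<in>visited o0. cy j = cy i \<and> o0 j = o1 i"
      proof cases
        case 1
        then obtain j where "j \<in> visited o0'" "cy' j = cy' i" "o0' j = o1' i" using inv0'(3) by blast
        then show ?thesis using disj[OF 1] disj[of j] vis by (intro bexI[of _ j]) auto
      next
        case 2
        obtain j where "j \<in> W" "o0 j = o1 i"
          using l(4)[OF 2] i0 l(2) x0 by (cases "i = l") auto
        then show ?thesis using cur 2 vis by (intro bexI[of _ j]) auto
      qed
    qed
    show "\<forall>i\<in>visited o0. \<exists>j\<in>visited o0. cy j = cy i \<and> o1 j = o0 i"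
    proof
      fix i assume "i \<in> visited o0"
      then consider "i \<in> visited o0'" | "i \<in> W" using vis by blast
      then show "\<exists>j\<in>visited o0. cy j = cy i \<and> o1 j = o0 i"
      proof cases
        case 1
        then obtain j where "j \<in> visited o0'" "cy' j = cy' i" "o1' j = o0' i" using inv0'(4) by blast
        then show ?thesis using disj[OF 1] disj[of j] vis by (intro bexI[of _ j]) auto
      next
        case 2
        obtain j where "j \<in> W" "o1 j = o0 i"
          using pred[OF 2] i0 l(1,2) x0 by (cases "i = i0") auto
        then show ?thesis using cur 2 vis by (intro bexI[of _ j]) auto
      qed
    qed
    show "\<forall>c. \<forall>f\<in>solutions I. (\<forall>i\<in>visited o0. cy i = c \<longrightarrow> f i = o0 i) \<or>
        (\<forall>i\<in>visited o0. cy i = c \<longrightarrow> f i = o1 i)"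
    proof (intro allI ballI)
      fix c f assume f: "f \<in> solutions I"
      have oldc: "(\<forall>i\<in>visited o0'. cy i = c \<longrightarrow> f i = o0 i) \<or> (\<forall>i\<in>visited o0'. cy i = c \<longrightarrow> f i = o1 i)"
        using inv0'(5)[OF f, of c] disj by auto
      show "(\<forall>i\<in>visited o0. cy i = c \<longrightarrow> f i = o0 i) \<or> (\<forall>i\<in>visited o0. cy i = c \<longrightarrow> f i = o1 i)"
      proof (cases "c = q")
        case False
        then show ?thesis using oldc cur unfolding vis by auto
      next
        case True
        \<comment> \<open>Earlier double edges may carry the label \<open>q\<close> as well; their
          coinciding options fit either alternative.\<close>
        then have "\<forall>i\<in>visited o0'. cy i = c \<longrightarrow> o0 i = o1 i" using inv0'(6) disj by auto
        then have oldq: "\<forall>i\<in>visited o0'. cy i = c \<longrightarrow> f i = o0 i \<and> f i = o1 i" using oldc by auto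
        have "(\<forall>i\<in>W. f i = o0 i) \<or> (\<forall>i\<in>W. f i = o1 i)"
        proof (cases "f i0 = o1 i0")
          case True
          then show ?thesis using fwd[OF f] by blast
        next
          case False
          then have fi0: "f i0 = o0 i0" using sol[OF f i0(1)] by blast
          have "f l = o0 l"
          proof (cases "l = i0")
            case False
            then have "f l \<noteq> x"
              using solution_inj[OF f, of l i0] fi0 i0 x0 l(1) WU U by (metis subsetD)
            then show ?thesis using sol[OF f l(1)] l(2) by auto
          qed (use fi0 in auto)
          then show ?thesis using l(5)[OF f] by blast
        qed
        then show ?thesis using oldq unfolding vis by blast
      qed
    qed
    show "\<forall>i\<in>visited o0. q + (if lo I i0 = hi I i0 then 0 else 1) \<le> cy i \<longrightarrow> o0 i = o1 i"
    proof (intro ballI impI)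
      fix i assume i: "i \<in> visited o0" "q + (if lo I i0 = hi I i0 then 0 else 1) \<le> cy i"
      show "o0 i = o1 i"
      proof (cases "i \<in> W")
        case True
        then have "lo I i0 = hi I i0" using i(2) cur[OF True] by (auto split: if_splits)
        then show ?thesis using loop True curends[OF True] by auto
      next
        case False
        then have "i \<in> visited o0'" using i(1) vis by blast
        then show ?thesis using inv0'(6) disj[of i] i(2) by auto
      qed
    qed
    show "\<forall>c<q + (if lo I i0 = hi I i0 then 0 else 1). \<exists>i\<in>visited o0. cy i = c \<and> o0 i \<noteq> o1 i"
    proof (intro allI impI)
      fix c assume c: "c < q + (if lo I i0 = hi I i0 then 0 else 1)"
      show "\<exists>i\<in>visited o0. cy i = c \<and> o0 i \<noteq> o1 i"
      proof (cases "c < q")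
        case True
        then obtain i where "i \<in> visited o0'" "cy' i = c" "o0' i \<noteq> o1' i" using inv0'(7) by blast
        then show ?thesis using disj[of i] vis by (intro bexI[of _ i]) auto
      next
        case False
        then have "lo I i0 \<noteq> hi I i0" "c = q" using c by (auto split: if_splits)
        then show ?thesis using i0v cur[OF i0(1)] i0(2) by (intro bexI[of _ i0]) auto
      qed
    qed
    show "q + (if lo I i0 = hi I i0 then 0 else 1) \<le> card (visited o0)" using card inv0'(8) by auto
    show "\<forall>i\<in>{1..num I}. cy i < num I"
      using inv0'(9) old cur qn by (metis)
  qed
qed

lemma cycles_inv_final:
  assumes inv: "cycles_inv q o0 o1 cy" and all: "U \<subseteq> visited o0"
  shows "cycle_structure I q o0 o1 cy"
proof
  have vis: "visited o0 = U" using all by (auto simp: visited_def)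
  have inv0': "\<And>i. i \<in> {1..num I} \<Longrightarrow> i \<notin> U \<Longrightarrow> o0 i \<noteq> 0 \<and> o1 i = o0 i \<and> o0 i \<in> {lo I i, hi I i} \<and> (\<forall>f\<in>solutions I. f i = o0 i)"
     "\<And>i. i\<in>U \<Longrightarrow> o0 i \<in> {lo I i, hi I i} \<and> o1 i = lo I i + hi I i - o0 i"
     "\<And>i. i\<in>U \<Longrightarrow> \<exists>j\<in>U. cy j = cy i \<and> o0 j = o1 i"
     "\<And>i. i\<in>U \<Longrightarrow> \<exists>j\<in>U. cy j = cy i \<and> o1 j = o0 i"
     "\<And>c f. f \<in> solutions I \<Longrightarrow> (\<forall>i\<in>U. cy i = c \<longrightarrow> f i = o0 i) \<or> (\<forall>i\<in>U. cy i = c \<longrightarrow> f i = o1 i)"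
     "\<And>i. i\<in>U \<Longrightarrow> q \<le> cy i \<Longrightarrow> o0 i = o1 i"
     "\<And>c. c<q \<Longrightarrow> \<exists>i\<in>U. cy i = c \<and> o0 i \<noteq> o1 i"
    using inv unfolding cycles_inv_def vis by blast+
  have ends: "{lo I i, hi I i} = {o0 i, o1 i}" if "i \<in> U" for i
    using inv0'(2)[OF that] by auto
  show "tspvr_instance I" "feasible I" by (fact inst feas)+
  show "o0 i \<in> req I i \<and> o1 i \<in> req I i" if i: "i \<in> {1..num I}" for i
    using req_eq(1)[OF i] inv0'(1)[OF i] ends[of i] by (cases "i \<in> U") auto
  show "\<exists>i\<in>{1..num I}. \<exists>j\<in>{1..num I}. cy i = cy j \<and> o1 i = x \<and> o0 j = x" if x: "x \<in> {1..num I}" for x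
  proof -
    \<comment> \<open>Any solution gives \<open>x\<close> to some position \<open>i\<close>. If
      \<open>i\<close> lies in \<open>U\<close>, its successor or predecessor supplies the other
      witness; otherwise \<open>i\<close> serves as both.\<close>
    obtain f where f: "f \<in> solutions I" using feas by (auto simp: feasible_def)
    obtain i where i: "i \<in> {1..num I}" "f i = x" using solution_surj[OF f x] by blast
    show ?thesis
    proof (cases "i \<in> U")
      case True
      then have "x = o0 i \<or> x = o1 i" using solution_req[OF f i(1)] ends i(2) by blast
      then show ?thesis
      proof
        assume "x = o0 i"
        then show ?thesis using inv0'(4)[OF True] U i(1) by (metis subsetD)
      next
        assume "x = o1 i"
        then show ?thesis using inv0'(3)[OF True] U i(1) by (metis subsetD)
      qed
    next
      case False
      then have "o1 i = x" "o0 i = x" using inv0'(1)[OF i(1)] f i(2) by auto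
      then show ?thesis using i(1) by blast
    qed
  qed
  show "(\<forall>i\<in>{1..num I}. cy i = c \<longrightarrow> f i = o0 i) \<or> (\<forall>i\<in>{1..num I}. cy i = c \<longrightarrow> f i = o1 i)"
    if f: "f \<in> solutions I" for f c
    using inv0'(5)[OF f, of c] inv0'(1) f by metis
  show "o0 i = o1 i" if "i \<in> {1..num I}" "q \<le> cy i" for i
    using inv0'(1)[OF that(1)] inv0'(6)[of i] that by (cases "i \<in> U") auto
  show "\<exists>i\<in>{1..num I}. cy i = c \<and> o0 i \<noteq> o1 i" if "c < q" for c
    using inv0'(7)[OF that] U by blast
qed

lemma peeled_cycles_inv:
  assumes "peel_inv o0 o1 deg su" "U = open_positions I o0" "\<forall>i. cy i = 0" "1 \<le> num I"
  shows "cycles_inv 0 o0 o1 cy"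
proof -
  have "visited o0 = {}"
    unfolding visited_def using assms(2) by (auto simp: open_positions_def)
  moreover have "o0 i \<noteq> 0" if "i \<in> {1..num I} - U" for i
    using that assms(2) by (auto simp: open_positions_def)
  ultimately show ?thesis
    using assms(1,3,4) unfolding cycles_inv_def peel_inv_def by simp
qed

end


text \<open>With a uniform bound \<open>A\<close> on the body, the potential is the measure times
  the full price of an iteration. The \<open>+ 1\<close> pays for the test that fails at the
  end.\<close>

lemma ht_while_measure:
  assumes "P s"
    and "\<And>s. P s \<Longrightarrow> bval b s \<Longrightarrow> ht s c (\<lambda>t s'. P s' \<and> t \<le> A \<and> \<mu> s' < (\<mu> s :: nat))"
    and "\<And>t s'. P s' \<Longrightarrow> \<not> bval b s' \<Longrightarrow> t \<le> (A + tcost b + 2) * (\<mu> s + 1) \<Longrightarrow> Q t s'"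
  shows "ht s (While b c) Q"
proof (rule ht_while_conseq[of P s b c "\<lambda>s. (A + tcost b + 2) * \<mu> s"])
  fix s assume "P s" "bval b s"
  have "tcost b + 2 + t + (A + tcost b + 2) * m' \<le> (A + tcost b + 2) * m"
    if "t \<le> A" "m' < m" for t m m'
  proof -
    have "(A + tcost b + 2) * Suc m' \<le> (A + tcost b + 2) * m"
      using that(2) by (intro mult_le_mono2) simp
    then show ?thesis using that(1) by simp
  qed
  then show "ht s c (\<lambda>t s'. P s' \<and> tcost b + 2 + t + (A + tcost b + 2) * \<mu> s' \<le> (A + tcost b + 2) * \<mu> s)"
    using assms(2)[OF \<open>P s\<close> \<open>bval b s\<close>] by (elim ht_conseq) blast
qed (use assms(1,3) in auto)


section \<open>Arrays\<close>

datatype arr = Deg | Sum | Opt0 | Opt1 | Cyc | Row | Pow | Bit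

datatype warr = Quad | Total | Delta

text \<open>The arrays are interleaved behind the input, whose length \<open>n\<close> is held in variable \<open>0\<close>.\<close>

definition adr :: "nat \<Rightarrow> arr \<Rightarrow> nat \<Rightarrow> nat" where
  "adr n k x = 2 * n + 1 + 8 * x +
     (case k of Deg \<Rightarrow> 0 | Sum \<Rightarrow> 1 | Opt0 \<Rightarrow> 2 | Opt1 \<Rightarrow> 3 | Cyc \<Rightarrow> 4 | Row \<Rightarrow> 5 | Pow \<Rightarrow> 6 | Bit \<Rightarrow> 7)"

definition wadr :: "nat \<Rightarrow> warr \<Rightarrow> nat \<Rightarrow> nat" where
  "wadr n k x = 4 * n + 4 * x + (case k of Quad \<Rightarrow> 0 | Total \<Rightarrow> 1 | Delta \<Rightarrow> 2)"

text \<open>The stride 8 is a power of two, so three doublings replace a multiplication.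
  \<open>adr 0 k 0\<close> is 1 plus the offset of \<open>k\<close>. Interleaving leaves every array
  unbounded, so no length has to be known in advance.\<close>

definition Adr :: "arr \<Rightarrow> aexp \<Rightarrow> aexp" where
  "Adr k e = Plus (Plus (V 0) (V 0)) (Plus (N (adr 0 k 0))
     (let e2 = Plus e e; e4 = Plus e2 e2 in Plus e4 e4))"

definition WAdr :: "warr \<Rightarrow> aexp \<Rightarrow> aexp" where
  "WAdr k e = Plus (let m = Plus (V 0) (V 0) in Plus m m) (Plus (N (wadr 0 k 0))
     (let e2 = Plus e e in Plus e2 e2))"

definition Arr :: "arr \<Rightarrow> aexp \<Rightarrow> aexp" where
  "Arr k e = Ld (Adr k e)"

definition WArr :: "warr \<Rightarrow> aexp \<Rightarrow> wexp" where
  "WArr k e = WLd (WAdr k e)"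

definition ar :: "nat \<Rightarrow> (nat \<Rightarrow> nat) \<Rightarrow> arr \<Rightarrow> nat \<Rightarrow> nat" where
  "ar n m k x = m (adr n k x)"

definition war :: "nat \<Rightarrow> (nat \<Rightarrow> real) \<Rightarrow> warr \<Rightarrow> nat \<Rightarrow> real" where
  "war n m k x = m (wadr n k x)"

lemma adr_eq [simp]: "adr n k x = adr n l y \<longleftrightarrow> k = l \<and> x = y"
proof
  let ?no = "\<lambda>k. case k of Deg \<Rightarrow> 0 | Sum \<Rightarrow> 1 | Opt0 \<Rightarrow> 2 | Opt1 \<Rightarrow> 3 | Cyc \<Rightarrow> 4 | Row \<Rightarrow> 5 | Pow \<Rightarrow> 6 | Bit \<Rightarrow> (7::nat)"
  have lt: "?no k < 8" for k by (cases k) auto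
  assume "adr n k x = adr n l y"
  then have eq: "8 * x + ?no k = 8 * y + ?no l" by (simp add: adr_def)
  then have "(8 * x + ?no k) mod 8 = (8 * y + ?no l) mod 8" by simp
  then have "?no k = ?no l" using lt by simp
  then show "k = l \<and> x = y" using eq by (cases k; cases l) auto
qed simp

lemma wadr_eq [simp]: "wadr n k x = wadr n l y \<longleftrightarrow> k = l \<and> x = y"
proof
  let ?no = "\<lambda>k. case k of Quad \<Rightarrow> 0 | Total \<Rightarrow> 1 | Delta \<Rightarrow> (2::nat)"
  have lt: "?no k < 4" for k by (cases k) auto
  assume "wadr n k x = wadr n l y"
  then have eq: "4 * x + ?no k = 4 * y + ?no l" by (simp add: wadr_def)
  then have "(4 * x + ?no k) mod 4 = (4 * y + ?no l) mod 4" by simp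
  then have "?no k = ?no l" using lt by simp
  then show "k = l \<and> x = y" using eq by (cases k; cases l) auto
qed simp

lemma aval_Adr [simp]: "aval (Adr k e) s = adr (var s 0) k (aval e s)"
  by (simp add: Adr_def adr_def Let_def)

lemma aval_WAdr [simp]: "aval (WAdr k e) s = wadr (var s 0) k (aval e s)"
  by (simp add: WAdr_def wadr_def Let_def)

lemma aval_Arr [simp]: "aval (Arr k e) s = ar (var s 0) (imem s) k (aval e s)"
  by (simp add: Arr_def ar_def)

lemma wval_WArr [simp]: "wval (WArr k e) s = war (var s 0) (rmem s) k (aval e s)"
  by (simp add: WArr_def war_def)

lemma exp_ok_arr [simp]:
  "aexp_ok (Adr k e) \<longleftrightarrow> aexp_ok e" "aexp_ok (WAdr l e) \<longleftrightarrow> aexp_ok e"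
  "aexp_ok (Arr k e) \<longleftrightarrow> aexp_ok e" "wexp_ok (WArr l e) \<longleftrightarrow> aexp_ok e"
  by (auto simp: Adr_def WAdr_def Arr_def WArr_def Let_def)

lemma adr_gt: "2 * n < adr n k x"
  by (simp add: adr_def)

lemma wadr_ge: "4 * n \<le> wadr n k x"
  by (simp add: wadr_def)

lemma ar_upd [simp]:
  "ar n (m(adr n k i := v)) l = (if k = l then (ar n m l)(i := v) else ar n m l)"
  by (auto simp: ar_def)

lemma ar_upd_low [simp]: "a \<le> 2 * n \<Longrightarrow> ar n (m(a := v)) l = ar n m l"
  using adr_gt[of n l] by (auto simp: ar_def fun_eq_iff dest: leD)

lemma adr_low [simp]:
  "a \<le> 2 * n \<Longrightarrow> a \<noteq> adr n k x" "a \<le> 2 * n \<Longrightarrow> adr n k x \<noteq> a" "\<not> adr n k x \<le> 2 * n"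
  using adr_gt[of n k x] by auto

lemma war_upd [simp]:
  "war n (m(wadr n k i := v)) l = (if k = l then (war n m l)(i := v) else war n m l)"
  by (auto simp: war_def)

lemma wadr_low [simp]:
  "a < 4 * n \<Longrightarrow> a \<noteq> wadr n k x" "a < 4 * n \<Longrightarrow> wadr n k x \<noteq> a" "\<not> wadr n k x < 4 * n"
  using wadr_ge[of n k x] by auto

definition Lo :: "aexp \<Rightarrow> aexp" where
  "Lo e = Ld (Minus (Plus e e) (N 1))"

definition Hi :: "aexp \<Rightarrow> aexp" where
  "Hi e = Ld (Plus e e)"

definition Sgn :: "aexp \<Rightarrow> aexp" where
  "Sgn e = Minus (N 1) (Minus (N 1) e)"

lemma aval_Lo [simp]: "aval (Lo e) s = imem s (2 * aval e s - 1)"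
  by (simp add: Lo_def mult_2)

lemma aval_Hi [simp]: "aval (Hi e) s = imem s (2 * aval e s)"
  by (simp add: Hi_def mult_2)

lemma aval_Sgn [simp]: "aval (Sgn e) s = (if aval e s = 0 then 0 else 1)"
  by (simp add: Sgn_def)

lemma exp_ok_Lo [simp]:
  "aexp_ok (Lo e) \<longleftrightarrow> aexp_ok e" "aexp_ok (Hi e) \<longleftrightarrow> aexp_ok e" "aexp_ok (Sgn e) \<longleftrightarrow> aexp_ok e"
  by (auto simp: Lo_def Hi_def Sgn_def)

lemma input_ends:
  assumes "1 \<le> i" "i \<le> num I"
  shows "input_mem I (2 * i - 1) = lo I i" "input_mem I (2 * i) = hi I i"
proof -
  have "(2 * i - 1 + 1) div 2 = i" "(2 * i - 1 + 1) mod 2 = 0" "2 * i - 1 \<noteq> 0" "2 * i - 1 \<le> 2 * num I"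
    using assms by auto
  then show "input_mem I (2 * i - 1) = lo I i" by (simp only: input_mem_def req_elem_def lo_def if_True if_False refl)
  have "(2 * i + 1) div 2 = i" "(2 * i + 1) mod 2 = 1" "2 * i \<noteq> 0" "2 * i \<le> 2 * num I"
    using assms by auto
  then show "input_mem I (2 * i) = hi I i" by (simp add: input_mem_def req_elem_def hi_def)
qed


section \<open>The algorithm\<close>

abbreviation (input) "vi \<equiv> 2 :: nat"
abbreviation (input) "vx \<equiv> 3 :: nat"
abbreviation (input) "vy \<equiv> 4 :: nat"
abbreviation (input) "vp \<equiv> 5 :: nat"
abbreviation (input) "vq \<equiv> 6 :: nat"
abbreviation (input) "vr \<equiv> 7 :: nat"

text \<open>\<open>Row\<close> receives the multiples of \<open>n\<close>, one addition per pass,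
  because matrix addresses \<open>c * n + d\<close> cannot be computed by a multiplication.\<close>

definition "count_body = [
  Assign vx (Lo (V vi)),
  Put (Adr Deg (V vx)) (Plus (Arr Deg (V vx)) (N 1)),
  Put (Adr Sum (V vx)) (Plus (Arr Sum (V vx)) (V vi)),
  Assign vx (Hi (V vi)),
  Put (Adr Deg (V vx)) (Plus (Arr Deg (V vx)) (N 1)),
  Put (Adr Sum (V vx)) (Plus (Arr Sum (V vx)) (V vi)),
  Put (Adr Row (Minus (V vi) (N 1))) (V vr),
  Assign vr (Plus (V vr) (V 0)),
  Assign vi (Plus (V vi) (N 1))]"

abbreviation (input) "pos_test \<equiv> Le (V vi) (V 0)"
abbreviation (input) "walk_test \<equiv> Le (Arr Opt0 (V vp)) (N 0)"
abbreviation (input) "open_test \<equiv> Le (Arr Opt0 (V vi)) (N 0)"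
abbreviation (input) "step_pos \<equiv> [Assign vi (Plus (V vi) (N 1))]"
abbreviation (input) "walk_init \<equiv> [Assign vx (Lo (V vi)), Assign vp (V vi)]"
abbreviation (input) "count_cycle \<equiv> [Assign vq (Plus (V vq) (Sgn (Minus (Hi (V vi)) (Lo (V vi)))))]"
abbreviation (input) "count_init \<equiv> [Assign 0 (Ld (N 0)), Assign vi (N 1)]"

definition "count_prog =
  Block count_init ;;
  While pos_test (Block count_body)"

text \<open>Removing a position can create a new vertex of degree 1 only at its other end
  \<open>y\<close>, so continuing there replaces a work list.\<close>

definition "peel_body = [
  Assign vp (Arr Sum (V vx)),
  Assign vy (Minus (Plus (Lo (V vp)) (Hi (V vp))) (V vx)),
  Put (Adr Opt0 (V vp)) (V vx),
  Put (Adr Opt1 (V vp)) (V vx),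
  Put (Adr Deg (V vx)) (Minus (Arr Deg (V vx)) (N 1)),
  Put (Adr Sum (V vx)) (Minus (Arr Sum (V vx)) (V vp)),
  Put (Adr Deg (V vy)) (Minus (Arr Deg (V vy)) (N 1)),
  Put (Adr Sum (V vy)) (Minus (Arr Sum (V vy)) (V vp)),
  Assign vx (V vy)]"

text \<open>Subtraction is truncated, so this tests whether the degree of \<open>vx\<close> is \<open>1\<close>.\<close>

definition "peel_test = Le (Plus (Minus (Arr Deg (V vx)) (N 1)) (Minus (N 1) (Arr Deg (V vx)))) (N 0)"

definition "peel_prog =
  Block [Assign vi (N 1)] ;;
  While pos_test (
    Block [Assign vx (V vi)] ;;
    While peel_test (Block peel_body) ;;
    Block step_pos)"

text \<open>A position entered through \<open>x\<close> is left through its other vertex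
  \<open>y\<close>. So \<open>Opt0\<close> collects the entries and \<open>Opt1\<close> the exits of
  the walk, and the two perfect matchings of a cycle are all entries and all exits.\<close>

definition "walk_body = [
  Put (Adr Opt0 (V vp)) (V vx),
  Assign vy (Minus (Plus (Lo (V vp)) (Hi (V vp))) (V vx)),
  Put (Adr Opt1 (V vp)) (V vy),
  Put (Adr Cyc (V vp)) (V vq),
  Assign vp (Minus (Arr Sum (V vy)) (V vp)),
  Assign vx (V vy)]"

abbreviation (input) "cycles_step \<equiv>
  If open_test (Block walk_init ;; While walk_test (Block walk_body) ;; Block count_cycle) (Block []) ;;
  Block step_pos"

definition "cycles_prog =
  Block [Assign vi (N 1), Assign vq (N 0)] ;;
  While pos_test cycles_step"

text \<open>Later phases accumulate into cells that are never cleared: \<open>Bit\<close>, the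
  coefficients and weight variable 0. So the first phases have to record that these keep their
  initial contents.\<close>

definition frame :: "tspvr \<Rightarrow> store \<Rightarrow> bool" where
  "frame I s \<longleftrightarrow> var s 0 = num I \<and> (\<forall>a \<le> 2 * num I. imem s a = input_mem I a) \<and>
     (\<forall>x. ar (num I) (imem s) Bit x = 0) \<and> rmem s = input_wmem I \<and> wvar s = (\<lambda>_. 0)"

definition rows :: "tspvr \<Rightarrow> store \<Rightarrow> nat \<Rightarrow> bool" where
  "rows I s k \<longleftrightarrow> (\<forall>c<k. ar (num I) (imem s) Row c = c * num I)"

lemma frame_ends:
  assumes "frame I s" "i \<in> {1..num I}"
  shows "imem s (2 * i - 1) = lo I i" "imem s (2 * i) = hi I i"
  using assms input_ends[of i I] unfolding frame_def by auto

abbreviation array :: "tspvr \<Rightarrow> store \<Rightarrow> arr \<Rightarrow> nat \<Rightarrow> nat" where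
  "array I s k \<equiv> ar (num I) (imem s) k"

lemma count_body_sem:
  assumes "frame I s" "var s vi = i" "i \<in> {1..num I}"
  defines "s' \<equiv> fold atom_sem count_body s"
  shows "frame I s' \<and> var s' vi = i + 1 \<and> var s' vr = var s vr + num I \<and>
    array I s' Deg = (\<lambda>x. array I s Deg x + mult I i x) \<and>
    array I s' Sum = (\<lambda>x. array I s Sum x + i * mult I i x) \<and>
    array I s' Row = (array I s Row)(i - 1 := var s vr) \<and>
    array I s' Opt0 = array I s Opt0 \<and> array I s' Opt1 = array I s Opt1 \<and> array I s' Cyc = array I s Cyc"
proof -
  have f: "var s 0 = num I" "\<And>a. a \<le> 2 * num I \<Longrightarrow> imem s a = input_mem I a"
    "\<And>x. ar (num I) (imem s) Bit x = 0" "rmem s = input_wmem I" "wvar s = (\<lambda>_. 0)"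
    using assms(1) by (auto simp: frame_def)
  have e: "input_mem I (2 * i - Suc 0) = lo I i" "input_mem I (2 * i) = hi I i"
    using input_ends[of i I] assms(3) by auto
  have b: "2 * i - Suc 0 \<le> 2 * num I" "i \<le> num I" using assms(3) by auto
  show ?thesis
    unfolding s'_def count_body_def frame_def
    using assms(2) by (auto simp: f e b fun_eq_iff mult_def)
qed

lemma peel_body_sem:
  assumes "frame I s" "var s vx = u" "i = array I s Sum u" "i \<in> {1..num I}"
    "y = lo I i + hi I i - u" "u \<noteq> y"
  defines "s' \<equiv> fold atom_sem peel_body s"
  shows "frame I s' \<and> var s' vi = var s vi \<and> var s' vx = y \<and>
    array I s' Deg = (array I s Deg)(u := array I s Deg u - 1, y := array I s Deg y - 1) \<and>
    array I s' Sum = (array I s Sum)(u := array I s Sum u - i, y := array I s Sum y - i) \<and>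
    array I s' Opt0 = (array I s Opt0)(i := u) \<and> array I s' Opt1 = (array I s Opt1)(i := u) \<and>
    array I s' Row = array I s Row \<and> array I s' Cyc = array I s Cyc"
proof -
  have f: "var s 0 = num I" "\<And>a. a \<le> 2 * num I \<Longrightarrow> imem s a = input_mem I a"
    "\<And>x. ar (num I) (imem s) Bit x = 0" "rmem s = input_wmem I" "wvar s = (\<lambda>_. 0)"
    using assms(1) by (auto simp: frame_def)
  have e: "input_mem I (2 * i - Suc 0) = lo I i" "input_mem I (2 * i) = hi I i"
    using input_ends[of i I] assms(4) by auto
  have b: "2 * i - Suc 0 \<le> 2 * num I" "i \<le> num I" using assms(4) by auto
  show ?thesis
    unfolding s'_def peel_body_def frame_def
    using assms(6) by (simp add: f e b assms(2) assms(3)[symmetric] assms(5)[symmetric])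
qed

lemma walk_body_sem:
  assumes "frame I s" "var s vx = x" "var s vp = p" "p \<in> {1..num I}" "y = lo I p + hi I p - x"
  defines "s' \<equiv> fold atom_sem walk_body s"
  shows "frame I s' \<and> var s' vi = var s vi \<and> var s' vq = var s vq \<and> var s' vx = y \<and>
    var s' vp = array I s Sum y - p \<and>
    array I s' Opt0 = (array I s Opt0)(p := x) \<and> array I s' Opt1 = (array I s Opt1)(p := y) \<and>
    array I s' Cyc = (array I s Cyc)(p := var s vq) \<and>
    array I s' Row = array I s Row \<and> array I s' Sum = array I s Sum"
proof -
  have f: "var s 0 = num I" "\<And>a. a \<le> 2 * num I \<Longrightarrow> imem s a = input_mem I a"
    "\<And>x. ar (num I) (imem s) Bit x = 0" "rmem s = input_wmem I" "wvar s = (\<lambda>_. 0)"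
    using assms(1) by (auto simp: frame_def)
  have e: "input_mem I (2 * p - Suc 0) = lo I p" "input_mem I (2 * p) = hi I p"
    using input_ends[of p I] assms(4) by auto
  have b: "2 * p - Suc 0 \<le> 2 * num I" "p \<le> num I" using assms(4) by auto
  show ?thesis
    unfolding s'_def walk_body_def frame_def
    by (simp add: f e b assms(2,3) assms(5)[symmetric])
qed


section \<open>Running times of counting and peeling\<close>

definition start :: "tspvr \<Rightarrow> store" where
  "start I = \<lparr>var = (\<lambda>_. 0), imem = input_mem I, wvar = (\<lambda>_. 0), rmem = input_wmem I\<rparr>"

definition "count_cost = bcost count_init +
  (bcost count_body + tcost pos_test + 2)"

definition "peel_cost = tcost peel_test + 2 + bcost peel_body"

definition "peel_outer_cost = tcost pos_test + 2 + bcost [Assign vx (V vi)] +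
  (tcost peel_test + 2) + bcost step_pos"

lemma potential_step: "i \<le> n \<Longrightarrow> (A::nat) * (n + 1 - i) = A + A * (n - i)"
  by (simp add: Suc_diff_le)

text \<open>Two counters bounded by \<open>n\<close> pay for a nested loop: \<open>x\<close> for all
  inner iterations together, \<open>y\<close> for the outer ones; \<open>r\<close> is the potential
  left over.\<close>

lemma amortised_total:
  assumes "t + r \<le> a * x + b * y + d" "x \<le> n" "y \<le> (n::nat)"
  shows "c + t \<le> (c + d + a + b) * (n + 1)"
proof -
  have "a * x \<le> a * n" "b * y \<le> b * n" using assms(2,3) by simp_all
  then have "c + t \<le> c + d + a * n + b * n" using assms(1) by linarith
  also have "\<dots> \<le> (c + d + a + b) * (n + 1)" by (simp add: algebra_simps)
  finally show ?thesis .
qed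

abbreviation (in feasible_instance) (input) count_inv :: "store \<Rightarrow> bool" where
  "count_inv s \<equiv> frame I s \<and> 1 \<le> var s vi \<and> var s vi \<le> num I + 1 \<and> var s vr = (var s vi - 1) * num I \<and>
      rows I s (var s vi - 1) \<and>
      array I s Deg = degree I {1..<var s vi} \<and> array I s Sum = pos_sum I {1..<var s vi} \<and>
      array I s Opt0 = (\<lambda>_. 0) \<and> array I s Opt1 = (\<lambda>_. 0) \<and> array I s Cyc = (\<lambda>_. 0)"

lemma (in feasible_instance) count_ht:
  "ht (start I) count_prog (\<lambda>t s. frame I s \<and> rows I s (num I) \<and>
     array I s Deg = degree I {1..num I} \<and> array I s Sum = pos_sum I {1..num I} \<and>
     array I s Opt0 = (\<lambda>_. 0) \<and> array I s Opt1 = (\<lambda>_. 0) \<and> array I s Cyc = (\<lambda>_. 0) \<and>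
     t \<le> count_cost * (num I + 1))"
  unfolding count_prog_def
proof (rule ht_seq, rule ht_block, rule ht_while_measure[where
    P = "\<lambda>s. count_inv s"
    and A = "bcost count_body" and \<mu> = "\<lambda>s. num I + 1 - var s vi"])
  have zero: "ar (num I) (input_mem I) k = (\<lambda>_. 0)" for k
    using adr_gt[of "num I" k] by (auto simp: ar_def input_mem_def fun_eq_iff)
  let ?s = "fold atom_sem count_init (start I)"
  have s: "var ?s vi = 1" "var ?s vr = 0" "imem ?s = input_mem I" by (simp_all add: start_def)
  have "frame I ?s" by (simp add: start_def frame_def zero) (simp add: input_mem_def)
  then show "count_inv ?s"
    unfolding s by (simp add: rows_def zero degree_def pos_sum_def fun_eq_iff)
next
  fix s
  assume inv: "count_inv s"
    and test: "bval pos_test s"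
  define i where "i = var s vi"
  define s' where "s' = fold atom_sem count_body s"
  have i: "i \<in> {1..num I}" using inv test by (auto simp: i_def frame_def)
  have split: "{1..<i + 1} = insert i {1..<i}" using i by auto
  have deg: "degree I {1..<i + 1} = (\<lambda>x. degree I {1..<i} x + mult I i x)"
    "pos_sum I {1..<i + 1} = (\<lambda>x. pos_sum I {1..<i} x + i * mult I i x)"
    unfolding split degree_def pos_sum_def by (auto simp: fun_eq_iff)
  have "frame I s" using inv by simp
  note count_body_sem[OF this i_def[symmetric] i, folded s'_def]
  moreover have "var s vr + num I = i * num I" using inv i by (cases i) (auto simp: i_def)
  moreover have "rows I s' i"
    using calculation inv i unfolding rows_def by (auto simp: i_def)
  ultimately show "ht s (Block count_body) (\<lambda>t s'. (count_inv s') \<and>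
      t \<le> bcost count_body \<and> num I + 1 - var s' vi < num I + 1 - var s vi)"
    using inv i deg by (intro ht_block) (auto simp: s'_def[symmetric] i_def)
next
  fix t s'
  let ?s = "fold atom_sem count_init (start I)"
  let ?A = "bcost count_body + tcost pos_test + 2"
  assume inv: "count_inv s'"
    and test: "\<not> bval pos_test s'" and t: "t \<le> ?A * (num I + 1 - var ?s vi + 1)"
  have "var s' vi = num I + 1" using inv test by (auto simp: frame_def)
  moreover have "{1..<num I + 1} = {1..num I}" by auto
  moreover have "t \<le> ?A * (num I + 1)"
    using t by (rule order_trans) (simp add: start_def)
  then have "bcost count_init + t \<le> count_cost * (num I + 1)"
    by (simp add: count_cost_def algebra_simps)
  ultimately show "frame I s' \<and> rows I s' (num I) \<and>
     array I s' Deg = degree I {1..num I} \<and> array I s' Sum = pos_sum I {1..num I} \<and>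
     array I s' Opt0 = (\<lambda>_. 0) \<and> array I s' Opt1 = (\<lambda>_. 0) \<and> array I s' Cyc = (\<lambda>_. 0) \<and>
     bcost count_init + t \<le> count_cost * (num I + 1)"
    using inv by simp
qed

lemma (in feasible_instance) peel_init:
  "peel_inv (\<lambda>_. 0) (\<lambda>_. 0) (degree I {1..num I}) (pos_sum I {1..num I})"
  by (auto simp: peel_inv_def open_positions_def atLeastAtMost_def atLeast_def atMost_def Collect_conj_eq)

definition (in feasible_instance) peeling :: "store \<Rightarrow> bool" where
  "peeling s \<longleftrightarrow> frame I s \<and> rows I s (num I) \<and> array I s Cyc = (\<lambda>_. 0) \<and>
     peel_inv (array I s Opt0) (array I s Opt1) (array I s Deg) (array I s Sum)"

abbreviation open_count :: "tspvr \<Rightarrow> store \<Rightarrow> nat" where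
  "open_count I s \<equiv> card (open_positions I (array I s Opt0))"

abbreviation (in feasible_instance) (input) peel_outer_inv :: "store \<Rightarrow> bool" where
  "peel_outer_inv s \<equiv> peeling s \<and> 1 \<le> var s vi \<and> var s vi \<le> num I + 1 \<and>
      (\<forall>x\<in>{1..<var s vi}. array I s Deg x \<noteq> 1)"

abbreviation (in feasible_instance) (input) peel_inner_inv :: "nat \<Rightarrow> store \<Rightarrow> bool" where
  "peel_inner_inv i s \<equiv> peeling s \<and> var s vx \<in> {1..num I} \<and> var s vi = i \<and>
    (\<forall>x\<in>{1..i} - {var s vx}. array I s Deg x \<noteq> 1)"

text \<open>A chain may lead back to vertices below \<open>i\<close>, so the invariant exempts just
  the vertex at which the chain stands. Every iteration decides an open position; as this potential
  is shared by all chains, they cost O(n) altogether.\<close>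

lemma (in feasible_instance) peel_inner_ht:
  assumes "peeling s" "var s vx \<in> {1..num I}" "var s vi = i"
    "\<forall>x\<in>{1..<i} - {var s vx}. array I s Deg x \<noteq> 1" "i = var s vx"
  shows "ht s (While peel_test (Block peel_body)) (\<lambda>t s'. peeling s' \<and> var s' vi = i \<and>
    (\<forall>x\<in>{1..i}. array I s' Deg x \<noteq> 1) \<and>
    t + peel_cost * open_count I s' \<le> peel_cost * open_count I s + (tcost peel_test + 2))"
proof (rule ht_while_conseq[where P = "\<lambda>s. peel_inner_inv i s" and \<Phi> = "\<lambda>s. peel_cost * open_count I s"])
  have test: "bval peel_test s \<longleftrightarrow> array I s Deg (var s vx) = 1" if "peeling s" for s
    using that by (auto simp: peel_test_def peeling_def frame_def)
  show "peel_inner_inv i s"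
    using assms by auto
  {
    fix s assume inv: "peel_inner_inv i s" and b: "bval peel_test s"
    define u where "u = var s vx"
    define k where "k = array I s Sum u"
    define y where "y = lo I k + hi I k - u"
    define s' where "s' = fold atom_sem peel_body s"
    have p: "frame I s" "rows I s (num I)" "array I s Cyc = (\<lambda>_. 0)"
      "peel_inv (array I s Opt0) (array I s Opt1) (array I s Deg) (array I s Sum)"
      and u: "u \<in> {1..num I}" and d: "array I s Deg u = 1"
      using inv test b by (auto simp: peeling_def u_def)
    note st = peel_step[OF p(4) u d k_def y_def]
    note sem = peel_body_sem[OF p(1) u_def[symmetric] k_def st(1) y_def st(4)[symmetric], folded s'_def]
    have "k \<in> open_positions I (array I s Opt0)"
      using st(1,2) by (simp add: open_positions_def)
    moreover have "open_positions I (array I s' Opt0) = open_positions I (array I s Opt0) - {k}"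
      using sem st(6) by simp
    moreover have "finite (open_positions I (array I s Opt0))" by (simp add: open_positions_def)
    ultimately have "Suc (open_count I s') = open_count I s" by (simp only: card_Suc_Diff1)
    then have pot: "peel_cost * open_count I s = peel_cost * open_count I s' + peel_cost"
      by (metis mult_Suc_right add.commute)
    have "peeling s'" unfolding peeling_def using sem p st(5) by (simp add: rows_def)
    moreover have "\<forall>x\<in>{1..i} - {var s' vx}. array I s' Deg x \<noteq> 1"
      using inv sem d by (auto simp: u_def)
    ultimately show "ht s (Block peel_body) (\<lambda>t s'. (peel_inner_inv i s') \<and>
        tcost peel_test + 2 + t + peel_cost * open_count I s' \<le> peel_cost * open_count I s)"
      using sem st(3) inv pot by (intro ht_block) (auto simp: s'_def[symmetric] peel_cost_def)
  next
    fix t s' assume "peel_inner_inv i s'" "\<not> bval peel_test s'"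
      "t + peel_cost * open_count I s' \<le> peel_cost * open_count I s + (tcost peel_test + 2)"
    then show "peeling s' \<and> var s' vi = i \<and> (\<forall>x\<in>{1..i}. array I s' Deg x \<noteq> 1) \<and>
      t + peel_cost * open_count I s' \<le> peel_cost * open_count I s + (tcost peel_test + 2)"
      using test[of s'] by auto
  }
qed

definition "peel_total_cost = bcost [Assign vi (N 1)] + (tcost pos_test + 2) +
  peel_cost + peel_outer_cost"

lemma (in feasible_instance) peel_ht:
  assumes "frame I s" "rows I s (num I)"
     "array I s Deg = degree I {1..num I}" "array I s Sum = pos_sum I {1..num I}"
     "array I s Opt0 = (\<lambda>_. 0)" "array I s Opt1 = (\<lambda>_. 0)" "array I s Cyc = (\<lambda>_. 0)"
  shows "ht s peel_prog (\<lambda>t s'. peeling s' \<and> (\<forall>x\<in>{1..num I}. array I s' Deg x \<noteq> 1) \<and>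
    t \<le> peel_total_cost * (num I + 1))"
  unfolding peel_prog_def
proof (rule ht_seq, rule ht_block, rule ht_while_conseq[where
    P = "\<lambda>s. peel_outer_inv s"
    and \<Phi> = "\<lambda>s. peel_cost * open_count I s + peel_outer_cost * (num I + 1 - var s vi)"])
  let ?s = "fold atom_sem [Assign vi (N 1)] s"
  have "frame I ?s" using assms(1) by (simp add: frame_def)
  then show "peel_outer_inv ?s"
    using assms peel_init by (simp add: peeling_def rows_def)
  {
    fix s assume inv: "peel_outer_inv s" and b: "bval pos_test s"
    define i where "i = var s vi"
    define s1 where "s1 = fold atom_sem [Assign vx (V vi)] s"
    have i: "i \<in> {1..num I}" using inv b by (auto simp: i_def peeling_def frame_def)
    have s1: "peeling s1" "var s1 vx = i" "var s1 vi = i" "imem s1 = imem s"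
      using inv by (auto simp: s1_def i_def peeling_def frame_def rows_def)
    have pot: "peel_outer_cost * (num I + 1 - i) = peel_outer_cost + peel_outer_cost * (num I - i)"
      using i by (intro potential_step) auto
    show "ht s (Block [Assign vx (V vi)] ;; While peel_test (Block peel_body) ;;
        Block step_pos)
      (\<lambda>t s'. (peel_outer_inv s') \<and>
        tcost pos_test + 2 + t + (peel_cost * open_count I s' + peel_outer_cost * (num I + 1 - var s' vi))
        \<le> peel_cost * open_count I s + peel_outer_cost * (num I + 1 - var s vi))"
    proof (rule ht_seq, rule ht_block, fold s1_def, rule ht_seq, rule ht_conseq[OF peel_inner_ht[of s1 i]])
      show "peeling s1" "var s1 vx \<in> {1..num I}" "var s1 vi = i" "i = var s1 vx" using s1 i by auto
      show "\<forall>x\<in>{1..<i} - {var s1 vx}. array I s1 Deg x \<noteq> 1" using inv s1 by (auto simp: i_def)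
      fix t s2
      assume s2: "peeling s2 \<and> var s2 vi = i \<and> (\<forall>x\<in>{1..i}. array I s2 Deg x \<noteq> 1) \<and>
        t + peel_cost * open_count I s2 \<le> peel_cost * open_count I s1 + (tcost peel_test + 2)"
      define s' where "s' = fold atom_sem step_pos s2"
      have s': "peeling s'" "var s' vi = i + 1" "imem s' = imem s2"
        using s2 by (auto simp: s'_def peeling_def frame_def rows_def)
      have "tcost pos_test + 2 + (bcost [Assign vx (V vi)] +
          (t + bcost step_pos)) +
          (peel_cost * open_count I s2 + peel_outer_cost * (num I - i))
        \<le> peel_cost * open_count I s + peel_outer_cost * (num I + 1 - i)"
        using s2 pot peel_outer_cost_def unfolding s1(4) by linarith
      then show "ht s2 (Block step_pos)
        (\<lambda>t' s'. (peel_outer_inv s') \<and>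
          tcost pos_test + 2 + (bcost [Assign vx (V vi)] + (t + t')) +
          (peel_cost * open_count I s' + peel_outer_cost * (num I + 1 - var s' vi))
          \<le> peel_cost * open_count I s + peel_outer_cost * (num I + 1 - var s vi))"
        using s' s2 i by (intro ht_block, fold s'_def i_def) auto
    qed
  next
    fix t s' assume inv: "peel_outer_inv s'" and b: "\<not> bval pos_test s'"
      and t: "t + (peel_cost * open_count I s' + peel_outer_cost * (num I + 1 - var s' vi))
        \<le> peel_cost * open_count I ?s + peel_outer_cost * (num I + 1 - var ?s vi) +
          (tcost pos_test + 2)"
    have "var s' vi = num I + 1" using inv b by (auto simp: peeling_def frame_def)
    have "open_count I ?s \<le> card {1..num I}"
      by (rule card_mono) (auto simp: open_positions_def)
    then have "open_count I ?s \<le> num I" by simp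
    moreover have "num I + 1 - var ?s vi \<le> num I" by simp
    ultimately have "bcost [Assign vi (N 1)] + t \<le> peel_total_cost * (num I + 1)"
      using amortised_total[OF t] by (simp only: peel_total_cost_def add.assoc)
    with \<open>var s' vi = num I + 1\<close> show "peeling s' \<and> (\<forall>x\<in>{1..num I}. array I s' Deg x \<noteq> 1) \<and>
        bcost [Assign vi (N 1)] + t \<le> peel_total_cost * (num I + 1)"
      using inv by auto
  }
qed


section \<open>Running time of the traversal\<close>

definition "walk_cost = tcost walk_test + 2 + bcost walk_body"

definition "cycles_outer_cost = tcost pos_test + 2 + tcost open_test + 2 +
  bcost walk_init + (tcost walk_test + 2) +
  bcost count_cycle + bcost [] +
  bcost step_pos"

definition "cycles_cost = bcost [Assign vi (N 1), Assign vq (N 0)] + (tcost pos_test + 2) +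
  walk_cost + cycles_outer_cost"

context two_regular
begin

definition walking :: "store \<Rightarrow> bool" where
  "walking s \<longleftrightarrow> frame I s \<and> rows I s (num I) \<and>
     (\<forall>x\<in>{1..num I}. array I s Sum x = pos_sum I U x)"

abbreviation unvisited :: "store \<Rightarrow> nat" where
  "unvisited s \<equiv> card (U - visited (array I s Opt0))"

abbreviation cycles_ok :: "store \<Rightarrow> bool" where
  "cycles_ok s \<equiv> cycles_inv (var s vq) (array I s Opt0) (array I s Opt1) (array I s Cyc)"

abbreviation (input) walk_loop_inv :: "store \<Rightarrow> nat \<Rightarrow> nat \<Rightarrow> store \<Rightarrow> bool" where
  "walk_loop_inv s0 q i s \<equiv> walking s \<and> var s vq = q \<and> var s vi = i \<and>
      walk_inv q (array I s0 Opt0) (array I s0 Opt1) (array I s0 Cyc) i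
        (array I s Opt0) (array I s Opt1) (array I s Cyc) (var s vp) (var s vx)"

text \<open>Every iteration visits a new position of \<open>U\<close>, so a long walk is paid from
  the same potential as all the others. The store at entry stays in the invariant as a reference,
  since the positions of this walk are those visited after it.\<close>

lemma walk_ht:
  assumes s: "walking s" "cycles_ok s" "var s vq = q" "var s vi = i" "var s vp = i" "var s vx = lo I i"
    and i: "i \<in> U" "array I s Opt0 i = 0"
  shows "ht s (While walk_test (Block walk_body)) (\<lambda>t s'. walking s' \<and>
    cycles_inv (q + (if lo I i = hi I i then 0 else 1)) (array I s' Opt0) (array I s' Opt1) (array I s' Cyc) \<and>
    visited (array I s Opt0) \<subseteq> visited (array I s' Opt0) \<and> i \<in> visited (array I s' Opt0) \<and>
    var s' vq = q \<and> var s' vi = i \<and>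
    t + walk_cost * unvisited s' \<le> walk_cost * unvisited s + (tcost walk_test + 2))"
proof (rule ht_while_conseq[where P = "\<lambda>s'. walk_loop_inv s q i s'"
      and \<Phi> = "\<lambda>s'. walk_cost * unvisited s'"])
  have inv0: "cycles_inv q (array I s Opt0) (array I s Opt1) (array I s Cyc)" using s by simp
  have test: "bval walk_test s' \<longleftrightarrow> array I s' Opt0 (var s' vp) = 0" if "walking s'" for s'
    using that by (auto simp: walking_def frame_def)
  show "walk_loop_inv s q i s"
    using s i walk_start[OF inv0] by simp
  {
    fix s1 assume inv: "walk_loop_inv s q i s1"
      and b: "bval walk_test s1"
    define p where "p = var s1 vp"
    define x where "x = var s1 vx"
    define y where "y = lo I p + hi I p - x"
    define s' where "s' = fold atom_sem walk_body s1"
    have p0: "array I s1 Opt0 p = 0" using inv b test by (simp add: p_def)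
    have w: "walk_inv q (array I s Opt0) (array I s Opt1) (array I s Cyc) i
        (array I s1 Opt0) (array I s1 Opt1) (array I s1 Cyc) p x"
      using inv by (simp add: p_def x_def)
    note st = walk_step[OF inv0 w p0 y_def]
    have fr: "frame I s1" "rows I s1 (num I)" "\<And>x. x \<in> {1..num I} \<Longrightarrow> array I s1 Sum x = pos_sum I U x"
      using inv by (auto simp: walking_def)
    have "p \<in> {1..num I}" using st(1) U by auto
    note sem = walk_body_sem[OF fr(1) x_def[symmetric] p_def[symmetric] this y_def, folded s'_def]
    have "walking s'" using sem fr by (simp add: walking_def rows_def)
    moreover have "var s' vp = partner y p" using sem fr(3)[OF st(3)] by (simp add: partner_def)
    moreover have "p \<in> U - visited (array I s1 Opt0)" using st(1) p0 by (simp add: visited_def)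
    then have "Suc (card (U - visited (array I s1 Opt0) - {p})) = unvisited s1"
      using finite_U by (intro card_Suc_Diff1) auto
    moreover have "U - visited (array I s1 Opt0) - {p} = U - visited (array I s' Opt0)"
      using sem st(4) by auto
    ultimately have *: "walking s'" "var s' vp = partner y p" "unvisited s1 = Suc (unvisited s')" by simp_all
    have "tcost walk_test + 2 + bcost walk_body + walk_cost * unvisited s'
        \<le> walk_cost * unvisited s1"
      unfolding *(3) mult_Suc_right using walk_cost_def by linarith
    then show "ht s1 (Block walk_body) (\<lambda>t s'. (walk_loop_inv s q i s') \<and>
      tcost walk_test + 2 + t + walk_cost * unvisited s' \<le> walk_cost * unvisited s1)"
      using sem st(5) * inv by (intro ht_block, fold s'_def) simp
  next
    fix t s' assume "walk_loop_inv s q i s'"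
      "\<not> bval walk_test s'"
      "t + walk_cost * unvisited s' \<le> walk_cost * unvisited s + (tcost walk_test + 2)"
    moreover from this have "array I s' Opt0 (var s' vp) \<noteq> 0" using test[of s'] by blast
    ultimately show "walking s' \<and>
      cycles_inv (q + (if lo I i = hi I i then 0 else 1)) (array I s' Opt0) (array I s' Opt1) (array I s' Cyc) \<and>
      visited (array I s Opt0) \<subseteq> visited (array I s' Opt0) \<and> i \<in> visited (array I s' Opt0) \<and>
      var s' vq = q \<and> var s' vi = i \<and>
      t + walk_cost * unvisited s' \<le> walk_cost * unvisited s + (tcost walk_test + 2)"
      using walk_end[OF inv0, of i "array I s' Opt0" "array I s' Opt1" "array I s' Cyc" "var s' vp" "var s' vx"]
      by simp
  }
qed

abbreviation (input) cycles_step_inv :: "nat \<Rightarrow> store \<Rightarrow> bool" where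
  "cycles_step_inv i s \<equiv> walking s \<and> cycles_ok s \<and> var s vi = i + 1 \<and> U \<inter> {1..<i + 1} \<subseteq> visited (array I s Opt0)"

lemma cycles_body_ht:
  assumes s: "walking s" "cycles_ok s" "var s vi = i" "i \<in> {1..num I}"
    and vis: "U \<inter> {1..<i} \<subseteq> visited (array I s Opt0)"
  shows "ht s cycles_step
    (\<lambda>t s'. cycles_step_inv i s' \<and>
      tcost pos_test + 2 + t + walk_cost * unvisited s' \<le> walk_cost * unvisited s + cycles_outer_cost)"
proof -
  have fr: "frame I s" using s(1) by (simp add: walking_def)
  have sc: "{1..<i + 1} = insert i {1..<i}" using s(4) by auto
  have incr: "walking s2 \<and> cycles_ok s2 \<and> var s2 vi = i \<Longrightarrow>
      walking (fold atom_sem step_pos s2) \<and>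
      cycles_ok (fold atom_sem step_pos s2) \<and>
      var (fold atom_sem step_pos s2) vi = i + 1 \<and>
      imem (fold atom_sem step_pos s2) = imem s2" for s2
    by (simp add: walking_def frame_def rows_def)
  show ?thesis
  proof (rule ht_seq, rule ht_if)
    assume b: "bval open_test s"
    then have o: "array I s Opt0 i = 0" using fr s(3) by (simp add: frame_def)
    \<comment> \<open>Positions outside \<open>U\<close> were decided while peeling, so an undecided
      one must belong to \<open>U\<close>.\<close>
    have iU: "i \<in> U" using s(2,4) o unfolding cycles_inv_def by blast
    define s1 where "s1 = fold atom_sem walk_init s"
    have s1: "walking s1" "cycles_ok s1" "var s1 vq = var s vq" "var s1 vi = i" "var s1 vp = i"
      "var s1 vx = lo I i" "imem s1 = imem s"
      using s frame_ends[OF fr s(4)] by (auto simp: s1_def walking_def frame_def rows_def)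
    show "ht s (Block walk_init ;;
       While walk_test (Block walk_body) ;;
       Block count_cycle)
      (\<lambda>t s'. ht s' (Block step_pos) (\<lambda>t' s'. cycles_step_inv i s' \<and>
      tcost pos_test + 2 + (tcost open_test + 1 + t + t') + walk_cost * unvisited s' \<le>
        walk_cost * unvisited s + cycles_outer_cost))"
    proof (rule ht_seq, rule ht_block, fold s1_def, rule ht_seq, rule ht_conseq[OF walk_ht[of s1 "var s vq" i]])
      show "walking s1" "cycles_ok s1" "var s1 vq = var s vq" "var s1 vi = i" "var s1 vp = i"
        "var s1 vx = lo I i" "i \<in> U" "array I s1 Opt0 i = 0" using s1 o iU by auto
      fix t s2
      assume s2: "walking s2 \<and>
        cycles_inv (var s vq + (if lo I i = hi I i then 0 else 1)) (array I s2 Opt0) (array I s2 Opt1) (array I s2 Cyc) \<and>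
        visited (array I s1 Opt0) \<subseteq> visited (array I s2 Opt0) \<and> i \<in> visited (array I s2 Opt0) \<and>
        var s2 vq = var s vq \<and> var s2 vi = i \<and>
        t + walk_cost * unvisited s2 \<le> walk_cost * unvisited s1 + (tcost walk_test + 2)"
      define s3 where "s3 = fold atom_sem count_cycle s2"
      have fr2: "frame I s2" using s2 by (simp add: walking_def)
      have s3: "walking s3 \<and> cycles_ok s3 \<and> var s3 vi = i" "imem s3 = imem s2"
        using s2 frame_ends[OF fr2 s(4)] req_eq(2)[OF s(4)]
        by (auto simp: s3_def walking_def frame_def rows_def)
      define s4 where "s4 = fold atom_sem step_pos s3"
      have s4: "walking s4" "cycles_ok s4" "var s4 vi = i + 1" "imem s4 = imem s2"
        using incr[OF s3(1), folded s4_def] s3(2) by metis+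
      have "U \<inter> {1..<i + 1} \<subseteq> visited (array I s2 Opt0)"
        using vis s2 s1(7) unfolding sc by auto
      moreover have "tcost pos_test + 2 + (tcost open_test + 1 +
          (bcost walk_init +
          (t + bcost count_cycle)) +
          bcost step_pos) + walk_cost * unvisited s2 \<le>
        walk_cost * unvisited s + cycles_outer_cost"
        using s2 cycles_outer_cost_def unfolding s1(7) by linarith
      ultimately show "ht s2 (Block count_cycle)
        (\<lambda>t' s'. ht s' (Block step_pos) (\<lambda>t'' s'. cycles_step_inv i s' \<and>
          tcost pos_test + 2 + (tcost open_test + 1 +
            (bcost walk_init + (t + t')) + t'') + walk_cost * unvisited s' \<le>
            walk_cost * unvisited s + cycles_outer_cost))"
        using s4 by (intro ht_block, fold s3_def, fold s4_def) simp
    qed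
  next
    assume b: "\<not> bval open_test s"
    then have o: "array I s Opt0 i \<noteq> 0" using fr s(3) by (simp add: frame_def)
    define s4 where "s4 = fold atom_sem step_pos s"
    have s4: "walking s4" "cycles_ok s4" "var s4 vi = i + 1" "imem s4 = imem s"
      using incr[of s, folded s4_def] s by metis+
    have "U \<inter> {1..<i + 1} \<subseteq> visited (array I s Opt0)"
      using vis o unfolding sc by (auto simp: visited_def)
    moreover have "tcost pos_test + 2 + (tcost open_test + 1 +
        (bcost [] + 1) + bcost step_pos) + walk_cost * unvisited s \<le>
        walk_cost * unvisited s + cycles_outer_cost"
      using cycles_outer_cost_def by linarith
    ultimately show "ht s (Block [])
      (\<lambda>t s'. ht s' (Block step_pos) (\<lambda>t' s'. cycles_step_inv i s' \<and>
      tcost pos_test + 2 + (tcost open_test + 1 + (t + 1) + t') + walk_cost * unvisited s' \<le>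
        walk_cost * unvisited s + cycles_outer_cost))"
      using s4 by (intro ht_block) (simp only: fold_simps(1) id_apply, fold s4_def, simp)
  qed
qed

abbreviation (input) cycles_outer_inv :: "store \<Rightarrow> bool" where
  "cycles_outer_inv s \<equiv> walking s \<and> cycles_ok s \<and> 1 \<le> var s vi \<and> var s vi \<le> num I + 1 \<and>
      U \<inter> {1..<var s vi} \<subseteq> visited (array I s Opt0)"

lemma cycles_ht:
  assumes s: "walking s" "cycles_inv 0 (array I s Opt0) (array I s Opt1) (array I s Cyc)"
  shows "ht s cycles_prog (\<lambda>t s'. frame I s' \<and> rows I s' (num I) \<and>
    cycle_structure I (var s' vq) (array I s' Opt0) (array I s' Opt1) (array I s' Cyc) \<and>
    (\<forall>i\<in>{1..num I}. array I s' Cyc i < num I) \<and> var s' vq \<le> num I \<and>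
    t \<le> cycles_cost * (num I + 1))"
  unfolding cycles_prog_def
proof (rule ht_seq, rule ht_block, rule ht_while_conseq[where
    P = "\<lambda>s. cycles_outer_inv s"
    and \<Phi> = "\<lambda>s. walk_cost * unvisited s + cycles_outer_cost * (num I + 1 - var s vi)"])
  let ?s = "fold atom_sem [Assign vi (N 1), Assign vq (N 0)] s"
  show "cycles_outer_inv ?s"
    using s by (simp add: walking_def frame_def rows_def)
  {
    fix s assume inv: "cycles_outer_inv s" and b: "bval pos_test s"
    define i where "i = var s vi"
    have i: "i \<in> {1..num I}" using inv b by (auto simp: i_def walking_def frame_def)
    have pot: "cycles_outer_cost * (num I + 1 - i) = cycles_outer_cost + cycles_outer_cost * (num I - i)"
      using i by (intro potential_step) auto
    show "ht s cycles_step
      (\<lambda>t s'. (cycles_outer_inv s') \<and>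
        tcost pos_test + 2 + t + (walk_cost * unvisited s' + cycles_outer_cost * (num I + 1 - var s' vi))
        \<le> walk_cost * unvisited s + cycles_outer_cost * (num I + 1 - var s vi))"
    proof (rule ht_conseq[OF cycles_body_ht[of s i]], goal_cases)
      case (6 t s')
      then show ?case using i pot unfolding i_def[symmetric] by auto
    qed (use inv i in \<open>auto simp: i_def\<close>)
  next
    fix t s' assume inv: "cycles_outer_inv s'" and b: "\<not> bval pos_test s'"
      and t: "t + (walk_cost * unvisited s' + cycles_outer_cost * (num I + 1 - var s' vi))
        \<le> walk_cost * unvisited ?s + cycles_outer_cost * (num I + 1 - var ?s vi) +
          (tcost pos_test + 2)"
    have "var s' vi = num I + 1" using inv b by (auto simp: walking_def frame_def)
    then have "U \<subseteq> visited (array I s' Opt0)" using inv U by (simp add: atLeastLessThanSuc_atLeastAtMost Int_absorb2)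
    then have cs: "cycle_structure I (var s' vq) (array I s' Opt0) (array I s' Opt1) (array I s' Cyc)"
      using inv cycles_inv_final by blast
    have "card (visited (array I s' Opt0)) \<le> card {1..num I}"
      using U by (intro card_mono) (auto simp: visited_def)
    then have q: "var s' vq \<le> num I" using inv by (auto simp: cycles_inv_def)
    have "unvisited ?s \<le> card {1..num I}" using U by (intro card_mono) auto
    then have "unvisited ?s \<le> num I" by simp
    moreover have "num I + 1 - var ?s vi \<le> num I" by simp
    ultimately have "bcost [Assign vi (N 1), Assign vq (N 0)] + t \<le> cycles_cost * (num I + 1)"
      using amortised_total[OF t] by (simp only: cycles_cost_def add.assoc)
    then show "frame I s' \<and> rows I s' (num I) \<and>
      cycle_structure I (var s' vq) (array I s' Opt0) (array I s' Opt1) (array I s' Cyc) \<and>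
      (\<forall>i\<in>{1..num I}. array I s' Cyc i < num I) \<and> var s' vq \<le> num I \<and>
      bcost [Assign vi (N 1), Assign vq (N 0)] + t \<le> cycles_cost * (num I + 1)"
      using inv cs q by (simp add: walking_def cycles_inv_def)
  }
qed

end


section \<open>The cost as a quadratic function of the choices\<close>

definition quad :: "(nat \<Rightarrow> nat \<Rightarrow> real) \<Rightarrow> nat set \<Rightarrow> real" where
  "quad B S = (\<Sum>c\<in>S. \<Sum>d\<in>S. B c d)"

text \<open>As column indices are below \<open>n\<close>, division by \<open>n\<close> recovers row
  and column from the address. So the update changes a single coefficient, which is counted iff both
  labels lie in \<open>S\<close>.\<close>

lemma quad_upd:
  assumes S: "S \<subseteq> {..<n}" and c: "c < n" "d < n"
  shows "quad (\<lambda>a b. (M(c * n + d := M (c * n + d) + v)) (a * n + b)) S =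
    quad (\<lambda>a b. M (a * n + b)) S + (if c \<in> S \<and> d \<in> S then v else 0)"
proof -
  have fin: "finite S" using S finite_subset by blast
  have inj: "a * n + b = c * n + d \<longleftrightarrow> a = c \<and> b = d" if "b < n" for a b
  proof
    assume eq: "a * n + b = c * n + d"
    then have "(a * n + b) div n = (c * n + d) div n" "(a * n + b) mod n = (c * n + d) mod n" by simp_all
    then show "a = c \<and> b = d" using that c(2) by simp
  qed simp
  have "quad (\<lambda>a b. (M(c * n + d := M (c * n + d) + v)) (a * n + b)) S =
      (\<Sum>a\<in>S. \<Sum>b\<in>S. M (a * n + b) + (if a = c then if b = d then v else 0 else 0))"
    unfolding quad_def using S by (intro sum.cong) (auto simp: inj)
  also have "\<dots> = quad (\<lambda>a b. M (a * n + b)) S + (\<Sum>a\<in>S. if a = c then if d \<in> S then v else 0 else 0)"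
    unfolding quad_def sum.distrib using fin by (intro arg_cong2[of _ _ _ _ "(+)"] sum.cong) auto
  also have "(\<Sum>a\<in>S. if a = c then if d \<in> S then v else 0 else 0) = (if c \<in> S \<and> d \<in> S then v else 0)"
    using fin by simp
  finally show ?thesis .
qed

definition delta :: "(nat \<Rightarrow> nat \<Rightarrow> real) \<Rightarrow> nat \<Rightarrow> nat set \<Rightarrow> real" where
  "delta B c S = B c c + (\<Sum>d\<in>S. B c d + B d c)"

lemma quad_insert: "finite S \<Longrightarrow> c \<notin> S \<Longrightarrow> quad B (insert c S) = quad B S + delta B c S"
  by (simp add: quad_def delta_def sum.distrib)

lemma delta_insert: "finite S \<Longrightarrow> d \<notin> S \<Longrightarrow> delta B c (insert d S) = delta B c S + (B c d + B d c)"
  by (simp add: delta_def)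

lemma set_decode_less:
  assumes "m < 2 ^ c"
  shows "set_decode m \<subseteq> {..<c}"
proof
  fix x assume "x \<in> set_decode m"
  then have "m div 2 ^ x \<noteq> 0" by (auto simp: set_decode_def intro: ccontr)
  then have "2 ^ x \<le> m" by (simp add: div_eq_0_iff)
  then have "2 ^ x < (2 ^ c :: nat)" using assms by (rule le_less_trans)
  then show "x \<in> {..<c}" using power_less_imp_less_exp[of "2 :: nat" x c] by simp
qed

lemma set_decode_add:
  assumes "m < 2 ^ c"
  shows "set_decode (2 ^ c + m) = insert c (set_decode m)" "c \<notin> set_decode m"
proof -
  show "c \<notin> set_decode m" using set_decode_less[OF assms] by blast
  then show "set_decode (2 ^ c + m) = insert c (set_decode m)" by (rule set_decode_plus_power_2)
qed

text \<open>\<open>set_encode\<close> is monotone and sends \<open>{..<q}\<close> to a number below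
  \<open>2 ^ q\<close>, the sum of the first \<open>q\<close> powers of two.\<close>

lemma subset_set_decode:
  assumes "S \<subseteq> {..<q}"
  shows "\<exists>m<2 ^ q. S = set_decode m"
proof (intro exI conjI)
  have fin: "finite S" using assms finite_subset by blast
  then show "S = set_decode (set_encode S)" by simp
  have "set_encode S \<le> set_encode {..<q}"
    unfolding set_encode_def using assms by (intro sum_mono2) auto
  also have "\<dots> < 2 ^ q" by (induction q) (simp_all add: set_encode_def lessThan_Suc)
  finally show "set_encode S < 2 ^ q" .
qed


section \<open>Collecting the weights\<close>

abbreviation (input) "vj \<equiv> 8 :: nat"
abbreviation (input) "vk0 \<equiv> 9 :: nat"
abbreviation (input) "vk1 \<equiv> 10 :: nat"
abbreviation (input) "vl0 \<equiv> 11 :: nat"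
abbreviation (input) "vl1 \<equiv> 12 :: nat"
abbreviation (input) "vc \<equiv> 13 :: nat"
abbreviation (input) "vd \<equiv> 14 :: nat"
abbreviation (input) "vrc \<equiv> 15 :: nat"
abbreviation (input) "vrd \<equiv> 16 :: nat"

text \<open>The input slot of the arc from option \<open>k\<close> of position \<open>vi\<close> to option \<open>l\<close> of the next one.\<close>

definition Slot :: "nat \<Rightarrow> nat \<Rightarrow> wexp" where
  "Slot k l = WLd (Plus (Minus (let e = Plus (V vi) (V vi) in Plus e e) (N 4)) (Plus (Plus (V k) (V k)) (V l)))"

lemma wval_Slot [simp]: "wval (Slot k l) s = rmem s (4 * var s vi - 4 + (2 * var s k + var s l))"
  by (simp only: Slot_def Let_def wval.simps aval.simps, rule arg_cong[where f = "rmem s"]) simp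

lemma Slot_ok [simp]: "wexp_ok (Slot k l) \<longleftrightarrow> k < 100 \<and> l < 100"
  by (auto simp: Slot_def Let_def)

text \<open>Input slots are indexed by the rank of an option in its requisition, whereas the arrays
  hold vertices. The sign of the difference to the smaller vertex recovers the rank; a singleton
  gets rank 0.\<close>

definition "index_body = [
  Assign vk0 (Sgn (Minus (Arr Opt0 (V vi)) (Lo (V vi)))),
  Assign vk1 (Sgn (Minus (Arr Opt1 (V vi)) (Lo (V vi)))),
  Assign vl0 (Sgn (Minus (Arr Opt0 (V vj)) (Lo (V vj)))),
  Assign vl1 (Sgn (Minus (Arr Opt1 (V vj)) (Lo (V vj)))),
  Assign vc (Arr Cyc (V vi)),
  Assign vd (Arr Cyc (V vj)),
  Assign vrc (Arr Row (V vc)),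
  Assign vrd (Arr Row (V vd))]"

text \<open>A function of two bits \<open>a\<close>, \<open>b\<close> with values
  \<open>w00\<close>, ..., \<open>w11\<close> is \<open>w00 + a (w10 - w00) + b (w01 - w00) + a b
  (w11 - w10 - w01 + w00)\<close>. A bit is its own square, so linear terms go to the diagonal. On a
  common cycle all three updates hit one cell, so each has to read what the previous one
  wrote.\<close>

definition "entries_body = [
  WAssign 2 (Slot vk0 vl0),
  WAssign 3 (Slot vk0 vl1),
  WAssign 4 (Slot vk1 vl0),
  WAssign 5 (Slot vk1 vl1),
  WAssign 0 (WPlus (WV 0) (WV 2)),
  WPut (WAdr Quad (Plus (V vrc) (V vc))) (WPlus (WArr Quad (Plus (V vrc) (V vc))) (WMinus (WV 4) (WV 2))),
  WPut (WAdr Quad (Plus (V vrd) (V vd))) (WPlus (WArr Quad (Plus (V vrd) (V vd))) (WMinus (WV 3) (WV 2))),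
  WPut (WAdr Quad (Plus (V vrc) (V vd))) (WPlus (WArr Quad (Plus (V vrc) (V vd)))
    (WPlus (WMinus (WMinus (WV 5) (WV 4)) (WV 3)) (WV 2))),
  Assign vi (V vj),
  Assign vj (Plus (V vj) (N 1))]"

text \<open>The pairs of neighbours are visited in the order \<open>(n, 1), (1, 2), \<dots>, (n - 1, n)\<close>.\<close>

abbreviation (input) "weights_init \<equiv> [Assign vi (V 0), Assign vj (N 1)]"
abbreviation (input) "weights_test \<equiv> Le (V vj) (V 0)"

definition "weights_prog =
  Block weights_init ;;
  While weights_test (Block (index_body @ entries_body))"

abbreviation warray :: "tspvr \<Rightarrow> store \<Rightarrow> warr \<Rightarrow> nat \<Rightarrow> real" where
  "warray I s k \<equiv> war (num I) (rmem s) k"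

definition quad_of :: "tspvr \<Rightarrow> store \<Rightarrow> nat \<Rightarrow> nat \<Rightarrow> real" where
  "quad_of I s c d = warray I s Quad (c * num I + d)"

lemma input_slot:
  assumes "i \<in> {1..num I}" "k < 2" "l < 2"
  shows "input_wmem I (4 * i - 4 + (2 * k + l)) =
    arc_weight I (req_elem I i k) (req_elem I (cyc_next (num I) i) l)"
proof -
  obtain m where m: "i = Suc m" using assms(1) by (cases i) auto
  define a where "a = 4 * i - 4 + (2 * k + l)"
  have a: "a = 4 * m + (2 * k + l)" by (simp add: a_def m)
  have kl: "2 * k + l < 4" using assms by auto
  have "a < 4 * num I" using a kl assms(1) m by auto
  moreover have "a div 4 + 1 = i" "a mod 4 = 2 * k + l" using a kl m by auto
  moreover have "(2 * k + l) div 2 = k" using assms(2,3) by auto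
  moreover have "a = l + 2 * (2 * m + k)" using a by simp
  then have "a mod 2 = l" using assms(3) by (simp only: mod_mult_self2 mod_less)
  ultimately show ?thesis unfolding a_def[symmetric] input_wmem_def Let_def by simp
qed

lemma option_index:
  assumes "lo I i \<le> hi I i" "x \<in> {lo I i, hi I i}"
  shows "req_elem I i (if x - lo I i = 0 then 0 else 1) = x"
  using assms by (auto simp: req_elem_def lo_def hi_def)

lemma weights_body_sem:
  assumes "var s 0 = num I" "rows I s (num I)" "\<And>a. a \<le> 2 * num I \<Longrightarrow> imem s a = input_mem I a"
    "\<And>a. a < 4 * num I \<Longrightarrow> rmem s a = input_wmem I a"
    and "var s vi = i" "var s vj = j" "i \<in> {1..num I}" "j \<in> {1..num I}" "j = cyc_next (num I) i"
    and "o0 = array I s Opt0" "o1 = array I s Opt1"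
    and le: "lo I i \<le> hi I i" "lo I j \<le> hi I j"
    and opt: "o0 i \<in> {lo I i, hi I i}" "o1 i \<in> {lo I i, hi I i}" "o0 j \<in> {lo I j, hi I j}" "o1 j \<in> {lo I j, hi I j}"
    and "c = array I s Cyc i" "c < num I" "d = array I s Cyc j" "d < num I"
  defines "w00 \<equiv> arc_weight I (o0 i) (o0 j)" and "w01 \<equiv> arc_weight I (o0 i) (o1 j)"
    and "w10 \<equiv> arc_weight I (o1 i) (o0 j)" and "w11 \<equiv> arc_weight I (o1 i) (o1 j)"
    and "s' \<equiv> fold atom_sem (index_body @ entries_body) s"
  shows "var s' 0 = num I \<and> var s' vq = var s vq \<and> imem s' = imem s \<and>
    (\<forall>a < 4 * num I. rmem s' a = input_wmem I a) \<and> var s' vi = j \<and> var s' vj = j + 1 \<and>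
    wvar s' 0 = wvar s 0 + w00 \<and>
    (\<forall>S \<subseteq> {..<num I}. quad (quad_of I s') S = quad (quad_of I s) S +
      (if c \<in> S \<and> c \<in> S then w10 - w00 else 0) + (if d \<in> S \<and> d \<in> S then w01 - w00 else 0) +
      (if c \<in> S \<and> d \<in> S then w11 - w10 - w01 + w00 else 0))"
proof -
  have sl: "input_wmem I (4 * i - 4 + (2 * (if x - lo I i = 0 then 0 else 1) + (if y - lo I j = 0 then 0 else 1)))
      = arc_weight I x y" if "x \<in> {lo I i, hi I i}" "y \<in> {lo I j, hi I j}" for x y
    using input_slot[OF assms(7), of "if x - lo I i = 0 then 0 else 1" "if y - lo I j = 0 then 0 else 1"]
      option_index[OF le(1) that(1)] option_index[OF le(2) that(2)] assms(9) by simp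
  have lt: "4 * i - 4 + (2 * (if P then 0 else 1) + (if Q then 0 else 1)) < 4 * num I" for P Q
    using assms(7) by auto
  have e: "imem s (2 * i - 1) = lo I i" "imem s (2 * j - 1) = lo I j"
    using assms(3) input_ends(1)[of i I] input_ends(1)[of j I] assms(7,8) by auto
  have r: "array I s Row c = c * num I" "array I s Row d = d * num I"
    using assms(2,19,21) by (auto simp: rows_def)
  define M where "M = warray I s Quad"
  define M1 where "M1 = M(c * num I + c := M (c * num I + c) + (w10 - w00))"
  define M2 where "M2 = M1(d * num I + d := M1 (d * num I + d) + (w01 - w00))"
  define M3 where "M3 = M2(c * num I + d := M2 (c * num I + d) + (w11 - w10 - w01 + w00))"
  have rm: "rmem s (4 * i - 4 + (2 * (if z - lo I i = 0 then 0 else 1) + (if z' - lo I j = 0 then 0 else 1)))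
      = arc_weight I z z'" if "z \<in> {lo I i, hi I i}" "z' \<in> {lo I j, hi I j}" for z z'
    using assms(4)[OF lt] sl[OF that] by simp
  note w = rm[OF opt(1) opt(3), folded w00_def] rm[OF opt(1) opt(4), folded w01_def]
    rm[OF opt(2) opt(3), folded w10_def] rm[OF opt(2) opt(4), folded w11_def]
  define k0 k1 l0 l1 :: nat where "k0 = (if o0 i - lo I i = 0 then 0 else 1)"
    and "k1 = (if o1 i - lo I i = 0 then 0 else 1)"
    and "l0 = (if o0 j - lo I j = 0 then 0 else 1)" and "l1 = (if o1 j - lo I j = 0 then 0 else 1)"
  note kl = k0_def[symmetric] k1_def[symmetric] l0_def[symmetric] l1_def[symmetric]
  define s1 where "s1 = fold atom_sem index_body s"
  have s1: "var s1 vk0 = k0" "var s1 vk1 = k1" "var s1 vl0 = l0" "var s1 vl1 = l1" "var s1 vc = c" "var s1 vd = d"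
    "var s1 vrc = c * num I" "var s1 vrd = d * num I" "var s1 0 = num I" "var s1 vi = i" "var s1 vj = j"
    "var s1 vq = var s vq" "imem s1 = imem s" "rmem s1 = rmem s" "wvar s1 = wvar s"
    unfolding s1_def index_body_def kl[symmetric]
    by (simp_all add: assms(1,5,6) assms(10,11,18,20)[symmetric] e[unfolded One_nat_def] r)
  define rc rd where "rc = c * num I" and "rd = d * num I"
  note w' = w[unfolded kl]
  have "s' = fold atom_sem entries_body s1" by (simp add: s'_def s1_def)
  then have main: "var s' 0 = num I \<and> var s' vq = var s vq \<and> imem s' = imem s \<and> var s' vi = j \<and> var s' vj = j + 1 \<and>
    wvar s' 0 = wvar s 0 + w00 \<and> warray I s' Quad = M3 \<and> (\<forall>a < 4 * num I. rmem s' a = rmem s a)"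
    unfolding entries_body_def M3_def M2_def M1_def M_def rc_def[symmetric] rd_def[symmetric]
    by (simp add: s1[folded rc_def rd_def] w')
  have "quad (quad_of I s') S = quad (quad_of I s) S +
      (if c \<in> S \<and> c \<in> S then w10 - w00 else 0) + (if d \<in> S \<and> d \<in> S then w01 - w00 else 0) +
      (if c \<in> S \<and> d \<in> S then w11 - w10 - w01 + w00 else 0)" if "S \<subseteq> {..<num I}" for S
  proof -
    have "quad (quad_of I s') S = quad (\<lambda>a b. M3 (a * num I + b)) S"
      using main by (simp add: quad_of_def[abs_def])
    also have "\<dots> = quad (\<lambda>a b. M2 (a * num I + b)) S + (if c \<in> S \<and> d \<in> S then w11 - w10 - w01 + w00 else 0)"
      unfolding M3_def by (rule quad_upd[OF that assms(19,21)])
    also have "quad (\<lambda>a b. M2 (a * num I + b)) S =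
        quad (\<lambda>a b. M1 (a * num I + b)) S + (if d \<in> S \<and> d \<in> S then w01 - w00 else 0)"
      unfolding M2_def by (rule quad_upd[OF that assms(21,21)])
    also have "quad (\<lambda>a b. M1 (a * num I + b)) S =
        quad (\<lambda>a b. M (a * num I + b)) S + (if c \<in> S \<and> c \<in> S then w10 - w00 else 0)"
      unfolding M1_def by (rule quad_upd[OF that assms(19,19)])
    finally show ?thesis by (simp add: M_def quad_of_def[abs_def])
  qed
  then show ?thesis using main assms(4) by auto
qed


definition "weights_cost = bcost weights_init +
  (bcost (index_body @ entries_body) + tcost weights_test + 2)"

context cycle_structure
begin

definition pair_weight :: "nat set \<Rightarrow> nat \<Rightarrow> nat \<Rightarrow> real" where
  "pair_weight S i j = arc_weight I (choice S i) (choice S j)"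

text \<open>When the loop counter stands at \<open>j\<close>, exactly the arcs that end at the
  positions \<open>1\<close> to \<open>j - 1\<close> have been collected, the closing arc from
  \<open>n\<close> being the first.\<close>

definition partial_cost :: "nat set \<Rightarrow> nat \<Rightarrow> real" where
  "partial_cost S j = (if j = 1 then 0 else pair_weight S (num I) 1 + (\<Sum>i = 1..<j - 1. pair_weight S i (i + 1)))"

text \<open>Expand in the indicators of \<open>cy i \<in> S\<close> and \<open>cy j \<in> S\<close>.\<close>

lemma pair_weight_quad:
  "pair_weight S i j = arc_weight I (o0 i) (o0 j) +
    (if cy i \<in> S \<and> cy i \<in> S then arc_weight I (o1 i) (o0 j) - arc_weight I (o0 i) (o0 j) else 0) +
    (if cy j \<in> S \<and> cy j \<in> S then arc_weight I (o0 i) (o1 j) - arc_weight I (o0 i) (o0 j) else 0) +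
    (if cy i \<in> S \<and> cy j \<in> S then arc_weight I (o1 i) (o1 j) - arc_weight I (o1 i) (o0 j)
       - arc_weight I (o0 i) (o1 j) + arc_weight I (o0 i) (o0 j) else 0)"
  by (simp add: pair_weight_def choice_def)

abbreviation (input) weights_inv :: "store \<Rightarrow> store \<Rightarrow> bool" where
  "weights_inv s0 s \<equiv> var s 0 = num I \<and> var s vq = var s0 vq \<and> imem s = imem s0 \<and>
      (\<forall>a < 4 * num I. rmem s a = input_wmem I a) \<and> 1 \<le> var s vj \<and> var s vj \<le> num I + 1 \<and>
      var s vi = (if var s vj = 1 then num I else var s vj - 1) \<and>
      (\<forall>S \<subseteq> {..<num I}. wvar s 0 + quad (quad_of I s) S = partial_cost S (var s vj))"

lemma weights_ht:
  assumes s: "frame I s" "rows I s (num I)" "array I s Opt0 = o0" "array I s Opt1 = o1" "array I s Cyc = cy"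
    and cy: "\<forall>i\<in>{1..num I}. cy i < num I" and n: "2 \<le> num I"
  shows "ht s weights_prog (\<lambda>t s'. var s' 0 = num I \<and> var s' vq = var s vq \<and> imem s' = imem s \<and>
    (\<forall>S \<subseteq> {..<num I}. wvar s' 0 + quad (quad_of I s') S = cost I (sol S)) \<and>
    t \<le> weights_cost * (num I + 1))"
  unfolding weights_prog_def
proof (rule ht_seq, rule ht_block, rule ht_while_measure[where
    P = "\<lambda>s'. weights_inv s s'"
    and A = "bcost (index_body @ entries_body)" and \<mu> = "\<lambda>s. num I + 1 - var s vj"])
  interpret fi: feasible_instance I by unfold_locales (fact inst feas)+
  let ?s = "fold atom_sem weights_init s"
  \<comment> \<open>The matrix is zero because its cells lie beyond the input; clearing them would
    already take quadratic time.\<close>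
  have "war (num I) (input_wmem I) Quad = (\<lambda>_. 0)"
    using wadr_ge[of "num I" Quad] by (auto simp: war_def input_wmem_def fun_eq_iff)
  then have "quad_of I ?s = (\<lambda>c d. 0)"
    using s(1) by (simp add: quad_of_def[abs_def] frame_def)
  then show "weights_inv s ?s"
    using s(1) by (simp add: frame_def partial_cost_def quad_def)
  {
    fix s1 assume inv: "weights_inv s s1"
      and b: "bval weights_test s1"
    define i j where "i = var s1 vi" and "j = var s1 vj"
    define s' where "s' = fold atom_sem (index_body @ entries_body) s1"
    have j: "j \<in> {1..num I}" and i: "i \<in> {1..num I}" and next_pos: "j = cyc_next (num I) i"
      using inv b n by (auto simp: i_def j_def cyc_next_def)
    have opt: "o0 k \<in> {lo I k, hi I k}" "o1 k \<in> {lo I k, hi I k}" if "k \<in> {1..num I}" for k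
      using options[OF that] fi.req_eq(1)[OF that] by auto
    have im: "imem s1 a = input_mem I a" if "a \<le> 2 * num I" for a
      using inv s(1) that by (simp add: frame_def)
    have sem: "var s' 0 = num I \<and> var s' vq = var s1 vq \<and> imem s' = imem s1 \<and>
      (\<forall>a < 4 * num I. rmem s' a = input_wmem I a) \<and> var s' vi = j \<and> var s' vj = j + 1 \<and>
      wvar s' 0 = wvar s1 0 + arc_weight I (o0 i) (o0 j) \<and>
      (\<forall>S \<subseteq> {..<num I}. quad (quad_of I s') S = quad (quad_of I s1) S +
        (if cy i \<in> S \<and> cy i \<in> S then arc_weight I (o1 i) (o0 j) - arc_weight I (o0 i) (o0 j) else 0) +
        (if cy j \<in> S \<and> cy j \<in> S then arc_weight I (o0 i) (o1 j) - arc_weight I (o0 i) (o0 j) else 0) +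
        (if cy i \<in> S \<and> cy j \<in> S then arc_weight I (o1 i) (o1 j) - arc_weight I (o1 i) (o0 j)
           - arc_weight I (o0 i) (o1 j) + arc_weight I (o0 i) (o0 j) else 0))"
      unfolding s'_def
    proof (rule weights_body_sem)
      show "rows I s1 (num I)" using inv s(2) by (simp add: rows_def)
      show "o0 = array I s1 Opt0" "o1 = array I s1 Opt1" "cy i = array I s1 Cyc i" "cy j = array I s1 Cyc j"
        using inv s by auto
    qed (use inv im i j next_pos opt cy fi.req_eq(2) in \<open>auto simp: i_def j_def\<close>)
    have "partial_cost S (j + 1) = partial_cost S j + pair_weight S i j" for S
    proof (cases "j = 1")
      case True
      then show ?thesis using inv by (simp add: partial_cost_def i_def j_def)
    next
      case False
      then have "i = j - 1" "{1..<j} = insert (j - 1) {1..<j - 1}" using inv j by (auto simp: i_def j_def)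
      then show ?thesis using False j by (simp add: partial_cost_def)
    qed
    then have "\<forall>S \<subseteq> {..<num I}. wvar s' 0 + quad (quad_of I s') S = partial_cost S (j + 1)"
      using sem inv pair_weight_quad[of _ i j] by (simp add: j_def[symmetric])
    then show "ht s1 (Block (index_body @ entries_body)) (\<lambda>t s'. (weights_inv s s') \<and>
      t \<le> bcost (index_body @ entries_body) \<and> num I + 1 - var s' vj < num I + 1 - var s1 vj)"
      using sem inv j by (intro ht_block, fold s'_def j_def) auto
  next
    fix t s' assume inv: "weights_inv s s'"
      and b: "\<not> bval weights_test s'"
      and t: "t \<le> (bcost (index_body @ entries_body) + tcost weights_test + 2) * (num I + 1 - var ?s vj + 1)"
    have "var s' vj = num I + 1" using inv b by auto
    moreover have "partial_cost S (num I + 1) = cost I (sol S)" for S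
      unfolding cost_sol[OF n] using n by (simp add: partial_cost_def pair_weight_def)
    moreover have "t \<le> (bcost (index_body @ entries_body) + tcost weights_test + 2) * (num I + 1)"
      using t by (rule order_trans) simp
    then have "bcost weights_init + t \<le> weights_cost * (num I + 1)"
      by (simp add: weights_cost_def add_mult_distrib)
    ultimately show "var s' 0 = num I \<and> var s' vq = var s vq \<and> imem s' = imem s \<and>
      (\<forall>S \<subseteq> {..<num I}. wvar s' 0 + quad (quad_of I s') S = cost I (sol S)) \<and>
      bcost weights_init + t \<le> weights_cost * (num I + 1)"
      using inv by simp
  }
qed

end


section \<open>Tabulating the costs of all choices\<close>

abbreviation (input) "ve \<equiv> 17 :: nat"
abbreviation (input) "vw \<equiv> 18 :: nat"
abbreviation (input) "vm \<equiv> 19 :: nat"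
abbreviation (input) "vb \<equiv> 20 :: nat"

abbreviation (input) "tables_test \<equiv> Le (Plus (V vc) (N 1)) (V vq)"
abbreviation (input) "delta_test \<equiv> Le (Plus (V vd) (N 1)) (V vc)"
abbreviation (input) "delta_copy_test \<equiv> Le (Plus (V vm) (N 1)) (V ve)"
abbreviation (input) "total_test \<equiv> Le (Plus (V vm) (N 1)) (V vw)"
abbreviation (input) "tables_init \<equiv> [Assign vc (N 0), Assign vw (N 1), WPut (WAdr Total (N 0)) (WV 0)]"

definition "delta_start = [
  Assign vrc (Arr Row (V vc)),
  WPut (WAdr Delta (N 0)) (WArr Quad (Plus (V vrc) (V vc))),
  Assign vd (N 0),
  Assign ve (N 1)]"

text \<open>Coefficients are stored in the direction of the tour, so the matrix need not be
  symmetric and both orders are added.\<close>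

definition "delta_pair = [
  Assign vrd (Arr Row (V vd)),
  WAssign 6 (WPlus (WArr Quad (Plus (V vrc) (V vd))) (WArr Quad (Plus (V vrd) (V vc)))),
  Assign vm (N 0)]"

definition "delta_copy = [
  WPut (WAdr Delta (Plus (V ve) (V vm))) (WPlus (WArr Delta (V vm)) (WV 6)),
  Assign vm (Plus (V vm) (N 1))]"

definition "delta_next = [Assign ve (Plus (V ve) (V ve)), Assign vd (Plus (V vd) (N 1))]"

definition "total_copy = [
  WPut (WAdr Total (Plus (V vw) (V vm))) (WPlus (WArr Total (V vm)) (WArr Delta (V vm))),
  Assign vm (Plus (V vm) (N 1))]"

text \<open>The powers of two are kept because decoding runs downwards and cannot halve.\<close>

definition "total_next = [
  Put (Adr Pow (V vc)) (V vw),
  Assign vw (Plus (V vw) (V vw)),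
  Assign vc (Plus (V vc) (N 1))]"

definition "delta_copy_loop = While delta_copy_test (Block delta_copy)"

definition "delta_loop = While delta_test
  (Block delta_pair ;; delta_copy_loop ;; Block delta_next)"

definition "total_copy_loop = While total_test (Block total_copy)"

definition "tables_prog =
  Block tables_init ;;
  While tables_test
    (Block delta_start ;; delta_loop ;; Block [Assign vm (N 0)] ;; total_copy_loop ;; Block total_next)"

text \<open>
  \<open>Total ! m\<close> is the cost of the choice coded by \<open>m\<close>, and \<open>Delta ! m\<close> is what the cost
  grows by when \<open>c\<close> is added to it.
\<close>

locale tables =
  fixes I :: tspvr and s0 :: store
  assumes rows: "rows I s0 (num I)" and q: "var s0 vq \<le> num I"
begin

definition total :: "nat \<Rightarrow> real" where
  "total m = wvar s0 0 + quad (quad_of I s0) (set_decode m)"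

definition grow :: "nat \<Rightarrow> nat \<Rightarrow> real" where
  "grow c m = delta (quad_of I s0) c (set_decode m)"

lemma total_add: "m < 2 ^ c \<Longrightarrow> total (2 ^ c + m) = total m + grow c m"
  using set_decode_add[of m c] by (simp add: total_def grow_def quad_insert)

lemma grow_add: "m < 2 ^ d \<Longrightarrow> grow c (2 ^ d + m) = grow c m + (quad_of I s0 c d + quad_of I s0 d c)"
  using set_decode_add[of m d] by (simp add: grow_def delta_insert)

text \<open>\<open>Delta\<close> is left out, as it is rewritten for every new cycle; its contents
  are described by \<open>grown\<close>.\<close>

definition tabulated :: "nat \<Rightarrow> store \<Rightarrow> bool" where
  "tabulated c s \<longleftrightarrow> var s 0 = num I \<and> var s vq = var s0 vq \<and>
     (\<forall>k. k \<noteq> Pow \<longrightarrow> array I s k = array I s0 k) \<and>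
     warray I s Quad = warray I s0 Quad \<and> wvar s 0 = wvar s0 0 \<and>
     var s vc = c \<and> var s vw = 2 ^ c \<and> (\<forall>d<c. array I s Pow d = 2 ^ d) \<and>
     (\<forall>m<2 ^ c. warray I s Total m = total m)"

definition grown :: "nat \<Rightarrow> nat \<Rightarrow> store \<Rightarrow> bool" where
  "grown c k s \<longleftrightarrow> (\<forall>m<k. warray I s Delta m = grow c m)"

definition "delta_copy_cost = bcost delta_copy + tcost delta_copy_test + 2"

abbreviation (input) delta_copy_inv :: "nat \<Rightarrow> nat \<Rightarrow> store \<Rightarrow> bool" where
  "delta_copy_inv c d s \<equiv> tabulated c s \<and> grown c (2 ^ d + var s vm) s \<and> var s ve = 2 ^ d \<and>
      var s vd = d \<and> var s vrc = c * num I \<and> var s vm \<le> 2 ^ d \<and>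
      wvar s 6 = quad_of I s0 c d + quad_of I s0 d c"

text \<open>The sets whose largest element is \<open>d\<close> have the codes
  \<open>2 ^ d + m\<close> with \<open>m < 2 ^ d\<close>. So the upper half of the table is the
  lower half shifted by the one weight kept in weight variable 6.\<close>

lemma delta_copy_ht:
  assumes "tabulated c s" "grown c (2 ^ d) s" "var s ve = 2 ^ d" "var s vd = d" "var s vrc = c * num I"
    "var s vm = 0" "wvar s 6 = quad_of I s0 c d + quad_of I s0 d c"
  shows "ht s delta_copy_loop (\<lambda>t s'. tabulated c s' \<and> grown c (2 ^ Suc d) s' \<and> var s' ve = 2 ^ d \<and>
    var s' vd = d \<and> var s' vrc = c * num I \<and> t \<le> delta_copy_cost * (2 ^ d + 1))"
  unfolding delta_copy_loop_def
proof (rule ht_while_measure[where P = "\<lambda>s. delta_copy_inv c d s"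
    and A = "bcost delta_copy" and \<mu> = "\<lambda>s. 2 ^ d - var s vm"])
  show "delta_copy_inv c d s"
    using assms by simp
next
  fix s assume inv: "delta_copy_inv c d s"
    and b: "bval delta_copy_test s"
  define m where "m = var s vm"
  define s' where "s' = fold atom_sem delta_copy s"
  have m: "m < 2 ^ d" using inv b by (simp add: m_def)
  have n0: "var s 0 = num I" using inv by (simp add: tabulated_def)
  have gm: "warray I s Delta m = grow c m" using inv m by (simp add: grown_def m_def[symmetric])
  have s': "tabulated c s'" "var s' ve = 2 ^ d" "var s' vd = d" "var s' vrc = c * num I" "var s' vm = m + 1"
    "wvar s' 6 = quad_of I s0 c d + quad_of I s0 d c"
    "warray I s' Delta = (warray I s Delta)(2 ^ d + m := grow c (2 ^ d + m))"
    using inv gm grow_add[OF m] unfolding s'_def delta_copy_def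
    by (simp_all add: tabulated_def m_def[symmetric])
  then have "grown c (2 ^ d + (m + 1)) s'"
    using inv by (auto simp: grown_def m_def[symmetric] less_Suc_eq)
  then show "ht s (Block delta_copy) (\<lambda>t s'. (delta_copy_inv c d s') \<and>
      t \<le> bcost delta_copy \<and> 2 ^ d - var s' vm < 2 ^ d - var s vm)"
    using s' m by (intro ht_block, fold s'_def m_def) auto
next
  fix t s' assume "delta_copy_inv c d s'"
    "\<not> bval delta_copy_test s'"
    "t \<le> (bcost delta_copy + tcost delta_copy_test + 2) * (2 ^ d - var s vm + 1)"
  moreover from this have "var s' vm = 2 ^ d" by auto
  ultimately show "tabulated c s' \<and> grown c (2 ^ Suc d) s' \<and> var s' ve = 2 ^ d \<and>
    var s' vd = d \<and> var s' vrc = c * num I \<and> t \<le> delta_copy_cost * (2 ^ d + 1)"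
    using assms(6) unfolding delta_copy_cost_def[symmetric] by (simp add: mult_2)
qed

text \<open>The factor 2 covers the failing test of the copy loop, since \<open>2 ^ d + 1\<close> is
  at most \<open>2 * 2 ^ d\<close>.\<close>

definition "delta_iter_cost = tcost delta_test + 2 + bcost delta_pair +
  bcost delta_next + 2 * delta_copy_cost"

text \<open>Iteration \<open>d\<close> costs a multiple of \<open>2 ^ d\<close>, which is exactly
  the drop of the potential. In this way the geometric series is summed for both nested loops, and
  tabulating takes O(2^q) steps in all.\<close>

lemma power_potential: "d < c \<Longrightarrow> (A::nat) * (2 ^ c - 2 ^ d) = A * 2 ^ d + A * (2 ^ c - 2 ^ Suc d)"
proof -
  assume "d < c"
  then have "(2::nat) ^ Suc d \<le> 2 ^ c" by (intro power_increasing) auto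
  then have "(2::nat) ^ c - 2 ^ d = 2 ^ d + (2 ^ c - 2 ^ Suc d)" by simp
  then show ?thesis by (metis add_mult_distrib2)
qed

abbreviation (input) delta_inv :: "nat \<Rightarrow> store \<Rightarrow> bool" where
  "delta_inv c s \<equiv> tabulated c s \<and> grown c (2 ^ var s vd) s \<and> var s ve = 2 ^ var s vd \<and>
      var s vd \<le> c \<and> var s vrc = c * num I"

lemma delta_ht:
  assumes "tabulated c s" "grown c 1 s" "var s ve = 1" "var s vd = 0" "var s vrc = c * num I" "c < num I"
  shows "ht s delta_loop (\<lambda>t s'. tabulated c s' \<and> grown c (2 ^ c) s' \<and>
    t \<le> delta_iter_cost * 2 ^ c + (tcost delta_test + 2))"
  unfolding delta_loop_def
proof (rule ht_while_conseq[where P = "\<lambda>s. delta_inv c s" and \<Phi> = "\<lambda>s. delta_iter_cost * (2 ^ c - 2 ^ var s vd)"])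
  show "delta_inv c s" using assms by simp
next
  fix s assume inv: "delta_inv c s" and b: "bval delta_test s"
  define d where "d = var s vd"
  define s1 where "s1 = fold atom_sem delta_pair s"
  have d: "d < c" using inv b by (simp add: d_def tabulated_def)
  have row: "array I s Row d = d * num I"
    using inv rows d assms(6) by (simp add: tabulated_def rows_def)
  have s1: "tabulated c s1" "grown c (2 ^ d) s1" "var s1 ve = 2 ^ d" "var s1 vd = d" "var s1 vrc = c * num I"
    "var s1 vm = 0" "wvar s1 6 = quad_of I s0 c d + quad_of I s0 d c"
    using inv row unfolding s1_def delta_pair_def
    by (simp_all add: tabulated_def grown_def d_def[symmetric] quad_of_def)
  show "ht s (Block delta_pair ;; delta_copy_loop ;; Block delta_next)
    (\<lambda>t s'. (delta_inv c s') \<and>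
      tcost delta_test + 2 + t + delta_iter_cost * (2 ^ c - 2 ^ var s' vd)
      \<le> delta_iter_cost * (2 ^ c - 2 ^ var s vd))"
  proof (rule ht_seq, rule ht_block, fold s1_def, rule ht_seq, rule ht_conseq[OF delta_copy_ht[OF s1]])
    fix t s2 assume s2: "tabulated c s2 \<and> grown c (2 ^ Suc d) s2 \<and> var s2 ve = 2 ^ d \<and>
      var s2 vd = d \<and> var s2 vrc = c * num I \<and> t \<le> delta_copy_cost * (2 ^ d + 1)"
    define s' where "s' = fold atom_sem delta_next s2"
    have s': "tabulated c s'" "grown c (2 ^ Suc d) s'" "var s' ve = 2 ^ Suc d" "var s' vd = Suc d"
      "var s' vrc = c * num I"
      using s2 unfolding s'_def delta_next_def by (simp_all add: tabulated_def grown_def)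
    define X where "X = tcost delta_test + 2 + bcost delta_pair + bcost delta_next"
    have "X + delta_copy_cost * (2 ^ d + 1) \<le> delta_iter_cost * 2 ^ d"
    proof -
      have "X + delta_copy_cost \<le> X * 2 ^ d + delta_copy_cost * 2 ^ d" by (intro add_mono) simp_all
      then show ?thesis
        unfolding delta_iter_cost_def X_def[symmetric] by (simp add: algebra_simps)
    qed
    then have "tcost delta_test + 2 + (bcost delta_pair + (t + bcost delta_next)) +
      delta_iter_cost * (2 ^ c - 2 ^ Suc d) \<le> delta_iter_cost * (2 ^ c - 2 ^ d)"
      using s2 X_def unfolding power_potential[OF d] by linarith
    then show "ht s2 (Block delta_next) (\<lambda>t' s'. (delta_inv c s') \<and>
        tcost delta_test + 2 + (bcost delta_pair + (t + t')) +
          delta_iter_cost * (2 ^ c - 2 ^ var s' vd) \<le> delta_iter_cost * (2 ^ c - 2 ^ var s vd))"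
      using s' d by (intro ht_block, fold s'_def d_def) (simp only: s', simp)
  qed
next
  fix t s' assume "delta_inv c s'" "\<not> bval delta_test s'"
    and t: "t + delta_iter_cost * (2 ^ c - 2 ^ var s' vd) \<le> delta_iter_cost * (2 ^ c - 2 ^ var s vd) +
      (tcost delta_test + 2)"
  moreover from this have "var s' vd = c" by (auto simp: tabulated_def)
  moreover have "delta_iter_cost * (2 ^ c - 2 ^ var s vd) \<le> delta_iter_cost * 2 ^ c" by simp
  then have "t \<le> delta_iter_cost * 2 ^ c + (tcost delta_test + 2)" using t by linarith
  ultimately show "tabulated c s' \<and> grown c (2 ^ c) s' \<and>
    t \<le> delta_iter_cost * 2 ^ c + (tcost delta_test + 2)" by simp
qed

definition "total_copy_cost = bcost total_copy + tcost total_test + 2"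

abbreviation (input) total_copy_inv :: "nat \<Rightarrow> store \<Rightarrow> bool" where
  "total_copy_inv c s \<equiv> tabulated c s \<and> grown c (2 ^ c) s \<and>
      (\<forall>m<2 ^ c + var s vm. warray I s Total m = total m) \<and> var s vm \<le> 2 ^ c"

lemma total_copy_ht:
  assumes "tabulated c s" "grown c (2 ^ c) s" "var s vm = 0"
  shows "ht s total_copy_loop (\<lambda>t s'. tabulated c s' \<and> (\<forall>m<2 ^ Suc c. warray I s' Total m = total m) \<and>
    t \<le> total_copy_cost * (2 ^ c + 1))"
  unfolding total_copy_loop_def
proof (rule ht_while_measure[where P = "\<lambda>s. total_copy_inv c s"
    and A = "bcost total_copy" and \<mu> = "\<lambda>s. 2 ^ c - var s vm"])
  show "total_copy_inv c s"
    using assms by (simp add: tabulated_def)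
next
  fix s assume inv: "total_copy_inv c s"
    and b: "bval total_test s"
  define m where "m = var s vm"
  define s' where "s' = fold atom_sem total_copy s"
  have m: "m < 2 ^ c" using inv b by (simp add: m_def tabulated_def)
  have tm: "warray I s Total m = total m" "warray I s Delta m = grow c m"
    using inv m by (auto simp: m_def grown_def)
  have s': "tabulated c s'" "grown c (2 ^ c) s'" "var s' vm = m + 1"
    "warray I s' Total = (warray I s Total)(2 ^ c + m := total (2 ^ c + m))"
    using inv tm total_add[OF m] unfolding s'_def total_copy_def
    by (simp_all add: tabulated_def grown_def m_def[symmetric])
  then have "\<forall>k<2 ^ c + (m + 1). warray I s' Total k = total k"
    using inv by (auto simp: m_def[symmetric] less_Suc_eq)
  then show "ht s (Block total_copy) (\<lambda>t s'. (total_copy_inv c s') \<and>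
      t \<le> bcost total_copy \<and> 2 ^ c - var s' vm < 2 ^ c - var s vm)"
    using s' m by (intro ht_block, fold s'_def m_def) auto
next
  fix t s' assume "total_copy_inv c s'"
    "\<not> bval total_test s'"
    "t \<le> (bcost total_copy + tcost total_test + 2) * (2 ^ c - var s vm + 1)"
  moreover from this have "var s' vm = 2 ^ c" by (auto simp: tabulated_def)
  ultimately show "tabulated c s' \<and> (\<forall>m<2 ^ Suc c. warray I s' Total m = total m) \<and>
    t \<le> total_copy_cost * (2 ^ c + 1)"
    using assms(3) unfolding total_copy_cost_def[symmetric] by (simp add: mult_2)
qed

definition "tables_iter_cost = tcost tables_test + 2 + bcost delta_start +
  (tcost delta_test + 2) + bcost [Assign vm (N 0)] + bcost total_next +
  delta_iter_cost + 2 * total_copy_cost"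

definition "tables_cost = bcost tables_init +
  tcost tables_test + 2 + tables_iter_cost"

abbreviation (input) tables_inv :: "store \<Rightarrow> bool" where
  "tables_inv s \<equiv> tabulated (var s vc) s \<and> var s vc \<le> var s0 vq"

lemma tables_ht:
  assumes n: "var s0 0 = num I"
  shows "ht s0 tables_prog (\<lambda>t s'. tabulated (var s0 vq) s' \<and> t \<le> tables_cost * 2 ^ var s0 vq)"
  unfolding tables_prog_def
proof (rule ht_seq, rule ht_block, rule ht_while_conseq[where
    P = "\<lambda>s. tables_inv s"
    and \<Phi> = "\<lambda>s. tables_iter_cost * (2 ^ var s0 vq - 2 ^ var s vc)"])
  let ?s = "fold atom_sem tables_init s0"
  show "tables_inv ?s"
    using n by (simp add: tabulated_def total_def quad_def)
  {
    fix s assume inv: "tables_inv s"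
      and b: "bval tables_test s"
    define c where "c = var s vc"
    define s1 where "s1 = fold atom_sem delta_start s"
    have tab: "tabulated c s" using inv by (simp add: c_def)
    have c: "c < var s0 vq" using tab b by (simp add: c_def tabulated_def)
    have cn: "c < num I" using c q by simp
    have row: "array I s Row c = c * num I" using tab rows cn by (simp add: tabulated_def rows_def)
    have s1: "tabulated c s1" "grown c 1 s1" "var s1 ve = 1" "var s1 vd = 0" "var s1 vrc = c * num I"
      using tab row unfolding s1_def delta_start_def
      by (simp_all add: tabulated_def grown_def grow_def delta_def quad_of_def)
    show "ht s (Block delta_start ;; delta_loop ;; Block [Assign vm (N 0)] ;; total_copy_loop ;; Block total_next)
      (\<lambda>t s'. tables_inv s' \<and>
        tcost tables_test + 2 + t + tables_iter_cost * (2 ^ var s0 vq - 2 ^ var s' vc)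
        \<le> tables_iter_cost * (2 ^ var s0 vq - 2 ^ var s vc))"
    proof (rule ht_seq, rule ht_block, fold s1_def, rule ht_seq, rule ht_conseq[OF delta_ht[OF s1 cn]],
        rule ht_seq, rule ht_block)
      fix t1 s2 assume s2: "tabulated c s2 \<and> grown c (2 ^ c) s2 \<and>
        t1 \<le> delta_iter_cost * 2 ^ c + (tcost delta_test + 2)"
      define s3 where "s3 = fold atom_sem [Assign vm (N 0)] s2"
      have s3: "tabulated c s3" "grown c (2 ^ c) s3" "var s3 vm = 0"
        using s2 by (simp_all add: s3_def tabulated_def grown_def)
      show "ht (fold atom_sem [Assign vm (N 0)] s2) (total_copy_loop ;; Block total_next)
        (\<lambda>t' s'. tables_inv s' \<and>
          tcost tables_test + 2 +
          (bcost delta_start + (t1 + (bcost [Assign vm (N 0)] + t'))) +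
            tables_iter_cost * (2 ^ var s0 vq - 2 ^ var s' vc)
          \<le> tables_iter_cost * (2 ^ var s0 vq - 2 ^ var s vc))"
      proof (fold s3_def, rule ht_seq, rule ht_conseq[OF total_copy_ht[OF s3]])
        fix t2 s4 assume s4: "tabulated c s4 \<and> (\<forall>m<2 ^ Suc c. warray I s4 Total m = total m) \<and>
          t2 \<le> total_copy_cost * (2 ^ c + 1)"
        define s' where "s' = fold atom_sem total_next s4"
        have s': "tabulated (Suc c) s'" "var s' vc = Suc c"
          using s4 unfolding s'_def total_next_def by (auto simp: tabulated_def less_Suc_eq)
        define X where "X = tcost tables_test + 2 + bcost delta_start +
          (tcost delta_test + 2) + bcost [Assign vm (N 0)] + bcost total_next"
        have "X + delta_iter_cost * 2 ^ c + total_copy_cost * (2 ^ c + 1) \<le> tables_iter_cost * 2 ^ c"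
        proof -
          have "X + total_copy_cost \<le> X * 2 ^ c + total_copy_cost * 2 ^ c" by (intro add_mono) simp_all
          then show ?thesis
            unfolding tables_iter_cost_def X_def[symmetric] by (simp add: algebra_simps)
        qed
        then have "tcost tables_test + 2 + (bcost delta_start + (t1 +
            (bcost [Assign vm (N 0)] + (t2 + bcost total_next)))) +
            tables_iter_cost * (2 ^ var s0 vq - 2 ^ Suc c) \<le> tables_iter_cost * (2 ^ var s0 vq - 2 ^ c)"
          using s2 s4 X_def unfolding power_potential[OF c] by linarith
        then show "ht s4 (Block total_next) (\<lambda>t' s'. tables_inv s' \<and>
          tcost tables_test + 2 + (bcost delta_start + (t1 +
            (bcost [Assign vm (N 0)] + (t2 + t')))) + tables_iter_cost * (2 ^ var s0 vq - 2 ^ var s' vc)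
          \<le> tables_iter_cost * (2 ^ var s0 vq - 2 ^ var s vc))"
          using s' c by (intro ht_block, fold s'_def c_def) (simp only: s', simp)
      qed
    qed
  next
    fix t s' assume inv: "tables_inv s'"
      "\<not> bval tables_test s'"
      and t: "t + tables_iter_cost * (2 ^ var s0 vq - 2 ^ var s' vc) \<le>
        tables_iter_cost * (2 ^ var s0 vq - 2 ^ var ?s vc) + (tcost tables_test + 2)"
    have "var s' vc = var s0 vq" using inv by (auto simp: tabulated_def)
    moreover
    define X where "X = bcost tables_init +
      tcost tables_test + 2"
    have "tables_iter_cost * (2 ^ var s0 vq - 2 ^ var ?s vc) \<le> tables_iter_cost * 2 ^ var s0 vq" by simp
    moreover have eq: "tables_cost * 2 ^ var s0 vq = X * 2 ^ var s0 vq + tables_iter_cost * 2 ^ var s0 vq"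
      by (simp only: tables_cost_def X_def add_mult_distrib)
    moreover have "X * 1 \<le> X * 2 ^ var s0 vq" by (intro mult_le_mono2) simp
    ultimately have "bcost tables_init + t
        \<le> tables_cost * 2 ^ var s0 vq"
      using t X_def eq by linarith
    then show "tabulated (var s0 vq) s' \<and>
      bcost tables_init + t \<le> tables_cost * 2 ^ var s0 vq"
      using inv \<open>var s' vc = var s0 vq\<close> by simp
  }
qed

end


section \<open>Selecting and decoding an optimal choice\<close>

abbreviation (input) "argmin_test \<equiv> WLe (WV 6) (WArr Total (V vm))"
abbreviation (input) "argmin_init \<equiv> [Assign vb (N 0), Assign vm (N 1), WAssign 6 (WArr Total (N 0))]"
abbreviation (input) "argmin_take \<equiv> [Assign vb (V vm), WAssign 6 (WArr Total (V vm))]"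
abbreviation (input) "bit_test \<equiv> Le (N 1) (Arr Bit (Arr Cyc (V vi)))"
abbreviation (input) "decode_bit \<equiv> [Assign vb (Minus (V vb) (Arr Pow (V vc))), Put (Adr Bit (V vc)) (N 1)]"
abbreviation (input) "decode_test \<equiv> Le (Arr Pow (V vc)) (V vb)"
abbreviation (input) "prev_cycle \<equiv> [Assign vc (Minus (V vc) (N 1))]"

definition "argmin_update =
  If argmin_test (Block []) (Block argmin_take) ;;
  Block [Assign vm (Plus (V vm) (N 1))]"

definition "argmin_prog =
  Block argmin_init ;;
  While total_test argmin_update"

definition "decode_step =
  Block prev_cycle ;;
  If decode_test
    (Block decode_bit) (Block [])"

definition "decode_prog = While (Le (N 1) (V vc)) decode_step"

definition "output_step =
  If bit_test
    (Block [Put (V vi) (Arr Opt1 (V vi))]) (Block [Put (V vi) (Arr Opt0 (V vi))]) ;;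
  Block step_pos"

definition "output_prog =
  Block [Assign vi (N 1)] ;;
  While pos_test output_step"

context tables
begin

definition "argmin_step_cost = tcost argmin_test + 2 + bcost [] +
  bcost argmin_take + bcost [Assign vm (Plus (V vm) (N 1))]"

definition "argmin_cost = bcost argmin_init +
  (argmin_step_cost + tcost total_test + 2)"

definition argmin_inv :: "nat \<Rightarrow> nat \<Rightarrow> store \<Rightarrow> bool" where
  "argmin_inv c m s \<longleftrightarrow> tabulated c s \<and> var s vb < 2 ^ c \<and> wvar s 6 = total (var s vb) \<and>
     (\<forall>k<m. total (var s vb) \<le> total k)"

lemma argmin_update_ht:
  assumes inv: "argmin_inv c m s" and m: "var s vm = m" "m < 2 ^ c"
  shows "ht s argmin_update (\<lambda>t s'. argmin_inv c (m + 1) s' \<and> var s' vm = m + 1 \<and> t \<le> argmin_step_cost)"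
  unfolding argmin_update_def
proof (rule ht_seq, rule ht_if)
  have tab: "var s 0 = num I" "warray I s Total m = total m"
    using inv m by (auto simp: argmin_inv_def tabulated_def)
  {
    assume "bval argmin_test s"
    then have le: "total (var s vb) \<le> total m" using inv m tab by (simp add: argmin_inv_def)
    define s' where "s' = fold atom_sem [Assign vm (Plus (V vm) (N 1))] s"
    have "argmin_inv c (m + 1) s'" "var s' vm = m + 1"
      using inv le m by (auto simp: s'_def argmin_inv_def tabulated_def less_Suc_eq)
    then show "ht s (Block []) (\<lambda>t s'. ht s' (Block [Assign vm (Plus (V vm) (N 1))])
      (\<lambda>t' s'. argmin_inv c (m + 1) s' \<and> var s' vm = m + 1 \<and>
        tcost argmin_test + 1 + t + t' \<le> argmin_step_cost))"
      by (intro ht_block) (simp only: fold_simps(1) id_apply, fold s'_def, simp add: argmin_step_cost_def)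
  next
    assume "\<not> bval argmin_test s"
    then have lt: "total m < total (var s vb)" using inv m tab by (simp add: argmin_inv_def)
    define s1 where "s1 = fold atom_sem argmin_take s"
    define s' where "s' = fold atom_sem [Assign vm (Plus (V vm) (N 1))] s1"
    have "argmin_inv c (m + 1) s'" "var s' vm = m + 1"
      using inv lt m tab by (fastforce simp: s'_def s1_def argmin_inv_def tabulated_def less_Suc_eq)+
    then show "ht s (Block argmin_take)
      (\<lambda>t s'. ht s' (Block [Assign vm (Plus (V vm) (N 1))])
      (\<lambda>t' s'. argmin_inv c (m + 1) s' \<and> var s' vm = m + 1 \<and>
        tcost argmin_test + 1 + (t + 1) + t' \<le> argmin_step_cost))"
      by (intro ht_block, fold s1_def, fold s'_def) (simp add: argmin_step_cost_def)
  }
qed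

lemma argmin_ht:
  assumes "tabulated c s"
  shows "ht s argmin_prog (\<lambda>t s'. tabulated c s' \<and> var s' vb < 2 ^ c \<and>
    (\<forall>m<2 ^ c. total (var s' vb) \<le> total m) \<and> t \<le> argmin_cost * (2 ^ c + 1))"
  unfolding argmin_prog_def
proof (rule ht_seq, rule ht_block, rule ht_while_measure[where
    P = "\<lambda>s. argmin_inv c (var s vm) s \<and> var s vm \<le> 2 ^ c" and
    A = argmin_step_cost and \<mu> = "\<lambda>s. 2 ^ c - var s vm"])
  let ?s = "fold atom_sem argmin_init s"
  show "argmin_inv c (var ?s vm) ?s \<and> var ?s vm \<le> 2 ^ c"
    using assms by (simp add: argmin_inv_def tabulated_def)
next
  fix s assume inv: "argmin_inv c (var s vm) s \<and> var s vm \<le> 2 ^ c"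
    and b: "bval total_test s"
  have m: "var s vm < 2 ^ c" using inv b by (simp add: argmin_inv_def tabulated_def)
  show "ht s argmin_update (\<lambda>t s'. (argmin_inv c (var s' vm) s' \<and> var s' vm \<le> 2 ^ c) \<and>
      t \<le> argmin_step_cost \<and> 2 ^ c - var s' vm < 2 ^ c - var s vm)"
    by (rule ht_conseq[OF argmin_update_ht[of c "var s vm" s]]) (use inv m in auto)
next
  fix t s'
  let ?s = "fold atom_sem argmin_init s"
  assume inv: "argmin_inv c (var s' vm) s' \<and> var s' vm \<le> 2 ^ c" "\<not> bval total_test s'"
    and t: "t \<le> (argmin_step_cost + tcost total_test + 2) * (2 ^ c - var ?s vm + 1)"
  have "var s' vm = 2 ^ c" using inv by (auto simp: argmin_inv_def tabulated_def)
  moreover have "t \<le> (argmin_step_cost + tcost total_test + 2) * (2 ^ c + 1)"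
    using t by (rule order_trans) (intro mult_le_mono2, simp)
  then have "bcost argmin_init + t
      \<le> argmin_cost * (2 ^ c + 1)"
    unfolding argmin_cost_def add_mult_distrib[of "bcost _"] by (rule add_le_mono[rotated]) simp
  ultimately show "tabulated c s' \<and> var s' vb < 2 ^ c \<and> (\<forall>m<2 ^ c. total (var s' vb) \<le> total m) \<and>
    bcost argmin_init + t \<le> argmin_cost * (2 ^ c + 1)"
    using inv by (simp add: argmin_inv_def)
qed

end

section \<open>Decoding and output\<close>

definition bits :: "tspvr \<Rightarrow> store \<Rightarrow> nat set" where
  "bits I s = {x. array I s Bit x \<noteq> 0}"

definition same_choices :: "tspvr \<Rightarrow> store \<Rightarrow> store \<Rightarrow> bool" where
  "same_choices I s0 s \<longleftrightarrow> var s 0 = num I \<and> (\<forall>k\<in>{Opt0, Opt1, Cyc}. array I s k = array I s0 k)"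

definition "decode_step_cost = bcost prev_cycle +
  tcost decode_test + 2 + bcost [] +
  bcost decode_bit"

definition "decode_cost = decode_step_cost + tcost (Le (N 1) (V vc)) + 2"

text \<open>This is the greedy binary expansion from the top: \<open>vb\<close> keeps the part below
  \<open>2 ^ c\<close>, and the bits from \<open>c\<close> on have been moved to \<open>Bit\<close>,
  where a membership test takes constant time.\<close>

definition decode_inv :: "tspvr \<Rightarrow> store \<Rightarrow> nat \<Rightarrow> nat \<Rightarrow> nat \<Rightarrow> store \<Rightarrow> bool" where
  "decode_inv I s0 q m c s \<longleftrightarrow> same_choices I s0 s \<and> var s vc = c \<and> c \<le> q \<and> (\<forall>d<q. array I s Pow d = 2 ^ d) \<and>
     var s vb < 2 ^ c \<and> bits I s \<subseteq> {c..} \<and> set_decode m = set_decode (var s vb) \<union> bits I s"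

lemma decode_step_ht:
  assumes inv: "decode_inv I s0 q m (Suc c) s"
  shows "ht s decode_step (\<lambda>t s'. decode_inv I s0 q m c s' \<and> t \<le> decode_step_cost)"
  unfolding decode_step_def
proof (rule ht_seq, rule ht_block)
  define s1 where "s1 = fold atom_sem prev_cycle s"
  have s1: "same_choices I s0 s1" "var s1 vc = c" "Suc c \<le> q" "\<forall>d<q. array I s1 Pow d = 2 ^ d"
    "var s1 vb < 2 ^ Suc c" "bits I s1 \<subseteq> {Suc c..}" "set_decode m = set_decode (var s1 vb) \<union> bits I s1"
    using inv by (auto simp: s1_def decode_inv_def same_choices_def bits_def)
  have s0: "var s1 0 = num I" "array I s1 Pow c = 2 ^ c" using s1 by (auto simp: same_choices_def)
  show "ht (fold atom_sem prev_cycle s) (If decode_test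
    (Block decode_bit) (Block []))
    (\<lambda>t' s'. decode_inv I s0 q m c s' \<and> bcost prev_cycle + t' \<le> decode_step_cost)"
  proof (fold s1_def, rule ht_if)
    assume "bval decode_test s1"
    then have le: "2 ^ c \<le> var s1 vb" using s0 s1 by simp
    define s' where "s' = fold atom_sem decode_bit s1"
    define k where "k = var s1 vb - 2 ^ c"
    have k: "k < 2 ^ c" "var s1 vb = 2 ^ c + k" using s1(5) le by (auto simp: k_def)
    have s': "same_choices I s0 s'" "var s' vc = c" "\<forall>d<q. array I s' Pow d = 2 ^ d" "var s' vb = k"
      "array I s' Bit = (array I s1 Bit)(c := 1)"
      using s1 s0 by (auto simp: s'_def same_choices_def k_def)
    have "bits I s' = insert c (bits I s1)" using s'(5) by (auto simp: bits_def)
    then have "decode_inv I s0 q m c s'"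
      using s' s1 k set_decode_add(1)[OF k(1)] by (auto simp: decode_inv_def)
    then show "ht s1 (Block decode_bit)
      (\<lambda>t s'. decode_inv I s0 q m c s' \<and> bcost prev_cycle +
        (tcost decode_test + 1 + t) \<le> decode_step_cost)"
      by (intro ht_block, fold s'_def) (simp add: decode_step_cost_def)
  next
    assume "\<not> bval decode_test s1"
    then have "var s1 vb < 2 ^ c" using s0 s1 by simp
    then have "decode_inv I s0 q m c s1" using s1 by (auto simp: decode_inv_def)
    then show "ht s1 (Block []) (\<lambda>t s'. decode_inv I s0 q m c s' \<and> bcost prev_cycle +
        (tcost decode_test + 1 + (t + 1)) \<le> decode_step_cost)"
      by (intro ht_block) (simp add: decode_step_cost_def)
  qed
qed

lemma decode_ht:
  assumes "decode_inv I s0 q m q s"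
  shows "ht s decode_prog (\<lambda>t s'. same_choices I s0 s' \<and> bits I s' = set_decode m \<and> t \<le> decode_cost * (q + 1))"
  unfolding decode_prog_def
proof (rule ht_while_measure[where P = "\<lambda>s. decode_inv I s0 q m (var s vc) s" and A = decode_step_cost
    and \<mu> = "\<lambda>s. var s vc"])
  show "decode_inv I s0 q m (var s vc) s" using assms by (simp add: decode_inv_def)
next
  fix s assume inv: "decode_inv I s0 q m (var s vc) s" and "bval (Le (N 1) (V vc)) s"
  then obtain c where c: "var s vc = Suc c" by (cases "var s vc") auto
  show "ht s decode_step (\<lambda>t s'. decode_inv I s0 q m (var s' vc) s' \<and> t \<le> decode_step_cost \<and> var s' vc < var s vc)"
    by (rule ht_conseq[OF decode_step_ht[of I s0 q m c s]]) (use inv c in \<open>auto simp: decode_inv_def\<close>)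
next
  fix t s' assume inv: "decode_inv I s0 q m (var s' vc) s'" and "\<not> bval (Le (N 1) (V vc)) s'"
    and t: "t \<le> (decode_step_cost + tcost (Le (N 1) (V vc)) + 2) * (var s vc + 1)"
  then have "var s' vc = 0" by simp
  then have "var s' vb = 0" using inv by (simp add: decode_inv_def)
  then have "set_decode (var s' vb) = {}" by simp
  then show "same_choices I s0 s' \<and> bits I s' = set_decode m \<and> t \<le> decode_cost * (q + 1)"
    using inv t assms by (simp add: decode_inv_def decode_cost_def)
qed

definition "output_step_cost = tcost bit_test + 2 +
  bcost [Put (V vi) (Arr Opt1 (V vi))] + bcost [Put (V vi) (Arr Opt0 (V vi))] +
  bcost step_pos"

definition "output_cost = bcost [Assign vi (N 1)] + (output_step_cost + tcost pos_test + 2)"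

text \<open>Writing the result to the addresses \<open>1\<close> to \<open>n\<close> destroys
  requisitions, but the arrays begin beyond address \<open>2 * n\<close>, so all data that the
  result depends on stay intact.\<close>

definition output_inv :: "tspvr \<Rightarrow> store \<Rightarrow> nat \<Rightarrow> store \<Rightarrow> bool" where
  "output_inv I s0 i s \<longleftrightarrow> same_choices I s0 s \<and> array I s Bit = array I s0 Bit \<and> var s vi = i \<and>
     1 \<le> i \<and> i \<le> num I + 1 \<and>
     (\<forall>j\<in>{1..<i}. imem s j = (if array I s0 Cyc j \<in> bits I s0 then array I s0 Opt1 j else array I s0 Opt0 j))"

lemma output_step_ht:
  assumes inv: "output_inv I s0 i s" and i: "i \<le> num I"
  shows "ht s output_step (\<lambda>t s'. output_inv I s0 (i + 1) s' \<and> t \<le> output_step_cost)"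
  unfolding output_step_def
proof (rule ht_seq, rule ht_if)
  have a: "var s 0 = num I" "array I s Opt0 = array I s0 Opt0" "array I s Opt1 = array I s0 Opt1"
    "array I s Cyc = array I s0 Cyc" "array I s Bit = array I s0 Bit" "var s vi = i"
    using inv by (auto simp: output_inv_def same_choices_def)
  have test: "bval bit_test s \<longleftrightarrow> array I s0 Cyc i \<in> bits I s0"
    using a by (auto simp: bits_def)
  {
    assume b: "bval bit_test s"
    define s' where "s' = fold atom_sem [Put (V vi) (Arr Opt1 (V vi)), Assign vi (Plus (V vi) (N 1))] s"
    have "output_inv I s0 (i + 1) s'"
      using inv i b[unfolded test] a
      by (auto simp: s'_def output_inv_def same_choices_def less_Suc_eq)
    moreover have "s' = fold atom_sem step_pos (fold atom_sem [Put (V vi) (Arr Opt1 (V vi))] s)"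
      by (simp add: s'_def)
    ultimately show "ht s (Block [Put (V vi) (Arr Opt1 (V vi))]) (\<lambda>t s'. ht s' (Block step_pos)
      (\<lambda>t' s'. output_inv I s0 (i + 1) s' \<and> tcost bit_test + 1 + t + t' \<le> output_step_cost))"
      by (intro ht_block) (simp only: output_step_cost_def, simp)
  next
    assume b: "\<not> bval bit_test s"
    define s' where "s' = fold atom_sem [Put (V vi) (Arr Opt0 (V vi)), Assign vi (Plus (V vi) (N 1))] s"
    have "output_inv I s0 (i + 1) s'"
      using inv i b[unfolded test] a
      by (auto simp: s'_def output_inv_def same_choices_def less_Suc_eq)
    moreover have "s' = fold atom_sem step_pos (fold atom_sem [Put (V vi) (Arr Opt0 (V vi))] s)"
      by (simp add: s'_def)
    ultimately show "ht s (Block [Put (V vi) (Arr Opt0 (V vi))]) (\<lambda>t s'. ht s' (Block step_pos)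
      (\<lambda>t' s'. output_inv I s0 (i + 1) s' \<and> tcost bit_test + 1 + (t + 1) + t' \<le> output_step_cost))"
      by (intro ht_block) (simp only: output_step_cost_def, simp)
  }
qed

lemma output_ht:
  assumes "var s0 0 = num I"
  shows "ht s0 output_prog (\<lambda>t s'. (\<forall>j\<in>{1..num I}. imem s' j =
      (if array I s0 Cyc j \<in> bits I s0 then array I s0 Opt1 j else array I s0 Opt0 j)) \<and>
    t \<le> output_cost * (num I + 1))"
  unfolding output_prog_def
proof (rule ht_seq, rule ht_block, rule ht_while_measure[where P = "\<lambda>s. output_inv I s0 (var s vi) s"
    and A = output_step_cost and \<mu> = "\<lambda>s. num I + 1 - var s vi"])
  show "output_inv I s0 (var (fold atom_sem [Assign vi (N 1)] s0) vi) (fold atom_sem [Assign vi (N 1)] s0)"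
    using assms by (simp add: output_inv_def same_choices_def)
next
  fix s assume inv: "output_inv I s0 (var s vi) s" and b: "bval pos_test s"
  have i: "var s vi \<le> num I" using inv b by (simp add: output_inv_def same_choices_def)
  show "ht s output_step (\<lambda>t s'. output_inv I s0 (var s' vi) s' \<and> t \<le> output_step_cost \<and>
      num I + 1 - var s' vi < num I + 1 - var s vi)"
    by (rule ht_conseq[OF output_step_ht[OF inv i]]) (use i in \<open>auto simp: output_inv_def\<close>)
next
  fix t s'
  let ?s = "fold atom_sem [Assign vi (N 1)] s0"
  assume inv: "output_inv I s0 (var s' vi) s'" "\<not> bval pos_test s'"
    and t: "t \<le> (output_step_cost + tcost pos_test + 2) * (num I + 1 - var ?s vi + 1)"
  have "var s' vi = num I + 1" using inv by (auto simp: output_inv_def same_choices_def)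
  moreover have "t \<le> (output_step_cost + tcost pos_test + 2) * (num I + 1)"
    using t by (rule order_trans) (intro mult_le_mono2, simp)
  then have "bcost [Assign vi (N 1)] + t \<le> output_cost * (num I + 1)"
    unfolding output_cost_def add_mult_distrib[of "bcost _"] by (rule add_le_mono[rotated]) simp
  ultimately show "(\<forall>j\<in>{1..num I}. imem s' j =
      (if array I s0 Cyc j \<in> bits I s0 then array I s0 Opt1 j else array I s0 Opt0 j)) \<and>
    bcost [Assign vi (N 1)] + t \<le> output_cost * (num I + 1)"
    using inv by (auto simp: output_inv_def)
qed

section \<open>The complete algorithm\<close>

definition "algorithm = count_prog ;; peel_prog ;; cycles_prog ;; weights_prog ;; tables_prog ;;
  argmin_prog ;; decode_prog ;; output_prog"

definition "linear_cost = count_cost + peel_total_cost + cycles_cost + weights_cost + output_cost"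

text \<open>Every phase is bounded by a constant times \<open>n + 1\<close>, \<open>2 ^ q\<close>,
  \<open>2 ^ q + 1\<close> or \<open>q + 1\<close>, and each of these is at most twice the time
  scale.\<close>

definition "algorithm_cost = 2 * (linear_cost + tables.tables_cost + tables.argmin_cost + decode_cost)"

lemma algorithm_ok: "com_ok algorithm"
  by (simp add: algorithm_def count_prog_def count_body_def peel_prog_def peel_body_def peel_test_def
      cycles_prog_def walk_body_def weights_prog_def index_body_def entries_body_def tables_prog_def
      delta_loop_def delta_copy_loop_def total_copy_loop_def delta_start_def delta_pair_def delta_copy_def
      delta_next_def total_copy_def total_next_def argmin_prog_def argmin_update_def decode_prog_def
      decode_step_def output_prog_def output_step_def)


abbreviation (input) time_scale :: "tspvr \<Rightarrow> nat" where
  "time_scale I \<equiv> num_cycles I * 2 ^ num_cycles I + num I"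

lemma (in feasible_instance) algorithm_ht:
  assumes n: "2 \<le> num I"
  shows "ht (start I) algorithm (\<lambda>t s. optimal I (restrict (imem s) {1..num I}) \<and>
    t \<le> algorithm_cost * time_scale I)"
  unfolding algorithm_def
proof (rule ht_seq, rule ht_conseq[OF count_ht], rule ht_seq, rule ht_conseq[OF peel_ht], goal_cases)
  case (8 t1 s1 t2 s2)
  define U where "U = open_positions I (array I s2 Opt0)"
  have s2: "peeling s2" "\<And>x. x \<in> {1..num I} \<Longrightarrow> array I s2 Deg x \<noteq> 1" using 8 by auto
  then have peel: "peel_inv (array I s2 Opt0) (array I s2 Opt1) (array I s2 Deg) (array I s2 Sum)"
    and fr: "frame I s2" "rows I s2 (num I)" "array I s2 Cyc = (\<lambda>_. 0)"
    by (simp_all add: peeling_def)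
  interpret two_regular I U
    using peeled_two_regular[OF peel s2(2)] by unfold_locales (auto simp: U_def open_positions_def)
  have walk: "walking s2" unfolding walking_def using fr peel by (simp add: peel_inv_def U_def)
  have cyc: "cycles_inv 0 (array I s2 Opt0) (array I s2 Opt1) (array I s2 Cyc)"
    using peeled_cycles_inv[OF peel U_def] fr(3) n by simp
  show ?case
  proof (rule ht_seq, rule ht_conseq[OF cycles_ht[OF walk cyc]])
    fix t3 s3
    assume s3: "frame I s3 \<and> rows I s3 (num I) \<and>
      cycle_structure I (var s3 vq) (array I s3 Opt0) (array I s3 Opt1) (array I s3 Cyc) \<and>
      (\<forall>i\<in>{1..num I}. array I s3 Cyc i < num I) \<and> var s3 vq \<le> num I \<and> t3 \<le> cycles_cost * (num I + 1)"
    define q where "q = var s3 vq"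
    interpret cs: cycle_structure I q "array I s3 Opt0" "array I s3 Opt1" "array I s3 Cyc"
      using s3 by (simp add: q_def)
    show "ht s3 (weights_prog ;; tables_prog ;; argmin_prog ;; decode_prog ;; output_prog)
      (\<lambda>t s. optimal I (restrict (imem s) {1..num I}) \<and>
        t1 + (t2 + (t3 + t)) \<le> algorithm_cost * time_scale I)"
    proof (rule ht_seq, rule ht_conseq[OF cs.weights_ht])
      show "frame I s3" "rows I s3 (num I)" "array I s3 Opt0 = array I s3 Opt0" "array I s3 Opt1 = array I s3 Opt1"
        "array I s3 Cyc = array I s3 Cyc" "\<forall>i\<in>{1..num I}. array I s3 Cyc i < num I" "2 \<le> num I"
        using s3 n by auto
      fix t4 s4
      assume s4: "var s4 0 = num I \<and> var s4 vq = var s3 vq \<and> imem s4 = imem s3 \<and>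
        (\<forall>S \<subseteq> {..<num I}. wvar s4 0 + quad (quad_of I s4) S = cost I (cs.sol S)) \<and>
        t4 \<le> weights_cost * (num I + 1)"
      have q4: "var s4 vq = q" "q \<le> num I" using s3 s4 by (auto simp: q_def)
      interpret tb: tables I s4
        using s3 s4 q4 by unfold_locales (auto simp: rows_def)
      have total: "tb.total m = cost I (cs.sol (set_decode m))" if "m < 2 ^ q" for m
      proof -
        have "set_decode m \<subseteq> {..<num I}" using set_decode_less[OF that] q4(2) by auto
        then show ?thesis using s4 unfolding tb.total_def by blast
      qed
      have tables: "ht s4 tables_prog (\<lambda>t s'. tb.tabulated q s' \<and> t \<le> tb.tables_cost * 2 ^ q)"
        using tb.tables_ht s4 q4 by simp
      show "ht s4 (tables_prog ;; argmin_prog ;; decode_prog ;; output_prog)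
        (\<lambda>t s. optimal I (restrict (imem s) {1..num I}) \<and>
          t1 + (t2 + (t3 + (t4 + t))) \<le> algorithm_cost * time_scale I)"
      proof (rule ht_seq, rule ht_conseq[OF tables], rule ht_seq, rule ht_conseq[OF tb.argmin_ht[of q]], simp)
        fix t5 s5 t6 s6
        assume t5: "tb.tabulated q s5 \<and> t5 \<le> tb.tables_cost * 2 ^ q"
          and s6: "tb.tabulated q s6 \<and> var s6 vb < 2 ^ q \<and>
            (\<forall>m<2 ^ q. tb.total (var s6 vb) \<le> tb.total m) \<and> t6 \<le> tb.argmin_cost * (2 ^ q + 1)"
        define m where "m = var s6 vb"
        \<comment> \<open>No phase so far has written to \<open>Bit\<close>, so the decoded set
          starts empty.\<close>
        have "array I s6 Bit = (\<lambda>_. 0)"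
          using s6 s4 s3 by (auto simp: tb.tabulated_def frame_def)
        then have dec: "decode_inv I s6 q m q s6"
          using s6 by (auto simp: decode_inv_def same_choices_def bits_def m_def tb.tabulated_def)
        have same: "array I s6 k = array I s3 k" if "k \<noteq> Pow" for k
          using s6 s4 that by (simp add: tb.tabulated_def)
        show "ht s6 (decode_prog ;; output_prog)
          (\<lambda>t s. optimal I (restrict (imem s) {1..num I}) \<and>
            t1 + (t2 + (t3 + (t4 + (t5 + (t6 + t))))) \<le> algorithm_cost * time_scale I)"
        proof (rule ht_seq, rule ht_conseq[OF decode_ht[OF dec]])
          fix t7 s7
          assume s7: "same_choices I s6 s7 \<and> bits I s7 = set_decode m \<and> t7 \<le> decode_cost * (q + 1)"
          show "ht s7 output_prog
            (\<lambda>t s. optimal I (restrict (imem s) {1..num I}) \<and>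
              t1 + (t2 + (t3 + (t4 + (t5 + (t6 + (t7 + t)))))) \<le>
                algorithm_cost * time_scale I)"
          proof (rule ht_conseq[OF output_ht])
            show "var s7 0 = num I" using s7 by (simp add: same_choices_def)
            fix t8 s8
            assume s8: "(\<forall>j\<in>{1..num I}. imem s8 j =
                (if array I s7 Cyc j \<in> bits I s7 then array I s7 Opt1 j else array I s7 Opt0 j)) \<and>
              t8 \<le> output_cost * (num I + 1)"
            have "imem s8 j = cs.choice (set_decode m) j" if "j \<in> {1..num I}" for j
              using s8 s7 same that by (simp add: same_choices_def cs.choice_def)
            then have "restrict (imem s8) {1..num I} = cs.sol (set_decode m)"
              by (auto simp: cs.sol_def restrict_def)
            moreover have "optimal I (cs.sol (set_decode m))"
            proof (rule cs.optimal_sol)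
              fix S assume "S \<subseteq> {..<q}"
              then obtain k where k: "k < 2 ^ q" "S = set_decode k" using subset_set_decode by blast
              have "m < 2 ^ q" "tb.total m \<le> tb.total k" using s6 k(1) unfolding m_def by blast+
              then show "cost I (cs.sol (set_decode m)) \<le> cost I (cs.sol S)"
                using total k by metis
            qed
            moreover have "t1 + (t2 + (t3 + (t4 + (t5 + (t6 + (t7 + t8)))))) \<le>
                algorithm_cost * time_scale I"
            proof -
              define Z where "Z = time_scale I"
              have "(2::nat) ^ q \<le> 2 ^ num_cycles I"
                using cs.cycles_le_num_cycles by (intro power_increasing) auto
              \<comment> \<open>Without cycles the product vanishes, and the summand
                \<open>num I\<close> has to pay for \<open>2 ^ 0\<close>.\<close>
              moreover have "(2::nat) ^ num_cycles I \<le> Z"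
                using n by (cases "num_cycles I") (auto simp: Z_def)
              ultimately have "2 ^ q \<le> Z" by linarith
              moreover have "q < 2 ^ q" by simp
              moreover have "num I + 1 \<le> 2 * Z" "2 \<le> Z" using n by (auto simp: Z_def)
              ultimately have Z: "2 ^ q \<le> 2 * Z" "2 ^ q + 1 \<le> 2 * Z" "q + 1 \<le> 2 * Z" "num I + 1 \<le> 2 * Z"
                by linarith+
              have "t1 + t2 + t3 + t4 + t8 \<le> linear_cost * (num I + 1)"
                using 8 s3 s4 s8 unfolding linear_cost_def add_mult_distrib by linarith
              also have "\<dots> \<le> linear_cost * (2 * Z)" using Z(4) by (rule mult_le_mono2)
              finally have "t1 + t2 + t3 + t4 + t8 \<le> linear_cost * (2 * Z)" .
              moreover have "t5 \<le> tb.tables_cost * (2 * Z)" "t6 \<le> tb.argmin_cost * (2 * Z)" "t7 \<le> decode_cost * (2 * Z)"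
                using t5 s6 s7 mult_le_mono2[OF Z(1)] mult_le_mono2[OF Z(2)] mult_le_mono2[OF Z(3)]
                by (meson order_trans)+
              ultimately have "t1 + (t2 + (t3 + (t4 + (t5 + (t6 + (t7 + t8)))))) \<le>
                  (linear_cost + tb.tables_cost + tb.argmin_cost + decode_cost) * (2 * Z)"
                unfolding add_mult_distrib by linarith
              also have "\<dots> = algorithm_cost * Z" by (simp only: algorithm_cost_def mult_ac)
              finally show ?thesis by (simp only: Z_def)
            qed
            ultimately show "optimal I (restrict (imem s8) {1..num I}) \<and>
              t1 + (t2 + (t3 + (t4 + (t5 + (t6 + (t7 + t8)))))) \<le>
                algorithm_cost * time_scale I" by simp
          qed
        qed
      qed
    qed
  qed
qed auto

theorem mainTheorem1:
  "\<exists>(p :: instr list) (C :: nat). \<forall>I. tspvr_instance I \<and> feasible I \<and> 2 \<le> num I \<longrightarrow>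
     (\<exists>t \<le> C * (num_cycles I * 2 ^ num_cycles I + num I).
        halted p ((step p ^^ t) (init I)) \<and>
        optimal I (ram_output I ((step p ^^ t) (init I))))"
proof (rule exI[of _ "com_code algorithm 0"], rule exI[of _ algorithm_cost], intro allI impI)
  fix I assume I: "tspvr_instance I \<and> feasible I \<and> 2 \<le> num I"
  let ?p = "com_code algorithm 0"
  interpret feasible_instance I using I by unfold_locales auto
  obtain t s where run: "runs algorithm (start I) t s" and opt: "optimal I (restrict (imem s) {1..num I})"
    and t: "t \<le> algorithm_cost * (num_cycles I * 2 ^ num_cycles I + num I)"
    using algorithm_ht I unfolding ht_def by blast
  \<comment> \<open>Machine and store start from the same input with all registers zero. The code
    fills the whole program from address 0, so reaching its end means halting.\<close>
  have "implements (init I) (start I)" "pc (init I) = 0"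
    by (simp_all add: implements_def init_def start_def)
  moreover have "code_at ?p 0 ?p" by (simp add: code_at_def)
  ultimately have "implements ((step ?p ^^ t) (init I)) s \<and> pc ((step ?p ^^ t) (init I)) = length ?p"
    using com_code_sound[OF run algorithm_ok, of "init I" ?p] by simp
  then show "\<exists>t \<le> algorithm_cost * (num_cycles I * 2 ^ num_cycles I + num I).
      halted ?p ((step ?p ^^ t) (init I)) \<and> optimal I (ram_output I ((step ?p ^^ t) (init I)))"
    using t opt by (intro exI[of _ t]) (simp add: halted_def ram_output_def implements_def)
qed

end
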